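(* Let $f\colon N\to M$ be an immersion of an oriented 5-manifold $N$ into a 6-manifold $M$ with an $\mathrm{SU}(3)$-structure $(F,\Psi_+,\Psi_-)$, and let $\mathbb U$ be the unit normal vector field along $f$. If the $\mathrm{SU}(3)$-structure is balanced, i.e. $d(F\wedge F)=0$, $d\Psi_+=0$ and $d\Psi_-=0$, then the induced $\mathrm{SU}(2)$-structure on $N$ given by $$\eta=-i_{\mathbb U}F,\qquad \omega_1=i_{\mathbb U}\Psi_-,\qquad \omega_2=-i_{\mathbb U}\Psi_+,\qquad \omega_3=f^*F$$ (where the contractions by $\mathbb U$ are understood as pulled back to $N$ by $f$) is balanced, i.e. $d(\omega_1\wedge\eta)=d(\omega_2\wedge\eta)=d(\omega_3\wedge\omega_3)=0$.
   Context: An $\mathrm{SU}(3)$-structure on a 6-manifold $M$ is given by a 2-form $F$ and a complex 3-form $\Psi=\Psi_++i\Psi_-$ for which locally there is a basis of 1-forms $e^1,\dots,e^6$ with $F=e^{12}+e^{34}+e^{56}$ and $\Psi=(e^1+ie^2)\wedge(e^3+ie^4)\wedge(e^5+ie^6)$, where $e^{ij}=e^i\wedge e^j$; it determines an orientation, a Riemannian metric (with the $e^i$ orthonormal) and an almost complex structure. The unit normal $\mathbb U$ is determined by this metric and the orientations of $N$ and $M$. The $\mathrm{SU}(3)$-structure is balanced if $F\wedge F$ and $\Psi$ are closed. An $\mathrm{SU}(2)$-structure on a 5-manifold $N$ is a quadruplet $(\eta,\omega_1,\omega_2,\omega_3)$, where $\eta$ is a 1-form and the $\omega_i$ are 2-forms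 such that $\omega_i\wedge\omega_j=\delta_{ij}v$ for some 4-form $v$ with $v\wedge\eta$ nowhere zero, and such that $i_X\omega_3=i_Y\omega_1$ implies $\omega_2(X,Y)\ge0$ (here $i_X$ is contraction by $X$). It is called balanced if $d(\omega_1\wedge\eta)=d(\omega_2\wedge\eta)=d(\omega_3\wedge\omega_3)=0$. *)

theory Defs
  imports "HOL-Analysis.Analysis" "HOL-Combinatorics.Permutations"
begin

section \<open>Smooth manifolds\<close>

text \<open>Differentiability of class \<open>C^k\<close> on an open set \<open>S\<close>, with every iterated directional derivative
  required to exist and to be continuous.\<close>

primrec Ck_on :: "nat \<Rightarrow> 'e::real_normed_vector set \<Rightarrow> ('e \<Rightarrow> 'f::real_normed_vector) \<Rightarrow> bool" where
  "Ck_on 0 S f \<longleftrightarrow> continuous_on S f"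
| "Ck_on (Suc k) S f \<longleftrightarrow> (\<forall>x\<in>S. f differentiable (at x)) \<and>
     (\<forall>v. Ck_on k S (\<lambda>x. frechet_derivative f (at x) v))"

definition smooth_on :: "'e::real_normed_vector set \<Rightarrow> ('e \<Rightarrow> 'f::real_normed_vector) \<Rightarrow> bool" where
  "smooth_on S f \<longleftrightarrow> (\<forall>k. Ck_on k S f)"

text \<open>A chart is a pair of its domain and its coordinate map; the values of the map outside the domain
  are irrelevant. A manifold is a topological space with an atlas (not necessarily maximal); its
  points are the elements of \<open>topspace (mtop M)\<close>.\<close>

type_synonym ('a, 'e) chart = "'a set \<times> ('a \<Rightarrow> 'e)"

record ('a, 'e) manifold =
  mtop :: "'a topology"
  charts :: "('a, 'e) chart set"

definition chart_inv :: "('a, 'e) chart \<Rightarrow> 'e \<Rightarrow> 'a" where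
  "chart_inv c = inv_into (fst c) (snd c)"

definition is_chart :: "'a topology \<Rightarrow> ('a, 'e::euclidean_space) chart \<Rightarrow> bool" where
  "is_chart X c \<longleftrightarrow> openin X (fst c) \<and> open (snd c ` fst c) \<and>
     homeomorphic_map (subtopology X (fst c)) (top_of_set (snd c ` fst c)) (snd c)"

definition smooth_manifold :: "('a, 'e::euclidean_space) manifold \<Rightarrow> bool" where
  "smooth_manifold M \<longleftrightarrow>
     Hausdorff_space (mtop M) \<and> second_countable (mtop M) \<and>
     (\<forall>c\<in>charts M. is_chart (mtop M) c) \<and>
     (\<Union>c\<in>charts M. fst c) = topspace (mtop M) \<and>
     (\<forall>c\<in>charts M. \<forall>d\<in>charts M. smooth_on (snd c ` (fst c \<inter> fst d)) (snd d \<circ> chart_inv c))"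

definition charts_at :: "('a, 'e) manifold \<Rightarrow> 'a \<Rightarrow> ('a, 'e) chart set" where
  "charts_at M p = {c \<in> charts M. p \<in> fst c}"

definition some_chart :: "('a, 'e) manifold \<Rightarrow> 'a \<Rightarrow> ('a, 'e) chart" where
  "some_chart M p = (SOME c. c \<in> charts_at M p)"


section \<open>Tangent vectors\<close>

text \<open>A tangent vector at \<open>p\<close> is the family of its coordinate vectors in the charts around \<open>p\<close>, which
  are related by the differentials of the transition maps. The components at
  all other arguments are set to 0, so that distinct families are distinct tangent vectors.\<close>

type_synonym ('a, 'e) tangent = "('a, 'e) chart \<Rightarrow> 'e"

definition tangent_space ::
    "('a, 'e::euclidean_space) manifold \<Rightarrow> 'a \<Rightarrow> ('a, 'e) tangent set" where
  "tangent_space M p =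
     {v. (\<forall>c\<in>charts_at M p. \<forall>d\<in>charts_at M p.
            v d = frechet_derivative (snd d \<circ> chart_inv c) (at (snd c p)) (v c)) \<and>
         (\<forall>c. c \<notin> charts_at M p \<longrightarrow> v c = 0)}"

text \<open>The tangent vector at \<open>p\<close> with coordinates \<open>x\<close> in the chart \<open>c\<close>.\<close>

definition tangent_of ::
    "('a, 'e::euclidean_space) manifold \<Rightarrow> ('a, 'e) chart \<Rightarrow> 'a \<Rightarrow> 'e \<Rightarrow> ('a, 'e) tangent" where
  "tangent_of M c p x = (\<lambda>d. if d \<in> charts_at M p
     then frechet_derivative (snd d \<circ> chart_inv c) (at (snd c p)) x else 0)"


section \<open>Differential forms\<close>

text \<open>A \<open>k\<close>-form is evaluated at a point on a list of \<open>k\<close> tangent vectors at that point. Values on any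
  other lists are irrelevant, so forms are compared by \<open>form_eq\<close>.\<close>

type_synonym ('a, 'e, 'b) form = "'a \<Rightarrow> ('a, 'e) tangent list \<Rightarrow> 'b"

definition tangent_lists ::
    "('a, 'e::euclidean_space) manifold \<Rightarrow> nat \<Rightarrow> 'a \<Rightarrow> ('a, 'e) tangent list set" where
  "tangent_lists M k p = {vs. length vs = k \<and> set vs \<subseteq> tangent_space M p}"

definition form_eq ::
    "('a, 'e::euclidean_space) manifold \<Rightarrow> 'a set \<Rightarrow> nat \<Rightarrow>
     ('a, 'e, 'b) form \<Rightarrow> ('a, 'e, 'b) form \<Rightarrow> bool" where
  "form_eq M S k \<alpha> \<beta> \<longleftrightarrow> (\<forall>p\<in>S. \<forall>vs\<in>tangent_lists M k p. \<alpha> p vs = \<beta> p vs)"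

definition alternating_form_at ::
    "('a, 'e::euclidean_space) manifold \<Rightarrow> 'a \<Rightarrow> nat \<Rightarrow> (('a, 'e) tangent list \<Rightarrow> real) \<Rightarrow> bool" where
  "alternating_form_at M p k a \<longleftrightarrow>
     (\<forall>vs\<in>tangent_lists M k p.
        (\<forall>i<k. \<forall>v\<in>tangent_space M p. \<forall>w\<in>tangent_space M p. \<forall>r s.
           a (vs[i := (\<lambda>c. r *\<^sub>R v c + s *\<^sub>R w c)]) = r * a (vs[i := v]) + s * a (vs[i := w])) \<and>
        (\<forall>i<k. \<forall>j<k. i \<noteq> j \<and> vs ! i = vs ! j \<longrightarrow> a vs = 0))"

text \<open>The component of \<open>\<alpha>\<close> in the chart \<open>c\<close> for the constant coordinate vectors \<open>xs\<close>, as a function of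
  the coordinates.\<close>

definition local_coeff ::
    "('a, 'e::euclidean_space) manifold \<Rightarrow> ('a, 'e) chart \<Rightarrow> ('a, 'e, 'b) form \<Rightarrow> 'e list \<Rightarrow> 'e \<Rightarrow> 'b" where
  "local_coeff M c \<alpha> xs = (\<lambda>y. \<alpha> (chart_inv c y) (map (tangent_of M c (chart_inv c y)) xs))"

text \<open>Smooth \<open>k\<close>-forms on the open subset \<open>S\<close> of \<open>M\<close>.\<close>

definition smooth_form ::
    "('a, 'e::euclidean_space) manifold \<Rightarrow> 'a set \<Rightarrow> nat \<Rightarrow> ('a, 'e, real) form \<Rightarrow> bool" where
  "smooth_form M S k \<alpha> \<longleftrightarrow>
     (\<forall>p\<in>S. alternating_form_at M p k (\<alpha> p)) \<and>
     (\<forall>c\<in>charts M. \<forall>xs. length xs = k \<longrightarrow> smooth_on (snd c ` (fst c \<inter> S)) (local_coeff M c \<alpha> xs))"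

text \<open>Wedge product of a \<open>k\<close>-form and an \<open>l\<close>-form, real or complex valued, normalized so that
  \<open>(\<alpha> \<and> \<beta>)(X, Y) = \<alpha>(X) \<beta>(Y) - \<alpha>(Y) \<beta>(X)\<close> for 1-forms.\<close>

definition wedge ::
    "nat \<Rightarrow> nat \<Rightarrow> ('a, 'e, 'b::field_char_0) form \<Rightarrow> ('a, 'e, 'b) form \<Rightarrow> ('a, 'e, 'b) form" where
  "wedge k l \<alpha> \<beta> = (\<lambda>p vs.
     (\<Sum>\<sigma> | \<sigma> permutes {..<k + l}. of_int (sign \<sigma>) *
        \<alpha> p (map (\<lambda>i. vs ! \<sigma> i) [0..<k]) * \<beta> p (map (\<lambda>i. vs ! \<sigma> i) [k..<k + l]))
     / (fact k * fact l))"

definition form_sum :: "('a, 'e, 'b::plus) form \<Rightarrow> ('a, 'e, 'b) form \<Rightarrow> ('a, 'e, 'b) form" where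
  "form_sum \<alpha> \<beta> = (\<lambda>p vs. \<alpha> p vs + \<beta> p vs)"

definition form_minus :: "('a, 'e, 'b::uminus) form \<Rightarrow> ('a, 'e, 'b) form" where
  "form_minus \<alpha> = (\<lambda>p vs. - \<alpha> p vs)"

definition zero_form :: "('a, 'e, 'b::zero) form" where
  "zero_form = (\<lambda>p vs. 0)"

definition complex_form :: "('a, 'e, real) form \<Rightarrow> ('a, 'e, real) form \<Rightarrow> ('a, 'e, complex) form" where
  "complex_form \<alpha> \<beta> = (\<lambda>p vs. Complex (\<alpha> p vs) (\<beta> p vs))"

text \<open>Exterior derivative of a \<open>k\<close>-form, computed in a chart around the point (for smooth forms
  the choice does not matter) from
  \<open>d\<alpha>(X_0, ..., X_k) = \<Sum>_i (-1)^i X_i(\<alpha>(X_0, ..., X_(i-1), X_(i+1), ..., X_k))\<close>,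
  where the \<open>X_j\<close> are extended to have constant coordinates.\<close>

definition ext_deriv ::
    "('a, 'e::euclidean_space) manifold \<Rightarrow> nat \<Rightarrow> ('a, 'e, real) form \<Rightarrow> ('a, 'e, real) form" where
  "ext_deriv M k \<alpha> = (\<lambda>p vs. let c = some_chart M p; xs = map (\<lambda>v. v c) vs in
     \<Sum>i\<le>k. (- 1) ^ i *
       frechet_derivative (local_coeff M c \<alpha> (take i xs @ drop (Suc i) xs)) (at (snd c p)) (xs ! i))"

definition closed_form ::
    "('a, 'e::euclidean_space) manifold \<Rightarrow> nat \<Rightarrow> ('a, 'e, real) form \<Rightarrow> bool" where
  "closed_form M k \<alpha> \<longleftrightarrow> form_eq M (topspace (mtop M)) (Suc k) (ext_deriv M k \<alpha>) zero_form"

text \<open>An orientation of an \<open>n\<close>-manifold is given by a nowhere vanishing \<open>n\<close>-form \<open>\<nu>\<close>; a basis \<open>vs\<close> of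
  the tangent space at \<open>p\<close> is then positive iff \<open>\<nu> p vs > 0\<close>.\<close>

definition orientation_form ::
    "('a, 'e::euclidean_space) manifold \<Rightarrow> ('a, 'e, real) form \<Rightarrow> bool" where
  "orientation_form M \<nu> \<longleftrightarrow> smooth_form M (topspace (mtop M)) DIM('e) \<nu> \<and>
     (\<forall>p\<in>topspace (mtop M). \<exists>vs\<in>tangent_lists M DIM('e) p. \<nu> p vs \<noteq> 0)"


section \<open>Smooth maps and immersions\<close>

definition smooth_map ::
    "('a, 'e::euclidean_space) manifold \<Rightarrow> ('b, 'f::euclidean_space) manifold \<Rightarrow> ('a \<Rightarrow> 'b) \<Rightarrow> bool" where
  "smooth_map N M f \<longleftrightarrow> continuous_map (mtop N) (mtop M) f \<and>
     (\<forall>c\<in>charts N. \<forall>d\<in>charts M. smooth_on (snd c ` (fst c \<inter> f -` fst d)) (snd d \<circ> f \<circ> chart_inv c))"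

definition differential ::
    "('a, 'e::euclidean_space) manifold \<Rightarrow> ('b, 'f::euclidean_space) manifold \<Rightarrow> ('a \<Rightarrow> 'b) \<Rightarrow>
     'a \<Rightarrow> ('a, 'e) tangent \<Rightarrow> ('b, 'f) tangent" where
  "differential N M f p v = (let c = some_chart N p in
     (\<lambda>d. if d \<in> charts_at M (f p)
          then frechet_derivative (snd d \<circ> f \<circ> chart_inv c) (at (snd c p)) (v c) else 0))"

definition immersion ::
    "('a, 'e::euclidean_space) manifold \<Rightarrow> ('b, 'f::euclidean_space) manifold \<Rightarrow> ('a \<Rightarrow> 'b) \<Rightarrow> bool" where
  "immersion N M f \<longleftrightarrow> smooth_map N M f \<and>
     (\<forall>p\<in>topspace (mtop N). inj_on (differential N M f p) (tangent_space N p))"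

definition pullback_form ::
    "('a, 'e::euclidean_space) manifold \<Rightarrow> ('b, 'f::euclidean_space) manifold \<Rightarrow> ('a \<Rightarrow> 'b) \<Rightarrow>
     ('b, 'f, real) form \<Rightarrow> ('a, 'e, real) form" where
  "pullback_form N M f \<alpha> = (\<lambda>p vs. \<alpha> (f p) (map (differential N M f p) vs))"

text \<open>Smooth sections of \<open>f^* TM\<close>.\<close>

definition vector_field_along ::
    "('a, 'e::euclidean_space) manifold \<Rightarrow> ('b, 'f::euclidean_space) manifold \<Rightarrow> ('a \<Rightarrow> 'b) \<Rightarrow>
     ('a \<Rightarrow> ('b, 'f) tangent) \<Rightarrow> bool" where
  "vector_field_along N M f U \<longleftrightarrow>
     (\<forall>p\<in>topspace (mtop N). U p \<in> tangent_space M (f p)) \<and>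
     (\<forall>c\<in>charts N. \<forall>d\<in>charts M.
        smooth_on (snd c ` (fst c \<inter> f -` fst d)) (\<lambda>y. U (chart_inv c y) d))"

text \<open>The contraction \<open>i_U \<alpha>\<close>, pulled back to \<open>N\<close>.\<close>

definition contract_along ::
    "('a, 'e::euclidean_space) manifold \<Rightarrow> ('b, 'f::euclidean_space) manifold \<Rightarrow> ('a \<Rightarrow> 'b) \<Rightarrow>
     ('a \<Rightarrow> ('b, 'f) tangent) \<Rightarrow> ('b, 'f, real) form \<Rightarrow> ('a, 'e, real) form" where
  "contract_along N M f U \<alpha> = (\<lambda>p vs. \<alpha> (f p) (U p # map (differential N M f p) vs))"


section \<open>SU(3)-structures on 6-manifolds\<close>

text \<open>The coframe is \<open>e 1, ..., e 6\<close>; in dimension 6 linear independence makes it a basis.\<close>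

definition adapted_coframe ::
    "('a, real^6) manifold \<Rightarrow> ('a, real^6, real) form \<Rightarrow> ('a, real^6, real) form \<Rightarrow>
     ('a, real^6, real) form \<Rightarrow> 'a set \<Rightarrow> (nat \<Rightarrow> ('a, real^6, real) form) \<Rightarrow> bool" where
  "adapted_coframe M F \<Psi>p \<Psi>m S e \<longleftrightarrow>
     openin (mtop M) S \<and>
     (\<forall>i\<in>{1..6}. smooth_form M S 1 (e i)) \<and>
     (\<forall>p\<in>S. \<forall>a :: nat \<Rightarrow> real. (\<forall>v\<in>tangent_space M p. (\<Sum>i=1..6. a i * e i p [v]) = 0) \<longrightarrow>
        (\<forall>i\<in>{1..6}. a i = 0)) \<and>
     form_eq M S 2 F
       (form_sum (form_sum (wedge 1 1 (e 1) (e 2)) (wedge 1 1 (e 3) (e 4))) (wedge 1 1 (e 5) (e 6))) \<and>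
     form_eq M S 3 (complex_form \<Psi>p \<Psi>m)
       (wedge 2 1 (wedge 1 1 (complex_form (e 1) (e 2)) (complex_form (e 3) (e 4)))
          (complex_form (e 5) (e 6)))"

definition SU3_structure ::
    "('a, real^6) manifold \<Rightarrow> ('a, real^6, real) form \<Rightarrow> ('a, real^6, real) form \<Rightarrow>
     ('a, real^6, real) form \<Rightarrow> bool" where
  "SU3_structure M F \<Psi>p \<Psi>m \<longleftrightarrow>
     smooth_form M (topspace (mtop M)) 2 F \<and>
     smooth_form M (topspace (mtop M)) 3 \<Psi>p \<and>
     smooth_form M (topspace (mtop M)) 3 \<Psi>m \<and>
     (\<forall>p\<in>topspace (mtop M). \<exists>S e. p \<in> S \<and> adapted_coframe M F \<Psi>p \<Psi>m S e)"

definition balanced_SU3_structure ::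
    "('a, real^6) manifold \<Rightarrow> ('a, real^6, real) form \<Rightarrow> ('a, real^6, real) form \<Rightarrow>
     ('a, real^6, real) form \<Rightarrow> bool" where
  "balanced_SU3_structure M F \<Psi>p \<Psi>m \<longleftrightarrow> SU3_structure M F \<Psi>p \<Psi>m \<and>
     closed_form M 4 (wedge 2 2 F F) \<and> closed_form M 3 \<Psi>p \<and> closed_form M 3 \<Psi>m"

text \<open>The metric for which adapted coframes are orthonormal. Any two adapted coframes differ
  by an SU(3)-valued function, so the value does not depend on the coframe.\<close>

definition SU3_metric ::
    "('a, real^6) manifold \<Rightarrow> ('a, real^6, real) form \<Rightarrow> ('a, real^6, real) form \<Rightarrow>
     ('a, real^6, real) form \<Rightarrow> 'a \<Rightarrow> ('a, real^6) tangent \<Rightarrow> ('a, real^6) tangent \<Rightarrow> real" where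
  "SU3_metric M F \<Psi>p \<Psi>m p v w =
     (THE r. \<exists>S e. p \<in> S \<and> adapted_coframe M F \<Psi>p \<Psi>m S e \<and> r = (\<Sum>i=1..6. e i p [v] * e i p [w]))"

text \<open>Positivity of a basis \<open>vs\<close> of the tangent space at \<open>p\<close> for the orientation \<open>e^123456\<close>, i.e.
  positivity of the determinant of \<open>(e^i(v_j))\<close>.\<close>

definition SU3_positive ::
    "('a, real^6) manifold \<Rightarrow> ('a, real^6, real) form \<Rightarrow> ('a, real^6, real) form \<Rightarrow>
     ('a, real^6, real) form \<Rightarrow> 'a \<Rightarrow> ('a, real^6) tangent list \<Rightarrow> bool" where
  "SU3_positive M F \<Psi>p \<Psi>m p vs \<longleftrightarrow>
     (\<exists>S e. p \<in> S \<and> adapted_coframe M F \<Psi>p \<Psi>m S e \<and>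
        0 < (\<Sum>\<sigma> | \<sigma> permutes {..<6}. of_int (sign \<sigma>) * (\<Prod>i<6. e (Suc i) p [vs ! \<sigma> i])))"

text \<open>The unit normal along an immersion of a 5-manifold oriented by \<open>\<nu>\<close>, with the convention that
  the normal comes first: \<open>(U, f_* v_1, ..., f_* v_5)\<close> is positive if \<open>(v_1, ..., v_5)\<close> is.\<close>

definition unit_normal_field ::
    "('a, real^5) manifold \<Rightarrow> ('a, real^5, real) form \<Rightarrow> ('b, real^6) manifold \<Rightarrow>
     ('b, real^6, real) form \<Rightarrow> ('b, real^6, real) form \<Rightarrow> ('b, real^6, real) form \<Rightarrow>
     ('a \<Rightarrow> 'b) \<Rightarrow> ('a \<Rightarrow> ('b, real^6) tangent) \<Rightarrow> bool" where
  "unit_normal_field N \<nu> M F \<Psi>p \<Psi>m f U \<longleftrightarrow>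
     vector_field_along N M f U \<and>
     (\<forall>p\<in>topspace (mtop N).
        SU3_metric M F \<Psi>p \<Psi>m (f p) (U p) (U p) = 1 \<and>
        (\<forall>v\<in>tangent_space N p. SU3_metric M F \<Psi>p \<Psi>m (f p) (U p) (differential N M f p v) = 0) \<and>
        (\<forall>vs\<in>tangent_lists N 5 p. 0 < \<nu> p vs \<longrightarrow>
           SU3_positive M F \<Psi>p \<Psi>m (f p) (U p # map (differential N M f p) vs)))"


section \<open>SU(2)-structures on 5-manifolds\<close>

definition SU2_structure ::
    "('a, real^5) manifold \<Rightarrow> ('a, real^5, real) form \<Rightarrow> ('a, real^5, real) form \<Rightarrow>
     ('a, real^5, real) form \<Rightarrow> ('a, real^5, real) form \<Rightarrow> bool" where
  "SU2_structure N \<eta> \<omega>1 \<omega>2 \<omega>3 \<longleftrightarrow>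
     (let P = topspace (mtop N); \<omega> = (\<lambda>i::nat. if i = 1 then \<omega>1 else if i = 2 then \<omega>2 else \<omega>3) in
       smooth_form N P 1 \<eta> \<and> (\<forall>i\<in>{1..3}. smooth_form N P 2 (\<omega> i)) \<and>
       (\<exists>v. smooth_form N P 4 v \<and>
          (\<forall>i\<in>{1..3}. \<forall>j\<in>{1..3}.
             form_eq N P 4 (wedge 2 2 (\<omega> i) (\<omega> j)) (if i = j then v else zero_form)) \<and>
          (\<forall>p\<in>P. \<exists>vs\<in>tangent_lists N 5 p. wedge 4 1 v \<eta> p vs \<noteq> 0)) \<and>
       (\<forall>p\<in>P. \<forall>X\<in>tangent_space N p. \<forall>Y\<in>tangent_space N p.
          (\<forall>Z\<in>tangent_space N p. \<omega>3 p [X, Z] = \<omega>1 p [Y, Z]) \<longrightarrow> 0 \<le> \<omega>2 p [X, Y]))"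

definition balanced_SU2_structure ::
    "('a, real^5) manifold \<Rightarrow> ('a, real^5, real) form \<Rightarrow> ('a, real^5, real) form \<Rightarrow>
     ('a, real^5, real) form \<Rightarrow> ('a, real^5, real) form \<Rightarrow> bool" where
  "balanced_SU2_structure N \<eta> \<omega>1 \<omega>2 \<omega>3 \<longleftrightarrow> SU2_structure N \<eta> \<omega>1 \<omega>2 \<omega>3 \<and>
     closed_form N 3 (wedge 2 1 \<omega>1 \<eta>) \<and> closed_form N 3 (wedge 2 1 \<omega>2 \<eta>) \<and>
     closed_form N 4 (wedge 2 2 \<omega>3 \<omega>3)"

end

theory Submission
  imports Defs
begin

text \<open>At a point of \<open>N\<close> two rotations in \<open>SU(2)\<close> turn an adapted coframe of \<open>M\<close> into one in which
  \<open>U\<close> has the coordinates \<open>(1, 0, 0)\<close> in \<open>\<complex>\<^sup>3\<close>. A tangent vector of \<open>N\<close> is then mapped to \<open>(\<i> t, z, w)\<close> with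
  \<open>t\<close> real, and \<open>\<eta> = - t\<close>, \<open>\<omega>\<^sub>3(u, v) = Im (cnj (z u) (z v) + cnj (w u) (w v))\<close> and
  \<open>- \<omega>\<^sub>2 + \<i> \<omega>\<^sub>1 = z \<and> w\<close>. In these coordinates the conditions on an \<open>SU(2)\<close>-structure as well as
  \<open>\<omega>\<^sub>1 \<and> \<eta> = f\<^sup>* \<Psi>\<^sub>+\<close>, \<open>\<omega>\<^sub>2 \<and> \<eta> = f\<^sup>* \<Psi>\<^sub>-\<close> and \<open>\<omega>\<^sub>3 \<and> \<omega>\<^sub>3 = f\<^sup>* (F \<and> F)\<close> are polynomial
  identities, and the three forms are closed because \<open>d\<close> commutes with \<open>f\<^sup>*\<close>.\<close>

section \<open>Functions of class \<open>C^k\<close>\<close>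

text \<open>The normal form is produced at one point at a time, without a smooth choice of rotated
  coframe, because derivatives never touch it: the only differential input is that \<open>d\<close>
  commutes with pullback, applied to the globally defined forms \<open>\<Psi>p\<close>,
  \<open>\<Psi>m\<close> and \<open>wedge 2 2 F F\<close>, and everything else compares values of
  forms at a point. The rotations need determinant one, as a general unitary change would multiply
  \<open>\<Psi>\<close> by a phase. Since the metric is a definite description over adapted
  coframes, its value must be shown independent of the coframe before it can be evaluated in the
  rotated one. The two product formulas have a common source: the restriction of
  \<open>\<Psi>\<close> to \<open>N\<close> is \<open>\<i> t \<and> z \<and> w = \<i> t \<and> (-
  \<omega>2 + \<i> \<omega>1) = (\<omega>1 + \<i> \<omega>2) \<and> \<eta>\<close>, because
  \<open>\<eta> = - t\<close>. The analytic obstacle is that \<open>ext_deriv\<close> works with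
  constant coordinate vectors, which the differential of \<open>f\<close> turns into varying ones.
  Second derivatives of the local map then appear, and they cancel only because they are
  symmetric.\<close>

lemma Ck_on_subset: "Ck_on k S f \<Longrightarrow> T \<subseteq> S \<Longrightarrow> Ck_on k T f"
  by (induction k arbitrary: f) (auto intro: continuous_on_subset)

text \<open>A derivative at a point depends on a whole neighbourhood of it, so equality on
  \<open>S\<close> passes to derivatives because \<open>S\<close> is open.\<close>

lemma Ck_on_cong:
  assumes "open S" "\<And>x. x \<in> S \<Longrightarrow> f x = g x" "Ck_on k S f"
  shows "Ck_on k S g"
  using assms(2,3)
proof (induction k arbitrary: f g)
  case 0
  then show ?case by (simp cong: continuous_on_cong)
next
  case (Suc k)
  have d: "f differentiable (at x)" if "x \<in> S" for x using Suc.prems that by simp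
  have e: "frechet_derivative f (at x) = frechet_derivative g (at x)" if "x \<in> S" for x
    using frechet_derivative_transform_within_open[OF d[OF that] assms(1) that] Suc.prems(1) by blast
  have "g differentiable (at x)" if "x \<in> S" for x
    using d[OF that] has_derivative_transform_within_open[OF _ assms(1) that] Suc.prems(1)
    unfolding differentiable_def by blast
  moreover have "Ck_on k S (\<lambda>x. frechet_derivative g (at x) v)" for v
    by (rule Suc.IH[of "\<lambda>x. frechet_derivative f (at x) v"]) (use e Suc.prems(2) in auto)
  ultimately show ?case by simp
qed

text \<open>\<open>Ck_on\<close> asks for continuity only at the last level, so the base case is
  that differentiability implies continuity. The product and chain rules need this lemma, since they
  keep an undifferentiated factor next to a derivative that has lost one order.\<close>

lemma Ck_on_Suc_imp: "Ck_on (Suc k) S f \<Longrightarrow> Ck_on k S f"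
proof (induction k arbitrary: f)
  case 0
  then show ?case
    by (auto intro!: differentiable_imp_continuous_on differentiable_at_imp_differentiable_on)
next
  case (Suc k)
  then show ?case by (metis Ck_on.simps(2))
qed

lemma Ck_on_const: "Ck_on k S (\<lambda>x. c)"
  by (induction k arbitrary: c) auto

lemma Ck_on_add:
  assumes "open S" "Ck_on k S f" "Ck_on k S g"
  shows "Ck_on k S (\<lambda>x. f x + g x)"
  using assms(2,3)
proof (induction k arbitrary: f g)
  case 0
  then show ?case by (simp add: continuous_on_add)
next
  case (Suc k)
  have e: "frechet_derivative (\<lambda>x. f x + g x) (at x) =
      (\<lambda>v. frechet_derivative f (at x) v + frechet_derivative g (at x) v)" if "x \<in> S" for x
    by (rule frechet_derivative_at[symmetric])
      (use Suc.prems that in \<open>auto intro!: has_derivative_add simp: frechet_derivative_works[symmetric]\<close>)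
  have "Ck_on k S (\<lambda>x. frechet_derivative (\<lambda>x. f x + g x) (at x) v)" for v
    by (rule Ck_on_cong[OF assms(1) _ Suc.IH[of "\<lambda>x. frechet_derivative f (at x) v"
            "\<lambda>x. frechet_derivative g (at x) v"]])
      (use Suc.prems in \<open>auto simp: e\<close>)
  then show ?case using Suc.prems by auto
qed

lemma Ck_on_sum:
  assumes "open S" "\<And>i. i \<in> I \<Longrightarrow> Ck_on k S (f i)"
  shows "Ck_on k S (\<lambda>x. \<Sum>i\<in>I. f i x)"
  using assms(2)
  by (induction I rule: infinite_finite_induct) (auto simp: Ck_on_const intro!: Ck_on_add assms(1))

text \<open>The product rule yields two terms, each of them \<open>b\<close> applied to one
  differentiated and one undifferentiated factor, so the induction hypothesis for arbitrary factors
  applies to both. Multiplication, scaling and inner products are instances.\<close>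

lemma Ck_on_bounded_bilinear:
  assumes "bounded_bilinear b" "open S" "Ck_on k S f" "Ck_on k S g"
  shows "Ck_on k S (\<lambda>x. b (f x) (g x))"
  using assms(3,4)
proof (induction k arbitrary: f g)
  case 0
  then show ?case by (simp add: bounded_bilinear.continuous_on[OF assms(1)])
next
  case (Suc k)
  have d: "((\<lambda>x. b (f x) (g x)) has_derivative
      (\<lambda>v. b (f x) (frechet_derivative g (at x) v) + b (frechet_derivative f (at x) v) (g x))) (at x)"
    if "x \<in> S" for x
    by (rule bounded_bilinear.FDERIV[OF assms(1)])
      (use Suc.prems that in \<open>auto simp: frechet_derivative_works[symmetric]\<close>)
  have e: "frechet_derivative (\<lambda>x. b (f x) (g x)) (at x) =
      (\<lambda>v. b (f x) (frechet_derivative g (at x) v) + b (frechet_derivative f (at x) v) (g x))"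
    if "x \<in> S" for x
    using frechet_derivative_at[OF d[OF that]] by simp
  have "Ck_on k S (\<lambda>x. frechet_derivative (\<lambda>x. b (f x) (g x)) (at x) v)" for v
    by (rule Ck_on_cong[OF assms(2) _ Ck_on_add[OF assms(2)
            Suc.IH[of f "\<lambda>x. frechet_derivative g (at x) v"]
            Suc.IH[of "\<lambda>x. frechet_derivative f (at x) v" g]]])
      (use Suc.prems e Ck_on_Suc_imp in auto)
  moreover have "(\<lambda>x. b (f x) (g x)) differentiable (at x)" if "x \<in> S" for x
    using d[OF that] differentiable_def by blast
  ultimately show ?case by simp
qed

lemmas Ck_on_mult = Ck_on_bounded_bilinear[OF bounded_bilinear_mult]
lemmas Ck_on_scaleR = Ck_on_bounded_bilinear[OF bounded_bilinear_scaleR]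
lemmas Ck_on_inner = Ck_on_bounded_bilinear[OF bounded_bilinear_inner]

text \<open>\<open>Ck_on\<close> controls derivatives in a fixed direction. A direction that varies
  with the point is replaced by the fixed basis directions with varying coefficients.\<close>

lemma frechet_derivative_expand:
  fixes g :: "'e::euclidean_space \<Rightarrow> 'f::real_normed_vector"
  assumes "g differentiable (at y)"
  shows "frechet_derivative g (at y) v = (\<Sum>b\<in>Basis. (v \<bullet> b) *\<^sub>R frechet_derivative g (at y) b)"
proof -
  have l: "linear (frechet_derivative g (at y))"
    using assms by (rule linear_frechet_derivative)
  have "frechet_derivative g (at y) v = frechet_derivative g (at y) (\<Sum>b\<in>Basis. (v \<bullet> b) *\<^sub>R b)"
    by (simp add: euclidean_representation)
  then show ?thesis
    by (simp only: linear_sum[OF l] linear_scale[OF l])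
qed

text \<open>The chain rule differentiates \<open>g\<close> in the direction of the derivative of
  \<open>f\<close>, which moves with \<open>x\<close>. After expansion in the basis each summand is
  a coefficient from \<open>f\<close> times a directional derivative of \<open>g\<close> composed
  with \<open>f\<close>, and the latter is covered by the induction hypothesis.\<close>

lemma Ck_on_compose:
  fixes f :: "'d::real_normed_vector \<Rightarrow> 'e::euclidean_space" and g :: "'e \<Rightarrow> 'f::real_normed_vector"
  assumes "open S" "f ` S \<subseteq> T" "Ck_on k S f" "Ck_on k T g"
  shows "Ck_on k S (\<lambda>x. g (f x))"
  using assms(3,4)
proof (induction k arbitrary: g)
  case 0
  then show ?case using assms(2) by (auto intro: continuous_on_compose2)
next
  case (Suc k)
  have df: "f differentiable (at x)" and dg: "g differentiable (at (f x))" if "x \<in> S" for x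
    using Suc.prems that assms(2) by auto
  have e: "frechet_derivative (\<lambda>x. g (f x)) (at x) v =
      (\<Sum>b\<in>Basis. (frechet_derivative f (at x) v \<bullet> b) *\<^sub>R frechet_derivative g (at (f x)) b)"
    if "x \<in> S" for x v
    using frechet_derivative_compose[OF df[OF that] dg[OF that]]
      frechet_derivative_expand[OF dg[OF that], of "frechet_derivative f (at x) v"]
    unfolding o_def by metis
  have "(\<lambda>x. g (f x)) differentiable (at x)" if "x \<in> S" for x
    using differentiable_chain_at[OF df[OF that] dg[OF that]] by (simp add: o_def)
  moreover have "Ck_on k S (\<lambda>x. frechet_derivative (\<lambda>x. g (f x)) (at x) v)" for v
  proof (rule Ck_on_cong[OF assms(1) e[symmetric]])
    show "Ck_on k S (\<lambda>x. \<Sum>b\<in>Basis. (frechet_derivative f (at x) v \<bullet> b) *\<^sub>R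
        frechet_derivative g (at (f x)) b)"
    proof (intro Ck_on_sum Ck_on_scaleR Ck_on_inner assms(1) Ck_on_const)
      show "Ck_on k S (\<lambda>x. frechet_derivative f (at x) v)"
        using Suc.prems(1) by simp
      show "Ck_on k S (\<lambda>x. frechet_derivative g (at (f x)) b)" for b
        using Suc.IH[OF Ck_on_Suc_imp[OF Suc.prems(1)], of "\<lambda>z. frechet_derivative g (at z) b"]
          Suc.prems(2) by simp
    qed
  qed auto
  ultimately show ?case by simp
qed

section \<open>Smooth functions: the rules above for all orders at once\<close>

lemma smooth_on_imp_differentiable: "smooth_on S f \<Longrightarrow> x \<in> S \<Longrightarrow> f differentiable (at x)"
  by (metis Ck_on.simps(2) smooth_on_def)

lemma smooth_on_frechet_derivative:
  "smooth_on S f \<Longrightarrow> smooth_on S (\<lambda>x. frechet_derivative f (at x) v)"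
  unfolding smooth_on_def by (metis Ck_on.simps(2))

lemma smooth_on_const: "smooth_on S (\<lambda>x. c)"
  by (simp add: smooth_on_def Ck_on_const)

lemma smooth_on_mult:
  fixes f g :: "_ \<Rightarrow> 'a::real_normed_algebra"
  shows "open S \<Longrightarrow> smooth_on S f \<Longrightarrow> smooth_on S g \<Longrightarrow> smooth_on S (\<lambda>x. f x * g x)"
  by (simp add: smooth_on_def Ck_on_mult)

lemma smooth_on_sum:
  "open S \<Longrightarrow> (\<And>i. i \<in> I \<Longrightarrow> smooth_on S (f i)) \<Longrightarrow> smooth_on S (\<lambda>x. \<Sum>i\<in>I. f i x)"
  by (simp add: smooth_on_def Ck_on_sum)

lemma smooth_on_inner_const:
  "open S \<Longrightarrow> smooth_on S f \<Longrightarrow> smooth_on S (\<lambda>x. f x \<bullet> c)"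
  by (simp add: smooth_on_def Ck_on_inner Ck_on_const)

lemma smooth_on_compose:
  fixes f :: "'d::real_normed_vector \<Rightarrow> 'e::euclidean_space"
  shows "open S \<Longrightarrow> f ` S \<subseteq> T \<Longrightarrow> smooth_on S f \<Longrightarrow> smooth_on T g \<Longrightarrow> smooth_on S (\<lambda>x. g (f x))"
  unfolding smooth_on_def by (blast intro: Ck_on_compose)

lemma smooth_on_subset: "smooth_on S f \<Longrightarrow> T \<subseteq> S \<Longrightarrow> smooth_on T f"
  unfolding smooth_on_def by (blast intro: Ck_on_subset)

lemma smooth_on_cong:
  "open S \<Longrightarrow> (\<And>x. x \<in> S \<Longrightarrow> f x = g x) \<Longrightarrow> smooth_on S f \<Longrightarrow> smooth_on S g"
  unfolding smooth_on_def by (blast intro: Ck_on_cong)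

text \<open>Differentiability is a condition at each point; openness of the pieces serves to glue
  continuity. The lemma is meant for a chart domain of \<open>N\<close> that \<open>f\<close> maps
  into several chart domains of \<open>M\<close>.\<close>

lemma Ck_on_Union:
  assumes "\<And>S. S \<in> A \<Longrightarrow> open S" "\<And>S. S \<in> A \<Longrightarrow> Ck_on k S f"
  shows "Ck_on k (\<Union>A) f"
  using assms(2)
proof (induction k arbitrary: f)
  case 0
  then show ?case using assms(1) by (simp add: continuous_on_open_Union)
next
  case (Suc k)
  then show ?case by fastforce
qed

lemma smooth_on_Union:
  "(\<And>S. S \<in> A \<Longrightarrow> open S) \<Longrightarrow> (\<And>S. S \<in> A \<Longrightarrow> smooth_on S f) \<Longrightarrow> smooth_on (\<Union>A) f"
  unfolding smooth_on_def using Ck_on_Union by blast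

text \<open>The second difference is symmetric in \<open>v\<close> and \<open>w\<close>, so this also relates it to the derivatives in
  the other order.\<close>

lemma mixed_difference_mean_value:
  fixes f :: "'e::real_normed_vector \<Rightarrow> real"
  assumes C: "convex C" "open C"
    and df: "\<And>y. y \<in> C \<Longrightarrow> f differentiable (at y)"
    and dg: "\<And>y. y \<in> C \<Longrightarrow> (\<lambda>y. frechet_derivative f (at y) v) differentiable (at y)"
    and s: "0 < s"
    and inC: "\<And>a b. 0 \<le> a \<Longrightarrow> a \<le> s \<Longrightarrow> 0 \<le> b \<Longrightarrow> b \<le> s \<Longrightarrow> x + a *\<^sub>R v + b *\<^sub>R w \<in> C"
  shows "\<exists>a b. 0 \<le> a \<and> a \<le> s \<and> 0 \<le> b \<and> b \<le> s \<and>
    f (x + s *\<^sub>R v + s *\<^sub>R w) - f (x + s *\<^sub>R v) - f (x + s *\<^sub>R w) + f x =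
    s * s * frechet_derivative (\<lambda>y. frechet_derivative f (at y) v) (at (x + a *\<^sub>R v + b *\<^sub>R w)) w"
proof -
  define g where "g = (\<lambda>y. frechet_derivative f (at y) v)"
  \<comment> \<open>\<open>h\<close> is the difference in direction \<open>w\<close> along a segment
    in direction \<open>v\<close>, so \<open>h s - h 0\<close> is the second difference. The mean
    value theorem is applied to \<open>h\<close> in direction \<open>v\<close>, and then to
    \<open>g\<close> in direction \<open>w\<close>.\<close>
  define h where "h = (\<lambda>a. f (x + a *\<^sub>R v + s *\<^sub>R w) - f (x + a *\<^sub>R v))"
  have f1: "((\<lambda>a. f (x + a *\<^sub>R v + b *\<^sub>R w)) has_real_derivative g (x + a *\<^sub>R v + b *\<^sub>R w)) (at a)"
    if "0 \<le> a" "a \<le> s" "0 \<le> b" "b \<le> s" for a b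
  proof -
    have F: "(f has_derivative frechet_derivative f (at (x + a *\<^sub>R v + b *\<^sub>R w)))
        (at (x + a *\<^sub>R v + b *\<^sub>R w))"
      using df[OF inC[OF that]] frechet_derivative_works by blast
    have "((\<lambda>a. x + a *\<^sub>R v + b *\<^sub>R w) has_derivative (\<lambda>t. t *\<^sub>R v)) (at a)"
      by (auto intro!: derivative_eq_intros)
    from diff_chain_at[OF this F]
    have "((\<lambda>a. f (x + a *\<^sub>R v + b *\<^sub>R w)) has_derivative
        (\<lambda>t. frechet_derivative f (at (x + a *\<^sub>R v + b *\<^sub>R w)) (t *\<^sub>R v))) (at a)"
      by (simp add: o_def)
    then show ?thesis
      unfolding has_field_derivative_def g_def
      by (simp add: linear_scale[OF has_derivative_linear[OF F]] mult_commute_abs)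
  qed
  have f2: "((\<lambda>b. g (x + a *\<^sub>R v + b *\<^sub>R w)) has_real_derivative
      frechet_derivative g (at (x + a *\<^sub>R v + b *\<^sub>R w)) w) (at b)"
    if "0 \<le> a" "a \<le> s" "0 \<le> b" "b \<le> s" for a b
  proof -
    have F: "(g has_derivative frechet_derivative g (at (x + a *\<^sub>R v + b *\<^sub>R w)))
        (at (x + a *\<^sub>R v + b *\<^sub>R w))"
      using dg[OF inC[OF that]] frechet_derivative_works g_def by blast
    have "((\<lambda>b. x + a *\<^sub>R v + b *\<^sub>R w) has_derivative (\<lambda>t. t *\<^sub>R w)) (at b)"
      by (auto intro!: derivative_eq_intros)
    from diff_chain_at[OF this F]
    have "((\<lambda>b. g (x + a *\<^sub>R v + b *\<^sub>R w)) has_derivative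
        (\<lambda>t. frechet_derivative g (at (x + a *\<^sub>R v + b *\<^sub>R w)) (t *\<^sub>R w))) (at b)"
      by (simp add: o_def)
    then show ?thesis
      unfolding has_field_derivative_def
      by (simp add: linear_scale[OF has_derivative_linear[OF F]] mult_commute_abs)
  qed
  have "(h has_real_derivative g (x + a *\<^sub>R v + s *\<^sub>R w) - g (x + a *\<^sub>R v)) (at a)"
    if "0 \<le> a" "a \<le> s" for a
    unfolding h_def using f1[OF that, of s] f1[OF that, of 0] s by (auto intro!: DERIV_diff)
  from MVT2[OF s this]
  obtain a where a: "0 < a" "a < s"
    "h s - h 0 = s * (g (x + a *\<^sub>R v + s *\<^sub>R w) - g (x + a *\<^sub>R v))" by auto
  obtain b where b: "0 < b" "b < s"
    "g (x + a *\<^sub>R v + s *\<^sub>R w) - g (x + a *\<^sub>R v + 0 *\<^sub>R w) =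
     s * frechet_derivative g (at (x + a *\<^sub>R v + b *\<^sub>R w)) w"
    using MVT2[OF s f2[OF less_imp_le[OF a(1)] less_imp_le[OF a(2)]]] by auto
  have "h s - h 0 = s * s * frechet_derivative g (at (x + a *\<^sub>R v + b *\<^sub>R w)) w"
    using a(3) b(3) by (simp add: mult.assoc)
  then show ?thesis using a b unfolding h_def g_def
    by (intro exI[of _ a] exI[of _ b]) (auto simp: algebra_simps)
qed

text \<open>The second difference over a small parallelogram equals \<open>s * s\<close> times
  either mixed derivative, each taken at some point of the parallelogram. By continuity both values
  tend to those at \<open>x\<close>.\<close>

lemma frechet_derivative_symmetric_real:
  fixes f :: "'e::real_normed_vector \<Rightarrow> real"
  assumes "open S" "x \<in> S" "Ck_on 2 S f"
  shows "frechet_derivative (\<lambda>y. frechet_derivative f (at y) v) (at x) w =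
         frechet_derivative (\<lambda>y. frechet_derivative f (at y) w) (at x) v"
proof -
  define D where "D = (\<lambda>v w y. frechet_derivative (\<lambda>y. frechet_derivative f (at y) v) (at y) w)"
  have C: "f differentiable (at y)" "(\<lambda>y. frechet_derivative f (at y) v) differentiable (at y)"
    "continuous_on S (D v w)" if "y \<in> S" for y v w
    using assms(3) that unfolding D_def by (auto simp: numeral_2_eq_2)
  obtain r where r: "r > 0" "ball x r \<subseteq> S" using assms(1,2) openE by blast
  \<comment> \<open>The summand 1 keeps \<open>K\<close> positive even when \<open>v\<close> and
    \<open>w\<close> vanish.\<close>
  define K where "K = norm v + norm w + 1"
  have K: "K > 0" unfolding K_def by (smt (verit) norm_ge_zero)
  have "D v w x = D w v x"
  proof (rule ccontr)
    \<comment> \<open>With half the gap as tolerance the intervals around the two values at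
      \<open>x\<close> are disjoint, so one common value of both mixed derivatives cannot lie in
      both.\<close>
    define e where "e = \<bar>D v w x - D w v x\<bar> / 2"
    assume "D v w x \<noteq> D w v x"
    then have e: "e > 0" by (simp add: e_def)
    have "isCont (D v' w') x" for v' w'
      using C(3) assms(1,2) continuous_on_eq_continuous_at by blast
    then have "\<exists>d>0. \<forall>y. dist y x < d \<longrightarrow> dist (D v' w' y) (D v' w' x) < e" for v' w'
      using e unfolding continuous_at_eps_delta by blast
    from this[of v w] this[of w v] obtain d1 d2 where d: "d1 > 0" "d2 > 0"
      "\<And>y. dist y x < d1 \<Longrightarrow> dist (D v w y) (D v w x) < e"
      "\<And>y. dist y x < d2 \<Longrightarrow> dist (D w v y) (D w v x) < e" by blast
    \<comment> \<open>This side length keeps every point of the parallelogram within half of the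
      smallest radius from \<open>x\<close>.\<close>
    define s where "s = Min {r, d1, d2} / (2 * K)"
    have m: "Min {r, d1, d2} > 0" using r d by simp
    have s: "s > 0" using m K by (simp add: s_def)
    have near: "dist (x + a *\<^sub>R v + b *\<^sub>R w) x < Min {r, d1, d2}"
      if "0 \<le> a" "a \<le> s" "0 \<le> b" "b \<le> s" for a b
    proof -
      have "norm (a *\<^sub>R v + b *\<^sub>R w) \<le> a * norm v + b * norm w"
        using norm_triangle_ineq[of "a *\<^sub>R v" "b *\<^sub>R w"] that by simp
      also have "\<dots> \<le> s * norm v + s * norm w"
        using that by (intro add_mono mult_right_mono) auto
      also have "\<dots> \<le> s * K" using s unfolding K_def by (simp add: algebra_simps)
      also have "\<dots> = Min {r, d1, d2} / 2" unfolding s_def using K by simp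
      finally show ?thesis using m by (simp add: dist_norm add.assoc)
    qed
    have B: "x + a *\<^sub>R v + b *\<^sub>R w \<in> ball x r" "dist (x + a *\<^sub>R v + b *\<^sub>R w) x < d1"
      "dist (x + a *\<^sub>R v + b *\<^sub>R w) x < d2"
      if "0 \<le> a" "a \<le> s" "0 \<le> b" "b \<le> s" for a b
      using near[OF that] by (auto simp: dist_commute)
    have B': "x + a *\<^sub>R w + b *\<^sub>R v \<in> ball x r"
      if "0 \<le> a" "a \<le> s" "0 \<le> b" "b \<le> s" for a b
      using B(1)[OF that(3,4,1,2)] by (simp add: algebra_simps)
    obtain a b where ab: "0 \<le> a" "a \<le> s" "0 \<le> b" "b \<le> s"
      "f (x + s *\<^sub>R v + s *\<^sub>R w) - f (x + s *\<^sub>R v) - f (x + s *\<^sub>R w) + f x =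
       s * s * D v w (x + a *\<^sub>R v + b *\<^sub>R w)"
      using mixed_difference_mean_value[of "ball x r" f v s x w] C r B(1) s
      unfolding D_def by (auto simp: subset_iff)
    obtain a' b' where ab': "0 \<le> a'" "a' \<le> s" "0 \<le> b'" "b' \<le> s"
      "f (x + s *\<^sub>R w + s *\<^sub>R v) - f (x + s *\<^sub>R w) - f (x + s *\<^sub>R v) + f x =
       s * s * D w v (x + a' *\<^sub>R w + b' *\<^sub>R v)"
      using mixed_difference_mean_value[of "ball x r" f w s x v] C r B' s
      unfolding D_def by (auto simp: subset_iff)
    have "s * s * D v w (x + a *\<^sub>R v + b *\<^sub>R w) = s * s * D w v (x + b' *\<^sub>R v + a' *\<^sub>R w)"
      using ab(5) ab'(5) by (simp add: algebra_simps)
    then have "D v w (x + a *\<^sub>R v + b *\<^sub>R w) = D w v (x + b' *\<^sub>R v + a' *\<^sub>R w)"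
      using s by simp
    moreover have "dist (D v w (x + a *\<^sub>R v + b *\<^sub>R w)) (D v w x) < e"
      using d(3) B(2)[OF ab(1-4)] by blast
    moreover have "dist (D w v (x + b' *\<^sub>R v + a' *\<^sub>R w)) (D w v x) < e"
      using d(4) B(3)[OF ab'(3,4,1,2)] by blast
    ultimately show False unfolding e_def dist_real_def
      by (simp only: abs_if split: if_splits) (simp_all add: field_simps)
  qed
  then show ?thesis by (simp add: D_def)
qed

lemma frechet_derivative_symmetric:
  fixes f :: "'e::real_normed_vector \<Rightarrow> 'f::euclidean_space"
  assumes "open S" "x \<in> S" "Ck_on 2 S f"
  shows "frechet_derivative (\<lambda>y. frechet_derivative f (at y) v) (at x) w =
         frechet_derivative (\<lambda>y. frechet_derivative f (at y) w) (at x) v"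
proof (rule euclidean_eqI)
  fix b :: 'f assume "b \<in> Basis"
  have D: "f differentiable (at y)" "(\<lambda>y. frechet_derivative f (at y) v) differentiable (at y)"
    if "y \<in> S" for y v
    using assms(3) that by (auto simp: numeral_2_eq_2)
  have inner: "frechet_derivative (\<lambda>y. g y \<bullet> b) (at y) u = frechet_derivative g (at y) u \<bullet> b"
    if "g differentiable (at y)" for g :: "'e \<Rightarrow> 'f" and y u
    by (rule fun_cong[OF frechet_derivative_at[OF has_derivative_inner_left[OF
          that[unfolded frechet_derivative_works]]], symmetric])
  have "frechet_derivative (\<lambda>y. frechet_derivative f (at y) v) (at x) w \<bullet> b =
      frechet_derivative (\<lambda>y. frechet_derivative (\<lambda>z. f z \<bullet> b) (at y) v) (at x) w" for v w
  proof -
    have "frechet_derivative (\<lambda>y. frechet_derivative f (at y) v \<bullet> b) (at x) =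
        frechet_derivative (\<lambda>y. frechet_derivative (\<lambda>z. f z \<bullet> b) (at y) v) (at x)"
      by (rule frechet_derivative_transform_within_open[OF _ assms(1,2)])
        (use D assms(2) in \<open>auto simp: inner intro!: differentiable_inner\<close>)
    then show ?thesis unfolding inner[OF D(2)[OF assms(2)], symmetric] by simp
  qed
  then show "frechet_derivative (\<lambda>y. frechet_derivative f (at y) v) (at x) w \<bullet> b =
      frechet_derivative (\<lambda>y. frechet_derivative f (at y) w) (at x) v \<bullet> b"
    using frechet_derivative_symmetric_real[OF assms(1,2), of "\<lambda>z. f z \<bullet> b" v w]
      Ck_on_inner[OF assms(1,3) Ck_on_const] by simp
qed

section \<open>Multilinear functions on lists\<close>

text \<open>Here and in \<open>alternating\<close> an argument slot is described by splitting the
  list around it. This suits arguments about \<open>map\<close>, which commutes with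
  \<open>append\<close>, better than numbered list updates.\<close>

definition multilinear :: "nat \<Rightarrow> ('e::euclidean_space list \<Rightarrow> real) \<Rightarrow> bool" where
  "multilinear k g \<longleftrightarrow>
     (\<forall>pre post. Suc (length pre + length post) = k \<longrightarrow> linear (\<lambda>x. g (pre @ x # post)))"

definition alternating :: "nat \<Rightarrow> ('e::euclidean_space list \<Rightarrow> real) \<Rightarrow> bool" where
  "alternating k g \<longleftrightarrow> (\<forall>pre mid post x. length (pre @ x # mid @ x # post) = k \<longrightarrow>
     g (pre @ x # mid @ x # post) = 0)"

lemma multilinear_add:
  "multilinear k g \<Longrightarrow> Suc (length pre + length post) = k \<Longrightarrow>
   g (pre @ (x + y) # post) = g (pre @ x # post) + g (pre @ y # post)"
  unfolding multilinear_def using linear_add by blast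

lemma multilinear_expand:
  assumes "multilinear k g" "Suc (length pre + length post) = k"
  shows "g (pre @ x # post) = (\<Sum>b\<in>Basis. (x \<bullet> b) * g (pre @ b # post))"
proof -
  have l: "linear (\<lambda>x. g (pre @ x # post))" using assms unfolding multilinear_def by blast
  have "g (pre @ x # post) = g (pre @ (\<Sum>b\<in>Basis. (x \<bullet> b) *\<^sub>R b) # post)"
    by (simp add: euclidean_representation)
  then show ?thesis by (simp only: linear_sum[OF l] linear_scale[OF l] real_scaleR_def)
qed

text \<open>Polarization: \<open>x + y\<close> is put into both slots and the four resulting terms
  are compared.\<close>

lemma alternating_swap:
  assumes "multilinear k g" "alternating k g" "length (pre @ x # y # post) = k"
  shows "g (pre @ x # y # post) = - g (pre @ y # x # post)"
proof -
  have A: "g (pre @ z # z # post) = 0" for z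
    using assms(2,3) unfolding alternating_def by (metis append_Nil length_Cons length_append)
  have L: "Suc (length pre + length (w # post)) = k" "Suc (length (pre @ [w]) + length post) = k" for w
    using assms(3) by auto
  have "g (pre @ (x + y) # (x + y) # post) =
    g (pre @ x # x # post) + g (pre @ x # y # post) + (g (pre @ y # x # post) + g (pre @ y # y # post))"
    using multilinear_add[OF assms(1) L(1)[of "x + y"], of x y]
      multilinear_add[OF assms(1) L(2)[of x], of x y] multilinear_add[OF assms(1) L(2)[of y], of x y] by simp
  then show ?thesis using A by simp
qed

lemma alternating_shift:
  assumes "multilinear k g" "alternating k g" "length (pre @ x # mid @ post) = k"
  shows "g (pre @ x # mid @ post) = (- 1) ^ length mid * g (pre @ mid @ x # post)"
  using assms(3)
proof (induction mid arbitrary: pre)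
  case (Cons y mid)
  have "g (pre @ x # (y # mid) @ post) = - g ((pre @ [y]) @ x # mid @ post)"
    using alternating_swap[OF assms(1,2), of pre x y "mid @ post"] Cons.prems by simp
  also have "\<dots> = - ((- 1) ^ length mid * g ((pre @ [y]) @ mid @ x # post))"
    using Cons.IH[of "pre @ [y]"] Cons.prems by simp
  finally show ?case by simp
qed simp

text \<open>A smooth form is known to have smooth coefficients for constant vectors, whereas pulling
  back inserts vectors that depend on \<open>y\<close>. Starting from the end of \<open>As\<close>,
  each varying vector is expanded in the basis; its basis vectors become constants at the front of
  \<open>post\<close>, and the coordinates become smooth factors.\<close>

lemma smooth_on_multilinear:
  fixes G :: "'e::euclidean_space list \<Rightarrow> 'f::euclidean_space \<Rightarrow> real" and \<phi> :: "'d::euclidean_space \<Rightarrow> 'f"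
  assumes "open S" "smooth_on S \<phi>" "\<phi> ` S \<subseteq> V"
    and G: "\<And>xs. length xs = k \<Longrightarrow> smooth_on V (G xs)"
    and mult: "\<And>z. z \<in> V \<Longrightarrow> multilinear k (\<lambda>xs. G xs z)"
    and "\<And>a. a \<in> set As \<Longrightarrow> smooth_on S a" "length As + length post = k"
  shows "smooth_on S (\<lambda>y. G (map (\<lambda>a. a y) As @ post) (\<phi> y))"
  using assms(6,7)
proof (induction As arbitrary: post rule: rev_induct)
  case Nil
  then show ?case using smooth_on_compose[OF assms(1,3,2) G[of post]] by simp
next
  case (snoc a As)
  have "smooth_on S (\<lambda>y. \<Sum>b\<in>Basis. (a y \<bullet> b) * G (map (\<lambda>a. a y) As @ b # post) (\<phi> y))"
    using snoc.prems snoc.IH[of "_ # post"] assms(1)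
    by (intro smooth_on_sum smooth_on_mult smooth_on_inner_const) auto
  then show ?case
  proof (rule smooth_on_cong[OF assms(1), rotated])
    fix y assume "y \<in> S"
    then have "multilinear k (\<lambda>xs. G xs (\<phi> y))" using mult assms(3) by blast
    from multilinear_expand[OF this, of "map (\<lambda>a. a y) As" post "a y"]
    show "(\<Sum>b\<in>Basis. (a y \<bullet> b) * G (map (\<lambda>a. a y) As @ b # post) (\<phi> y)) =
        G (map (\<lambda>a. a y) (As @ [a]) @ post) (\<phi> y)"
      using snoc.prems by simp
  qed
qed

text \<open>Linearity of \<open>G\<close> in a slot is a finite sum identity with constant
  coefficients on the open set \<open>V\<close>, so it may be differentiated in
  \<open>z\<close>.\<close>

lemma frechet_derivative_multilinear_expand:
  fixes G :: "'e::euclidean_space list \<Rightarrow> 'f::euclidean_space \<Rightarrow> real"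
  assumes "open V" "z \<in> V"
    and G: "\<And>xs. length xs = k \<Longrightarrow> G xs differentiable (at z)"
    and mult: "\<And>z. z \<in> V \<Longrightarrow> multilinear k (\<lambda>xs. G xs z)"
    and "Suc (length pre + length post) = k"
  shows "frechet_derivative (G (pre @ x # post)) (at z) u =
    (\<Sum>b\<in>Basis. (x \<bullet> b) * frechet_derivative (G (pre @ b # post)) (at z) u)"
proof -
  have "((\<lambda>y. \<Sum>b\<in>Basis. (x \<bullet> b) * G (pre @ b # post) y) has_derivative
      (\<lambda>u. \<Sum>b\<in>Basis. (x \<bullet> b) * frechet_derivative (G (pre @ b # post)) (at z) u)) (at z)"
    using G assms(5)
    by (intro has_derivative_sum has_derivative_mult_right)
      (auto simp: frechet_derivative_works[symmetric])
  then have "(G (pre @ x # post) has_derivative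
      (\<lambda>u. \<Sum>b\<in>Basis. (x \<bullet> b) * frechet_derivative (G (pre @ b # post)) (at z) u)) (at z)"
    by (rule has_derivative_transform_within_open[OF _ assms(1,2)])
      (rule multilinear_expand[OF mult assms(5), symmetric])
  from fun_cong[OF frechet_derivative_at[OF this], symmetric] show ?thesis .
qed

text \<open>The product rule for a multilinear expression with moving base point: one term for the
  motion of \<open>\<phi> y\<close> and one for the motion of each argument.\<close>

lemma has_derivative_multilinear:
  fixes G :: "'e::euclidean_space list \<Rightarrow> 'f::euclidean_space \<Rightarrow> real" and \<phi> :: "'d::euclidean_space \<Rightarrow> 'f"
  assumes S: "open S" "y0 \<in> S" and V: "open V" "\<phi> ` S \<subseteq> V"
    and phi: "(\<phi> has_derivative \<phi>') (at y0)"
    and G: "\<And>xs. length xs = k \<Longrightarrow> G xs differentiable (at (\<phi> y0))"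
    and mult: "\<And>z. z \<in> V \<Longrightarrow> multilinear k (\<lambda>xs. G xs z)"
    and "\<And>a. a \<in> set As \<Longrightarrow> a differentiable (at y0)" "length As + length post = k"
  shows "((\<lambda>y. G (map (\<lambda>a. a y) As @ post) (\<phi> y)) has_derivative
    (\<lambda>h. frechet_derivative (G (map (\<lambda>a. a y0) As @ post)) (at (\<phi> y0)) (\<phi>' h) +
      (\<Sum>j<length As. G ((map (\<lambda>a. a y0) As)[j := frechet_derivative (As ! j) (at y0) h] @ post) (\<phi> y0))))
    (at y0)"
  using assms(8,9)
proof (induction As arbitrary: post rule: rev_induct)
  case Nil
  have "(G post has_derivative frechet_derivative (G post) (at (\<phi> y0))) (at (\<phi> y0))"
    using G[of post] Nil by (simp add: frechet_derivative_works[symmetric])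
  from diff_chain_at[OF phi this] show ?case by (simp add: o_def)
next
  case (snoc a As)
  let ?m = "\<lambda>y. map (\<lambda>a. a y) As"
  let ?u = "\<lambda>j h. (?m y0)[j := frechet_derivative (As ! j) (at y0) h]"
  have y0: "\<phi> y0 \<in> V" using S(2) V(2) by blast
  have da: "(a has_derivative frechet_derivative a (at y0)) (at y0)"
    using snoc.prems by (simp add: frechet_derivative_works[symmetric])
  have E: "G (pre @ x # post) z = (\<Sum>b\<in>Basis. (x \<bullet> b) * G (pre @ b # post) z)"
    if "z \<in> V" "length pre = length As" for pre x z
    using multilinear_expand[OF mult[OF that(1)]] that(2) snoc.prems(2) by simp
  \<comment> \<open>The last varying argument is expanded so that the induction hypothesis applies
    with the constant \<open>b\<close> in its place. The equation that follows collapses the sums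
    over \<open>b\<close> again, separately for the base point, for the earlier arguments and for
    the last one.\<close>
  have "((\<lambda>y. \<Sum>b\<in>Basis. (a y \<bullet> b) * G (?m y @ b # post) (\<phi> y)) has_derivative
    (\<lambda>h. \<Sum>b\<in>Basis. (a y0 \<bullet> b) * (frechet_derivative (G (?m y0 @ b # post)) (at (\<phi> y0)) (\<phi>' h) +
         (\<Sum>j<length As. G (?u j h @ b # post) (\<phi> y0))) +
       (frechet_derivative a (at y0) h \<bullet> b) * G (?m y0 @ b # post) (\<phi> y0))) (at y0)"
    using snoc.prems by (intro has_derivative_sum has_derivative_mult has_derivative_inner_left da snoc.IH) auto
  also have "(\<lambda>h. \<Sum>b\<in>Basis. (a y0 \<bullet> b) * (frechet_derivative (G (?m y0 @ b # post)) (at (\<phi> y0)) (\<phi>' h) +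
         (\<Sum>j<length As. G (?u j h @ b # post) (\<phi> y0))) +
       (frechet_derivative a (at y0) h \<bullet> b) * G (?m y0 @ b # post) (\<phi> y0)) =
    (\<lambda>h. frechet_derivative (G (?m y0 @ a y0 # post)) (at (\<phi> y0)) (\<phi>' h) +
      ((\<Sum>j<length As. G (?u j h @ a y0 # post) (\<phi> y0)) +
       G (?m y0 @ frechet_derivative a (at y0) h # post) (\<phi> y0)))"
  proof
    fix h
    have "(\<Sum>b\<in>Basis. (a y0 \<bullet> b) * frechet_derivative (G (?m y0 @ b # post)) (at (\<phi> y0)) (\<phi>' h)) =
        frechet_derivative (G (?m y0 @ a y0 # post)) (at (\<phi> y0)) (\<phi>' h)"
      using frechet_derivative_multilinear_expand[OF V(1) y0 G mult, of "?m y0" post "a y0" "\<phi>' h"]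
        snoc.prems(2) by simp
    moreover have "(\<Sum>j<length As. G (?u j h @ a y0 # post) (\<phi> y0)) =
        (\<Sum>b\<in>Basis. (a y0 \<bullet> b) * (\<Sum>j<length As. G (?u j h @ b # post) (\<phi> y0)))"
      unfolding sum_distrib_left by (subst sum.swap) (simp add: E[OF y0, of _ "a y0"])
    moreover have "G (?m y0 @ frechet_derivative a (at y0) h # post) (\<phi> y0) =
        (\<Sum>b\<in>Basis. (frechet_derivative a (at y0) h \<bullet> b) * G (?m y0 @ b # post) (\<phi> y0))"
      by (rule E[OF y0]) simp
    ultimately show "(\<Sum>b\<in>Basis. (a y0 \<bullet> b) * (frechet_derivative (G (?m y0 @ b # post)) (at (\<phi> y0)) (\<phi>' h) +
         (\<Sum>j<length As. G (?u j h @ b # post) (\<phi> y0))) +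
       (frechet_derivative a (at y0) h \<bullet> b) * G (?m y0 @ b # post) (\<phi> y0)) =
     frechet_derivative (G (?m y0 @ a y0 # post)) (at (\<phi> y0)) (\<phi>' h) +
      ((\<Sum>j<length As. G (?u j h @ a y0 # post) (\<phi> y0)) +
       G (?m y0 @ frechet_derivative a (at y0) h # post) (\<phi> y0))"
      by (simp add: sum.distrib distrib_left)
  qed
  finally have D: "((\<lambda>y. \<Sum>b\<in>Basis. (a y \<bullet> b) * G (?m y @ b # post) (\<phi> y)) has_derivative
    (\<lambda>h. frechet_derivative (G (?m y0 @ a y0 # post)) (at (\<phi> y0)) (\<phi>' h) +
      ((\<Sum>j<length As. G (?u j h @ a y0 # post) (\<phi> y0)) +
       G (?m y0 @ frechet_derivative a (at y0) h # post) (\<phi> y0)))) (at y0)" .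
  have "((\<lambda>y. G (?m y @ a y # post) (\<phi> y)) has_derivative
    (\<lambda>h. frechet_derivative (G (?m y0 @ a y0 # post)) (at (\<phi> y0)) (\<phi>' h) +
      ((\<Sum>j<length As. G (?u j h @ a y0 # post) (\<phi> y0)) +
       G (?m y0 @ frechet_derivative a (at y0) h # post) (\<phi> y0)))) (at y0)"
    by (rule has_derivative_transform_within_open[OF D S]) (use V(2) in \<open>auto intro!: E[symmetric]\<close>)
  then show ?case
    by (simp add: list_update_append nth_append cong: sum.cong_simp)
qed

text \<open>\<open>T i j\<close> stands for the term in which argument \<open>i\<close> is omitted
  and entry \<open>j\<close> of the remaining list is changed. For \<open>j \<le> i\<close> the
  positions \<open>(j, i)\<close> and \<open>(Suc i, j)\<close> involve the same two original
  arguments, and after the assumed relation their signs are \<open>(- 1) ^ i\<close> and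
  \<open>(- 1) ^ Suc i\<close>. The induction step adds a last row and a last column, which cancel
  each other.\<close>

lemma alternating_double_sum_cancel:
  fixes T :: "nat \<Rightarrow> nat \<Rightarrow> 'a::comm_ring_1"
  assumes "\<And>i j. j \<le> i \<Longrightarrow> i < k \<Longrightarrow> T j i = (- 1) ^ (i - j) * T (Suc i) j"
  shows "(\<Sum>i\<le>k. \<Sum>j<k. (- 1) ^ i * T i j) = 0"
  using assms
proof (induction k)
  case (Suc k)
  have "(- 1) ^ i * T i k = (- 1) ^ k * T (Suc k) i" if "i \<le> k" for i
    using Suc.prems[of i k] that by (simp add: mult.assoc[symmetric] power_add[symmetric])
  then have "(\<Sum>i\<le>k. (- 1) ^ i * T i k) = (\<Sum>i\<le>k. (- 1) ^ k * T (Suc k) i)"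
    by (intro sum.cong) auto
  moreover have "(\<Sum>i\<le>k. \<Sum>j<k. (- 1) ^ i * T i j) = 0"
    using Suc by simp
  moreover have "(\<Sum>i\<le>Suc k. \<Sum>j<Suc k. (- 1) ^ i * T i j) =
      (\<Sum>i\<le>k. \<Sum>j<k. (- 1) ^ i * T i j) + (\<Sum>i\<le>k. (- 1) ^ i * T i k) +
      (\<Sum>j\<le>k. (- 1) ^ Suc k * T (Suc k) j)"
    by (simp add: sum.distrib lessThan_Suc_atMost[symmetric])
  ultimately show ?case by (simp add: sum_negf)
qed simp

text \<open>The terms with second derivatives of \<open>\<phi>\<close> cancel in pairs.\<close>

lemma coordinate_ext_deriv_pullback:
  fixes G :: "'e::euclidean_space list \<Rightarrow> 'e \<Rightarrow> real" and \<phi> :: "'d::euclidean_space \<Rightarrow> 'e"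
  assumes S: "open S" "y0 \<in> S" and V: "open V" "\<phi> ` S \<subseteq> V"
    and phi: "smooth_on S \<phi>"
    and G: "\<And>xs. length xs = k \<Longrightarrow> G xs differentiable (at (\<phi> y0))"
    and mult: "\<And>z. z \<in> V \<Longrightarrow> multilinear k (\<lambda>xs. G xs z)"
    and alt: "alternating k (\<lambda>xs. G xs (\<phi> y0))"
    and xs: "length xs = Suc k"
  shows "(\<Sum>i\<le>k. (- 1) ^ i * frechet_derivative
      (\<lambda>y. G (map (frechet_derivative \<phi> (at y)) (take i xs @ drop (Suc i) xs)) (\<phi> y)) (at y0) (xs ! i)) =
    (\<Sum>i\<le>k. (- 1) ^ i * frechet_derivative
      (G (take i (map (frechet_derivative \<phi> (at y0)) xs) @ drop (Suc i) (map (frechet_derivative \<phi> (at y0)) xs)))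
      (at (\<phi> y0)) (map (frechet_derivative \<phi> (at y0)) xs ! i))"
proof -
  define D where "D = frechet_derivative \<phi> (at y0)"
  define B where "B = (\<lambda>h x. frechet_derivative (\<lambda>y. frechet_derivative \<phi> (at y) x) (at y0) h)"
  define R where "R = (\<lambda>i. take i xs @ drop (Suc i) xs)"
  \<comment> \<open>The product rule terms containing a second derivative of \<open>\<phi>\<close>:
    argument \<open>i\<close> is the direction of differentiation, and \<open>j\<close> counts
    within the list from which it was removed.\<close>
  define T where "T = (\<lambda>i j. G ((map D (R i))[j := B (xs ! i) (R i ! j)]) (\<phi> y0))"
  have y0: "\<phi> y0 \<in> V" using S(2) V(2) by blast
  have sym: "B x z = B z x" for x z
    unfolding B_def using frechet_derivative_symmetric[OF S] phi by (metis smooth_on_def)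
  have lenR: "length (R i) = k" if "i \<le> k" for i
    using that xs unfolding R_def by simp
  have main: "frechet_derivative (\<lambda>y. G (map (frechet_derivative \<phi> (at y)) (R i)) (\<phi> y)) (at y0) (xs ! i) =
      frechet_derivative (G (map D (R i))) (at (\<phi> y0)) (D (xs ! i)) + (\<Sum>j<k. T i j)"
    if "i \<le> k" for i
  proof -
    let ?As = "map (\<lambda>x y. frechet_derivative \<phi> (at y) x) (R i)"
    have m: "map (\<lambda>a. a y) ?As = map (frechet_derivative \<phi> (at y)) (R i)" for y
      by (simp add: o_def)
    have "((\<lambda>y. G (map (\<lambda>a. a y) ?As @ []) (\<phi> y)) has_derivative
      (\<lambda>h. frechet_derivative (G (map (\<lambda>a. a y0) ?As @ [])) (at (\<phi> y0)) (D h) +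
        (\<Sum>j<length ?As. G ((map (\<lambda>a. a y0) ?As)[j := frechet_derivative (?As ! j) (at y0) h] @ []) (\<phi> y0))))
      (at y0)"
    proof (rule has_derivative_multilinear[OF S V _ G mult])
      show "(\<phi> has_derivative D) (at y0)"
        using smooth_on_imp_differentiable[OF phi S(2)] unfolding D_def
        by (simp add: frechet_derivative_works[symmetric])
      show "a differentiable (at y0)" if "a \<in> set ?As" for a
        using that smooth_on_imp_differentiable[OF smooth_on_frechet_derivative[OF phi] S(2)] by auto
      show "length ?As + length [] = k" using lenR[OF that] by simp
    qed
    from fun_cong[OF frechet_derivative_at[OF this], of "xs ! i", symmetric]
    show ?thesis unfolding T_def m
      by (simp add: lenR[OF that] B_def D_def cong: sum.cong_simp)
  qed
  have "T j i = (- 1) ^ (i - j) * T (Suc i) j" if "j \<le> i" "i < k" for i j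
  proof -
    \<comment> \<open>The list is cut as \<open>a\<close>, argument \<open>j\<close>,
      \<open>b\<close>, argument \<open>Suc i\<close>, \<open>c\<close>. Both terms contain the same
      vector \<open>B\<close> of these two arguments, once behind \<open>b\<close> and once in front
      of it, so moving it past \<open>b\<close> costs \<open>i - j\<close> signs.\<close>
    define a b c where "a = take j xs" and "b = take (i - j) (drop (Suc j) xs)"
      and "c = drop (Suc (Suc i)) xs"
    have la: "length a = j" and lb: "length b = i - j" using that xs unfolding a_def b_def by auto
    have "drop (Suc j) xs = b @ drop (Suc i) xs"
      using append_take_drop_id[of "i - j" "drop (Suc j) xs"] that unfolding b_def by simp
    moreover have "drop (Suc i) xs = xs ! Suc i # c"
      unfolding c_def using that xs by (simp add: Cons_nth_drop_Suc)
    ultimately have d: "drop (Suc j) xs = b @ xs ! Suc i # c" by simp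
    have e: "xs = a @ xs ! j # b @ xs ! Suc i # c"
      using id_take_nth_drop[of j xs] that xs d unfolding a_def by simp
    have "take (Suc i) (a @ xs ! j # b @ xs ! Suc i # c) = a @ xs ! j # b"
      using la lb that by (simp add: Suc_diff_le)
    then have t: "take (Suc i) xs = a @ xs ! j # b" using e by metis
    have Rj: "R j = a @ b @ xs ! Suc i # c" unfolding R_def d a_def[symmetric] by simp
    have Ri: "R (Suc i) = a @ xs ! j # b @ c" unfolding R_def t c_def[symmetric] by simp
    have Ti: "T (Suc i) j = G (map D a @ B (xs ! Suc i) (xs ! j) # map D b @ map D c) (\<phi> y0)"
      unfolding T_def Ri by (simp add: la nth_append list_update_append)
    have "R j ! i = xs ! Suc i" "i = length (map D a @ map D b)"
      unfolding Rj using la lb that by (auto simp: nth_append)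
    then have Tj: "T j i = G (map D a @ map D b @ B (xs ! j) (xs ! Suc i) # map D c) (\<phi> y0)"
      unfolding T_def Rj by (simp add: list_update_append)
    have "length (map D a @ B (xs ! Suc i) (xs ! j) # map D b @ map D c) = k"
      using arg_cong[OF e, of length] xs by simp
    from alternating_shift[OF mult[OF y0] alt this]
    show ?thesis unfolding Ti Tj by (simp add: lb sym[of "xs ! Suc i"] mult.assoc[symmetric] power_add[symmetric] mult_2[symmetric])
  qed
  then have "(\<Sum>i\<le>k. \<Sum>j<k. (- 1) ^ i * T i j) = 0"
    by (rule alternating_double_sum_cancel)
  then have "(\<Sum>i\<le>k. (- 1) ^ i * frechet_derivative (\<lambda>y. G (map (frechet_derivative \<phi> (at y)) (R i)) (\<phi> y)) (at y0) (xs ! i)) =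
      (\<Sum>i\<le>k. (- 1) ^ i * frechet_derivative (G (map D (R i))) (at (\<phi> y0)) (D (xs ! i)))"
    by (simp add: main sum.distrib distrib_left sum_distrib_left[symmetric])
  then show ?thesis
    unfolding R_def D_def[symmetric] using xs
    by (simp add: take_map drop_map cong: sum.cong_simp)
qed

section \<open>Charts and tangent vectors\<close>

text \<open>Charts are pairs; quantifiers over them should not be split.\<close>

declare split_paired_All [simp del] split_paired_Ex [simp del]

lemma smooth_manifold_is_chart: "smooth_manifold M \<Longrightarrow> c \<in> charts M \<Longrightarrow> is_chart (mtop M) c"
  by (simp add: smooth_manifold_def)

lemma chart_inv_chart:
  assumes "is_chart X c" "p \<in> fst c"
  shows "chart_inv c (snd c p) = p"
proof -
  have "inj_on (snd c) (topspace (subtopology X (fst c)))"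
    using assms(1) unfolding is_chart_def homeomorphic_eq_everything_map by blast
  moreover have "topspace (subtopology X (fst c)) = fst c"
    using assms(1) openin_subset unfolding is_chart_def by (metis topspace_subtopology_subset)
  ultimately show ?thesis unfolding chart_inv_def using assms(2) by (simp add: inv_into_f_f)
qed

lemma open_chart_image:
  assumes "is_chart X c" "openin X W"
  shows "open (snd c ` (fst c \<inter> W))"
proof -
  have "open_map (subtopology X (fst c)) (top_of_set (snd c ` fst c)) (snd c)"
    using assms(1) homeomorphic_imp_open_map unfolding is_chart_def by blast
  moreover have "openin (subtopology X (fst c)) (fst c \<inter> W)"
    using assms(2) by (simp add: openin_subtopology_Int2)
  ultimately have "openin (top_of_set (snd c ` fst c)) (snd c ` (fst c \<inter> W))"
    unfolding open_map_def by blast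
  then show ?thesis using assms(1) openin_open_trans unfolding is_chart_def by blast
qed

lemma tangent_space_change:
  "v \<in> tangent_space M p \<Longrightarrow> c \<in> charts_at M p \<Longrightarrow> d \<in> charts_at M p \<Longrightarrow>
   v d = frechet_derivative (snd d \<circ> chart_inv c) (at (snd c p)) (v c)"
  unfolding tangent_space_def by blast

lemma tangent_space_outside: "v \<in> tangent_space M p \<Longrightarrow> c \<notin> charts_at M p \<Longrightarrow> v c = 0"
  unfolding tangent_space_def by blast

lemma tangent_spaceI:
  assumes "\<And>c d. c \<in> charts_at M p \<Longrightarrow> d \<in> charts_at M p \<Longrightarrow>
      v d = frechet_derivative (snd d \<circ> chart_inv c) (at (snd c p)) (v c)"
    and "\<And>c. c \<notin> charts_at M p \<Longrightarrow> v c = 0"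
  shows "v \<in> tangent_space M p"
  unfolding tangent_space_def using assms by blast

text \<open>Together with the next lemma and \<open>alternating_form_atI\<close> this translates
  between the numbered slots of \<open>alternating_form_at\<close> and split lists.\<close>

lemma alternating_form_at_combination:
  assumes "alternating_form_at M p k a" "Suc (length pre + length post) = k"
    and "set (pre @ post) \<subseteq> tangent_space M p" "v \<in> tangent_space M p" "w \<in> tangent_space M p"
  shows "a (pre @ (\<lambda>c. r *\<^sub>R v c + s *\<^sub>R w c) # post) = r * a (pre @ v # post) + s * a (pre @ w # post)"
proof -
  have "pre @ v # post \<in> tangent_lists M k p" "length pre < k"
    using assms unfolding tangent_lists_def by auto
  then have "a ((pre @ v # post)[length pre := (\<lambda>c. r *\<^sub>R v c + s *\<^sub>R w c)]) =
      r * a ((pre @ v # post)[length pre := v]) + s * a ((pre @ v # post)[length pre := w])"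
    using assms(1,4,5) unfolding alternating_form_at_def by blast
  then show ?thesis by simp
qed

lemma alternating_form_at_repeat:
  assumes "alternating_form_at M p k a" "length (pre @ v # mid @ v # post) = k"
    and "set (pre @ v # mid @ v # post) \<subseteq> tangent_space M p"
  shows "a (pre @ v # mid @ v # post) = 0"
proof -
  let ?vs = "pre @ v # mid @ v # post"
  have "?vs \<in> tangent_lists M k p" using assms unfolding tangent_lists_def by auto
  moreover have "length pre < k" "length pre + Suc (length mid) < k"
    "length pre \<noteq> length pre + Suc (length mid)" "?vs ! length pre = ?vs ! (length pre + Suc (length mid))"
    using assms(2) by (auto simp: nth_append)
  ultimately show ?thesis using assms(1) unfolding alternating_form_at_def by blast
qed

lemma smooth_form_local_coeff:
  "smooth_form M S k \<alpha> \<Longrightarrow> c \<in> charts M \<Longrightarrow> length xs = k \<Longrightarrow>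
   smooth_on (snd c ` (fst c \<inter> S)) (local_coeff M c \<alpha> xs)"
  unfolding smooth_form_def by blast

lemma alternating_form_atI:
  assumes "\<And>pre post v w r s. Suc (length pre + length post) = k \<Longrightarrow>
      set pre \<subseteq> tangent_space M p \<Longrightarrow> set post \<subseteq> tangent_space M p \<Longrightarrow>
      v \<in> tangent_space M p \<Longrightarrow> w \<in> tangent_space M p \<Longrightarrow>
      a (pre @ (\<lambda>c. r *\<^sub>R v c + s *\<^sub>R w c) # post) = r * a (pre @ v # post) + s * a (pre @ w # post)"
    and "\<And>pre mid post v. length (pre @ v # mid @ v # post) = k \<Longrightarrow>
      set (pre @ v # mid @ v # post) \<subseteq> tangent_space M p \<Longrightarrow> a (pre @ v # mid @ v # post) = 0"
  shows "alternating_form_at M p k a"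
proof -
  have lin: "a (vs[i := (\<lambda>c. r *\<^sub>R v c + s *\<^sub>R w c)]) = r * a (vs[i := v]) + s * a (vs[i := w])"
    if "vs \<in> tangent_lists M k p" "i < k" "v \<in> tangent_space M p" "w \<in> tangent_space M p" for vs i v w r s
  proof -
    have l: "length vs = k" "set vs \<subseteq> tangent_space M p" using that(1) by (simp_all add: tangent_lists_def)
    have "a (take i vs @ (\<lambda>c. r *\<^sub>R v c + s *\<^sub>R w c) # drop (Suc i) vs) =
        r * a (take i vs @ v # drop (Suc i) vs) + s * a (take i vs @ w # drop (Suc i) vs)"
    proof (rule assms(1)[OF _ _ _ that(3,4)])
      show "Suc (length (take i vs) + length (drop (Suc i) vs)) = k" using l(1) that(2) by simp
      show "set (take i vs) \<subseteq> tangent_space M p"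
        by (rule order_trans[OF set_take_subset l(2)])
      show "set (drop (Suc i) vs) \<subseteq> tangent_space M p"
        by (rule order_trans[OF set_drop_subset l(2)])
    qed
    then show ?thesis using l(1) that(2) by (simp only: upd_conv_take_nth_drop)
  qed
  have rep: "a vs = 0" if vs: "vs \<in> tangent_lists M k p" and ij: "i < j" "j < k" "vs ! i = vs ! j" for vs i j
  proof -
    define pre mid post where "pre = take i vs" and "mid = take (j - Suc i) (drop (Suc i) vs)"
      and "post = drop (Suc j) vs"
    have l: "length vs = k" "set vs \<subseteq> tangent_space M p" using vs by (simp_all add: tangent_lists_def)
    have "drop (Suc i) vs = mid @ drop j vs"
      using append_take_drop_id[of "j - Suc i" "drop (Suc i) vs"] ij unfolding mid_def by simp
    moreover have "drop j vs = vs ! i # post"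
      unfolding post_def using ij l by (simp add: Cons_nth_drop_Suc)
    ultimately have "vs = pre @ vs ! i # mid @ vs ! i # post"
      using id_take_nth_drop[of i vs] ij l unfolding pre_def by simp
    then show ?thesis using assms(2)[of pre "vs ! i" mid post] l by metis
  qed
  have "a vs = 0" if "vs \<in> tangent_lists M k p" "i < k" "j < k" "i \<noteq> j" "vs ! i = vs ! j" for vs i j
    using rep[OF that(1), of i j] rep[OF that(1), of j i] that(2-) by (metis linorder_neqE_nat)
  then show ?thesis unfolding alternating_form_at_def using lin by blast
qed

section \<open>Transition maps, tangent vectors and local coefficients on a single manifold\<close>

context
  fixes M :: "('a, 'e::euclidean_space) manifold"
  assumes M: "smooth_manifold M"
begin

lemma charts_subset_topspace: "c \<in> charts M \<Longrightarrow> fst c \<subseteq> topspace (mtop M)"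
  using M unfolding smooth_manifold_def by blast

lemma openin_chart: "c \<in> charts M \<Longrightarrow> openin (mtop M) (fst c)"
  using smooth_manifold_is_chart[OF M] by (simp add: is_chart_def)

lemma open_chart_image_Int: "c \<in> charts M \<Longrightarrow> openin (mtop M) W \<Longrightarrow> open (snd c ` (fst c \<inter> W))"
  by (rule open_chart_image[OF smooth_manifold_is_chart[OF M]])

lemma chart_inv_chart_at: "c \<in> charts M \<Longrightarrow> p \<in> fst c \<Longrightarrow> chart_inv c (snd c p) = p"
  by (rule chart_inv_chart[OF smooth_manifold_is_chart[OF M]])

lemma some_chart_charts_at: "p \<in> topspace (mtop M) \<Longrightarrow> some_chart M p \<in> charts_at M p"
proof -
  assume "p \<in> topspace (mtop M)"
  then obtain c where "c \<in> charts_at M p"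
    using M unfolding smooth_manifold_def charts_at_def by blast
  then show ?thesis unfolding some_chart_def by (rule someI)
qed

lemma charts_at_topspace: "c \<in> charts_at M p \<Longrightarrow> p \<in> topspace (mtop M)"
  unfolding charts_at_def using charts_subset_topspace by blast

lemma transition_differentiable:
  assumes "c \<in> charts_at M p" "d \<in> charts_at M p"
  shows "(snd d \<circ> chart_inv c) differentiable (at (snd c p))"
proof -
  have "smooth_on (snd c ` (fst c \<inter> fst d)) (snd d \<circ> chart_inv c)" "snd c p \<in> snd c ` (fst c \<inter> fst d)"
    using M assms by (auto simp: smooth_manifold_def charts_at_def)
  then show ?thesis by (rule smooth_on_imp_differentiable)
qed

text \<open>The chain rule through the transition map; the factorization of
  \<open>h \<circ> chart_inv c\<close> holds on the open overlap of the two charts. With another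
  coordinate map for \<open>h\<close> it gives the cocycle rule for tangent vectors, and with
  \<open>snd d \<circ> f\<close> the independence of the differential from the chart of
  \<open>N\<close>.\<close>

lemma has_derivative_change_chart:
  fixes h :: "'a \<Rightarrow> 'x::real_normed_vector"
  assumes "c \<in> charts_at M p" "d \<in> charts_at M p"
    and "(h \<circ> chart_inv d) differentiable (at (snd d p))"
  shows "((h \<circ> chart_inv c) has_derivative
     (\<lambda>x. frechet_derivative (h \<circ> chart_inv d) (at (snd d p))
        (frechet_derivative (snd d \<circ> chart_inv c) (at (snd c p)) x))) (at (snd c p))"
proof -
  have cd: "c \<in> charts M" "d \<in> charts M" "p \<in> fst c" "p \<in> fst d"
    using assms(1,2) by (auto simp: charts_at_def)
  have p: "(snd d \<circ> chart_inv c) (snd c p) = snd d p"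
    using chart_inv_chart_at[OF cd(1,3)] by simp
  have "((h \<circ> chart_inv d) \<circ> (snd d \<circ> chart_inv c) has_derivative
      frechet_derivative (h \<circ> chart_inv d) (at (snd d p)) \<circ>
      frechet_derivative (snd d \<circ> chart_inv c) (at (snd c p))) (at (snd c p))"
    by (rule diff_chain_at) (use transition_differentiable[OF assms(1,2)] assms(3) p in
      \<open>simp_all add: frechet_derivative_works[symmetric]\<close>)
  then have "((h \<circ> chart_inv c) has_derivative
      frechet_derivative (h \<circ> chart_inv d) (at (snd d p)) \<circ>
      frechet_derivative (snd d \<circ> chart_inv c) (at (snd c p))) (at (snd c p))"
    by (rule has_derivative_transform_within_open[OF _ open_chart_image_Int[OF cd(1) openin_chart[OF cd(2)]]])
      (use cd in \<open>auto simp: chart_inv_chart_at[OF cd(1)] chart_inv_chart_at[OF cd(2)]\<close>)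
  then show ?thesis by (simp add: o_def)
qed

lemmas frechet_derivative_change_chart =
  fun_cong[OF frechet_derivative_at[OF has_derivative_change_chart], symmetric]

lemma frechet_derivative_chart_self:
  assumes "c \<in> charts_at M p"
  shows "frechet_derivative (snd c \<circ> chart_inv c) (at (snd c p)) x = x"
proof -
  have c: "c \<in> charts M" "p \<in> fst c" using assms by (auto simp: charts_at_def)
  have o: "open (snd c ` fst c)"
    using smooth_manifold_is_chart[OF M c(1)] by (simp add: is_chart_def)
  have "((snd c \<circ> chart_inv c) has_derivative (\<lambda>x. x)) (at (snd c p))"
    by (rule has_derivative_transform_within_open[OF has_derivative_ident o])
      (use c in \<open>auto simp: chart_inv_chart_at[OF c(1)]\<close>)
  from fun_cong[OF frechet_derivative_at[OF this], symmetric] show ?thesis .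
qed

lemma tangent_of_self: "c \<in> charts_at M p \<Longrightarrow> tangent_of M c p x c = x"
  by (simp add: tangent_of_def frechet_derivative_chart_self)

lemma tangent_of_in_tangent_space:
  assumes "c \<in> charts_at M p"
  shows "tangent_of M c p x \<in> tangent_space M p"
proof (rule tangent_spaceI)
  fix d e assume de: "d \<in> charts_at M p" "e \<in> charts_at M p"
  show "tangent_of M c p x e = frechet_derivative (snd e \<circ> chart_inv d) (at (snd d p)) (tangent_of M c p x d)"
    unfolding tangent_of_def if_P[OF de(1)] if_P[OF de(2)]
    by (rule frechet_derivative_change_chart[OF assms de(1) transition_differentiable[OF de]])
qed (simp add: tangent_of_def)

text \<open>Equality as functions, not only on the charts around \<open>p\<close>, because both
  sides take the default value 0 elsewhere.\<close>

lemma tangent_of_component: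
  assumes "v \<in> tangent_space M p" "c \<in> charts_at M p"
  shows "tangent_of M c p (v c) = v"
proof
  fix d
  show "tangent_of M c p (v c) d = v d"
    by (cases "d \<in> charts_at M p")
      (simp_all add: tangent_of_def tangent_space_change[OF assms] tangent_space_outside[OF assms(1)])
qed

lemma tangent_of_combination:
  assumes "c \<in> charts_at M p"
  shows "tangent_of M c p (r *\<^sub>R x + s *\<^sub>R y) =
    (\<lambda>d. r *\<^sub>R tangent_of M c p x d + s *\<^sub>R tangent_of M c p y d)"
proof
  fix d
  show "tangent_of M c p (r *\<^sub>R x + s *\<^sub>R y) d =
      r *\<^sub>R tangent_of M c p x d + s *\<^sub>R tangent_of M c p y d"
    unfolding tangent_of_def
    using linear_frechet_derivative[OF transition_differentiable[OF assms]]
    by (auto simp: linear_add linear_scale)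
qed

lemma local_coeff_components:
  assumes "c \<in> charts_at M p" "set vs \<subseteq> tangent_space M p"
  shows "local_coeff M c \<alpha> (map (\<lambda>v. v c) vs) (snd c p) = \<alpha> p vs"
proof -
  have "chart_inv c (snd c p) = p" using assms(1) chart_inv_chart_at by (auto simp: charts_at_def)
  moreover have "map (tangent_of M c p \<circ> (\<lambda>v. v c)) vs = vs"
    using assms by (intro map_idI) (simp add: subset_iff tangent_of_component)
  ultimately show ?thesis unfolding local_coeff_def by simp
qed

lemma local_coeff_at:
  "c \<in> charts_at M p \<Longrightarrow> local_coeff M c \<alpha> xs (snd c p) = \<alpha> p (map (tangent_of M c p) xs)"
  unfolding local_coeff_def by (simp add: charts_at_def chart_inv_chart_at)

lemma local_coeff_multilinear:
  assumes "alternating_form_at M p k (\<alpha> p)" "c \<in> charts_at M p"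
  shows "multilinear k (\<lambda>xs. local_coeff M c \<alpha> xs (snd c p))"
  unfolding multilinear_def local_coeff_at[OF assms(2)]
proof (intro allI impI)
  fix pre post :: "'e list" assume l: "Suc (length pre + length post) = k"
  let ?t = "tangent_of M c p"
  have tp: "?t x \<in> tangent_space M p" for x by (rule tangent_of_in_tangent_space[OF assms(2)])
  have c: "\<alpha> p (map ?t (pre @ (r *\<^sub>R x + s *\<^sub>R y) # post)) =
      r * \<alpha> p (map ?t (pre @ x # post)) + s * \<alpha> p (map ?t (pre @ y # post))" for x y r s
    using alternating_form_at_combination[OF assms(1), of "map ?t pre" "map ?t post" "?t x" "?t y" r s] l
      tp by (simp add: tangent_of_combination[OF assms(2)] image_subset_iff)
  show "linear (\<lambda>x. \<alpha> p (map ?t (pre @ x # post)))"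
    \<comment> \<open>Coefficients 1 and 1 give additivity, and a vanishing second coefficient gives
      homogeneity.\<close>
    using c[of 1 _ 1] c[of _ _ 0] by (intro linearI) auto
qed

lemma local_coeff_alternating:
  assumes "alternating_form_at M p k (\<alpha> p)" "c \<in> charts_at M p"
  shows "alternating k (\<lambda>xs. local_coeff M c \<alpha> xs (snd c p))"
  unfolding alternating_def local_coeff_at[OF assms(2)]
  using alternating_form_at_repeat[OF assms(1)] tangent_of_in_tangent_space[OF assms(2)]
  by (simp add: image_subset_iff)

lemma local_coeff_differentiable:
  assumes "smooth_form M (topspace (mtop M)) k \<alpha>" "c \<in> charts_at M p" "length xs = k"
  shows "local_coeff M c \<alpha> xs differentiable (at (snd c p))"
proof -
  have c: "c \<in> charts M" "p \<in> fst c" using assms(2) by (simp_all add: charts_at_def)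
  show ?thesis
    by (rule smooth_on_imp_differentiable[OF smooth_form_local_coeff[OF assms(1) c(1) assms(3)]])
      (use c charts_subset_topspace[OF c(1)] in blast)
qed

lemma local_coeff_cong:
  assumes "form_eq M (topspace (mtop M)) k \<alpha> \<beta>" "c \<in> charts_at M p" "length xs = k"
  shows "local_coeff M c \<alpha> xs (snd c p) = local_coeff M c \<beta> xs (snd c p)"
proof -
  have "map (tangent_of M c p) xs \<in> tangent_lists M k p"
    using assms(3) tangent_of_in_tangent_space[OF assms(2)]
    by (simp add: tangent_lists_def image_subset_iff)
  then show ?thesis
    using assms(1) charts_at_topspace[OF assms(2)] unfolding form_eq_def local_coeff_at[OF assms(2)] by blast
qed

text \<open>Equal forms have equal coefficients on the image of a chart, and that image is open, so
  the derivatives entering \<open>ext_deriv\<close> agree. Smoothness of \<open>\<alpha>\<close>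
  supplies the differentiability needed to transfer them.\<close>

lemma closed_form_cong:
  assumes "form_eq M (topspace (mtop M)) k \<alpha> \<beta>" "smooth_form M (topspace (mtop M)) k \<alpha>"
    and "closed_form M k \<alpha>"
  shows "closed_form M k \<beta>"
proof -
  have "ext_deriv M k \<beta> p vs = ext_deriv M k \<alpha> p vs"
    if p: "p \<in> topspace (mtop M)" and vs: "vs \<in> tangent_lists M (Suc k) p" for p vs
  proof -
    let ?c = "some_chart M p"
    have c: "?c \<in> charts_at M p" by (rule some_chart_charts_at[OF p])
    then have c': "?c \<in> charts M" "p \<in> fst ?c" by (simp_all add: charts_at_def)
    have "frechet_derivative (local_coeff M ?c \<alpha> xs) (at (snd ?c p)) =
        frechet_derivative (local_coeff M ?c \<beta> xs) (at (snd ?c p))" if xs: "length xs = k" for xs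
    proof (rule frechet_derivative_transform_within_open[OF local_coeff_differentiable[OF assms(2) c xs]])
      show "open (snd ?c ` (fst ?c \<inter> topspace (mtop M)))"
        by (rule open_chart_image_Int[OF c'(1) openin_topspace])
      show "snd ?c p \<in> snd ?c ` (fst ?c \<inter> topspace (mtop M))" using c'(2) p by blast
      fix y assume "y \<in> snd ?c ` (fst ?c \<inter> topspace (mtop M))"
      then obtain q where "q \<in> fst ?c" "y = snd ?c q" by blast
      then show "local_coeff M ?c \<alpha> xs y = local_coeff M ?c \<beta> xs y"
        using local_coeff_cong[OF assms(1) _ xs] c'(1) by (simp add: charts_at_def)
    qed
    then show ?thesis using vs unfolding ext_deriv_def Let_def tangent_lists_def
      by (simp cong: sum.cong_simp)
  qed
  then show ?thesis using assms(3) unfolding closed_form_def form_eq_def by simp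
qed

end

section \<open>Maps between manifolds\<close>

locale smooth_mapping =
  fixes N :: "('a, 'e::euclidean_space) manifold" and M :: "('b, 'f::euclidean_space) manifold"
    and f :: "'a \<Rightarrow> 'b"
  assumes N: "smooth_manifold N" and M: "smooth_manifold M" and f: "smooth_map N M f"
begin

lemma maps_topspace: "p \<in> topspace (mtop N) \<Longrightarrow> f p \<in> topspace (mtop M)"
  using f by (auto simp: smooth_map_def continuous_map_def Pi_iff)

lemma open_chart_preimage:
  assumes "c \<in> charts N" "d \<in> charts M"
  shows "open (snd c ` (fst c \<inter> f -` fst d))"
proof -
  have "openin (mtop N) {x \<in> topspace (mtop N). f x \<in> fst d}"
    using f openin_chart[OF M assms(2)]
    unfolding smooth_map_def continuous_map_def by blast
  moreover have "fst c \<inter> f -` fst d = fst c \<inter> {x \<in> topspace (mtop N). f x \<in> fst d}"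
    using charts_subset_topspace[OF N assms(1)] by auto
  ultimately show ?thesis using open_chart_image_Int[OF N assms(1)] by metis
qed

lemma smooth_on_local_map:
  "c \<in> charts N \<Longrightarrow> d \<in> charts M \<Longrightarrow> smooth_on (snd c ` (fst c \<inter> f -` fst d)) (snd d \<circ> f \<circ> chart_inv c)"
  using f by (simp add: smooth_map_def)

lemma local_map_differentiable:
  "c \<in> charts_at N p \<Longrightarrow> d \<in> charts_at M (f p) \<Longrightarrow>
   (snd d \<circ> f \<circ> chart_inv c) differentiable (at (snd c p))"
  by (rule smooth_on_imp_differentiable[OF smooth_on_local_map]) (auto simp: charts_at_def)

text \<open>Frees the differential from the arbitrary choice of \<open>some_chart\<close> in its
  definition: passing to \<open>c\<close> multiplies by a transition derivative, which is also how
  the components of \<open>v\<close> change.\<close>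

lemma differential_component:
  assumes "v \<in> tangent_space N p" "c \<in> charts_at N p" "d \<in> charts_at M (f p)"
  shows "differential N M f p v d = frechet_derivative (snd d \<circ> f \<circ> chart_inv c) (at (snd c p)) (v c)"
proof -
  let ?c = "some_chart N p"
  have c': "?c \<in> charts_at N p" using some_chart_charts_at[OF N charts_at_topspace[OF N assms(2)]] .
  have "frechet_derivative (snd d \<circ> f \<circ> chart_inv ?c) (at (snd ?c p)) (v ?c) =
      frechet_derivative (snd d \<circ> f \<circ> chart_inv c) (at (snd c p))
        (frechet_derivative (snd c \<circ> chart_inv ?c) (at (snd ?c p)) (v ?c))"
    by (rule frechet_derivative_change_chart[OF N c' assms(2) local_map_differentiable[OF assms(2,3)]])
  also have "frechet_derivative (snd c \<circ> chart_inv ?c) (at (snd ?c p)) (v ?c) = v c"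
    by (rule tangent_space_change[OF assms(1) c' assms(2), symmetric])
  finally show ?thesis unfolding differential_def Let_def if_P[OF assms(3)] .
qed

lemma differential_tangent_of:
  "c \<in> charts_at N p \<Longrightarrow> d \<in> charts_at M (f p) \<Longrightarrow>
   differential N M f p (tangent_of N c p x) d = frechet_derivative (snd d \<circ> f \<circ> chart_inv c) (at (snd c p)) x"
  using differential_component[OF tangent_of_in_tangent_space[OF N]] tangent_of_self[OF N] by metis

text \<open>The components at \<open>f p\<close> are compatible by the chain rule for
  \<open>f\<close> followed by a transition map of \<open>M\<close>. The argument \<open>v\<close>
  may be any family, since only its component in \<open>some_chart N p\<close> enters.\<close>

lemma differential_in_tangent_space:
  assumes "p \<in> topspace (mtop N)"
  shows "differential N M f p v \<in> tangent_space M (f p)"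
proof -
  let ?c = "some_chart N p"
  have c: "?c \<in> charts_at N p" using some_chart_charts_at[OF N assms] .
  have inv: "chart_inv ?c (snd ?c p) = p"
    using c chart_inv_chart_at[OF N] by (auto simp: charts_at_def)
  have eq: "frechet_derivative (snd e \<circ> f \<circ> chart_inv ?c) (at (snd ?c p)) x =
      frechet_derivative (snd e \<circ> chart_inv d) (at (snd d (f p)))
        (frechet_derivative (snd d \<circ> f \<circ> chart_inv ?c) (at (snd ?c p)) x)"
    if de: "d \<in> charts_at M (f p)" "e \<in> charts_at M (f p)" for d e x
  proof -
    have cc: "?c \<in> charts N" "d \<in> charts M" "p \<in> fst ?c" "f p \<in> fst d"
      using c de(1) by (auto simp: charts_at_def)
    have "((snd e \<circ> chart_inv d) \<circ> (snd d \<circ> f \<circ> chart_inv ?c) has_derivative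
        frechet_derivative (snd e \<circ> chart_inv d) (at (snd d (f p))) \<circ>
        frechet_derivative (snd d \<circ> f \<circ> chart_inv ?c) (at (snd ?c p))) (at (snd ?c p))"
      by (rule diff_chain_at) (use transition_differentiable[OF M de] local_map_differentiable[OF c de(1)] inv in
          \<open>simp_all add: frechet_derivative_works[symmetric]\<close>)
    then have "((snd e \<circ> f \<circ> chart_inv ?c) has_derivative
        frechet_derivative (snd e \<circ> chart_inv d) (at (snd d (f p))) \<circ>
        frechet_derivative (snd d \<circ> f \<circ> chart_inv ?c) (at (snd ?c p))) (at (snd ?c p))"
      by (rule has_derivative_transform_within_open[OF _ open_chart_preimage[OF cc(1,2)]])
        (use cc in \<open>auto simp: chart_inv_chart_at[OF M cc(2)] chart_inv_chart_at[OF N cc(1)]\<close>)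
    from fun_cong[OF frechet_derivative_at[OF this], symmetric] show ?thesis by simp
  qed
  show ?thesis unfolding differential_def Let_def
  proof (rule tangent_spaceI)
    fix d e assume de: "d \<in> charts_at M (f p)" "e \<in> charts_at M (f p)"
    show "(if e \<in> charts_at M (f p) then frechet_derivative (snd e \<circ> f \<circ> chart_inv ?c) (at (snd ?c p)) (v ?c) else 0) =
      frechet_derivative (snd e \<circ> chart_inv d) (at (snd d (f p)))
       (if d \<in> charts_at M (f p) then frechet_derivative (snd d \<circ> f \<circ> chart_inv ?c) (at (snd ?c p)) (v ?c) else 0)"
      unfolding if_P[OF de(1)] if_P[OF de(2)] by (rule eq[OF de])
  qed simp
qed

lemma differential_combination:
  assumes "p \<in> topspace (mtop N)"
  shows "differential N M f p (\<lambda>c. r *\<^sub>R v c + s *\<^sub>R w c) =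
    (\<lambda>d. r *\<^sub>R differential N M f p v d + s *\<^sub>R differential N M f p w d)"
  unfolding differential_def Let_def
proof
  fix d
  show "(if d \<in> charts_at M (f p) then frechet_derivative (snd d \<circ> f \<circ> chart_inv (some_chart N p))
      (at (snd (some_chart N p) p)) (r *\<^sub>R v (some_chart N p) + s *\<^sub>R w (some_chart N p)) else 0) =
    r *\<^sub>R (if d \<in> charts_at M (f p) then frechet_derivative (snd d \<circ> f \<circ> chart_inv (some_chart N p))
      (at (snd (some_chart N p) p)) (v (some_chart N p)) else 0) +
    s *\<^sub>R (if d \<in> charts_at M (f p) then frechet_derivative (snd d \<circ> f \<circ> chart_inv (some_chart N p))
      (at (snd (some_chart N p) p)) (w (some_chart N p)) else 0)"
  proof (cases "d \<in> charts_at M (f p)")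
    case True
    have l: "linear (frechet_derivative (snd d \<circ> f \<circ> chart_inv (some_chart N p)) (at (snd (some_chart N p) p)))"
      by (rule linear_frechet_derivative[OF local_map_differentiable[OF some_chart_charts_at[OF N assms] True]])
    show ?thesis unfolding if_P[OF True] by (simp only: linear_add[OF l] linear_scale[OF l])
  qed simp
qed

end

section \<open>Pullbacks and contractions of forms\<close>

context smooth_mapping
begin

text \<open>Covers pullback (no field) and contraction along \<open>f\<close> (one field), so that
  local coefficients and smoothness are treated once for both.\<close>

definition form_along ::
    "('a \<Rightarrow> ('b, 'f) tangent) list \<Rightarrow> ('b, 'f, real) form \<Rightarrow> ('a, 'e, real) form" where
  "form_along Us \<alpha> = (\<lambda>p vs. \<alpha> (f p) (map (\<lambda>U. U p) Us @ map (differential N M f p) vs))"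

lemma local_coeff_form_along:
  assumes "c \<in> charts_at N p" "d \<in> charts_at M (f p)"
    and "\<And>U. U \<in> set Us \<Longrightarrow> U p \<in> tangent_space M (f p)"
  shows "local_coeff N c (form_along Us \<alpha>) xs (snd c p) =
    local_coeff M d \<alpha> (map (\<lambda>U. U p d) Us @
      map (frechet_derivative (snd d \<circ> f \<circ> chart_inv c) (at (snd c p))) xs) (snd d (f p))"
proof -
  let ?vs = "map (\<lambda>U. U p) Us @ map (differential N M f p) (map (tangent_of N c p) xs)"
  have p: "p \<in> topspace (mtop N)" by (rule charts_at_topspace[OF N assms(1)])
  have "set ?vs \<subseteq> tangent_space M (f p)"
    using assms(3) differential_in_tangent_space[OF p] by auto
  from local_coeff_components[OF M assms(2) this, of \<alpha>]
  show ?thesis unfolding local_coeff_at[OF N assms(1)] form_along_def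
    by (simp add: o_def differential_tangent_of[OF assms(1,2)])
qed

lemma alternating_form_along:
  assumes "alternating_form_at M (f p) (length Us + k) (\<alpha> (f p))" "p \<in> topspace (mtop N)"
    and "\<And>U. U \<in> set Us \<Longrightarrow> U p \<in> tangent_space M (f p)"
  shows "alternating_form_at N p k (form_along Us \<alpha> p)"
proof (rule alternating_form_atI)
  let ?U = "map (\<lambda>U. U p) Us" and ?D = "differential N M f p"
  have U: "set ?U \<subseteq> tangent_space M (f p)" using assms(3) by auto
  have D: "?D v \<in> tangent_space M (f p)" for v by (rule differential_in_tangent_space[OF assms(2)])
  show "form_along Us \<alpha> p (pre @ (\<lambda>c. r *\<^sub>R v c + s *\<^sub>R w c) # post) =
      r * form_along Us \<alpha> p (pre @ v # post) + s * form_along Us \<alpha> p (pre @ w # post)"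
    if "Suc (length pre + length post) = k" for pre post v w r s
    using alternating_form_at_combination[OF assms(1), of "?U @ map ?D pre" "map ?D post" "?D v" "?D w" r s]
      that U D unfolding form_along_def
    by (simp add: differential_combination[OF assms(2)] image_subset_iff)
  show "form_along Us \<alpha> p (pre @ v # mid @ v # post) = 0"
    if "length (pre @ v # mid @ v # post) = k" for pre mid post v
    using alternating_form_at_repeat[OF assms(1), of "?U @ map ?D pre" "?D v" "map ?D mid" "map ?D post"]
      that U D unfolding form_along_def by (simp add: image_subset_iff)
qed

text \<open>In a pair of charts the coefficient is a coefficient of \<open>\<alpha>\<close> at the
  local map, evaluated on the components of the fields and on derivatives of the local map in
  constant directions. All of these are smooth functions of \<open>y\<close>. The pieces belonging
  to the charts of \<open>M\<close> cover the chart of \<open>N\<close> and are then glued.\<close>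

lemma smooth_form_along:
  assumes \<alpha>: "smooth_form M (topspace (mtop M)) (length Us + k) \<alpha>"
    and U: "\<And>U. U \<in> set Us \<Longrightarrow> vector_field_along N M f U"
  shows "smooth_form N (topspace (mtop N)) k (form_along Us \<alpha>)"
proof -
  have UT: "U p \<in> tangent_space M (f p)" if "U \<in> set Us" "p \<in> topspace (mtop N)" for U p
    using U[OF that(1)] that(2) by (simp add: vector_field_along_def)
  have alt: "alternating_form_at M q (length Us + k) (\<alpha> q)" if "q \<in> topspace (mtop M)" for q
    using \<alpha> that by (simp add: smooth_form_def)
  have "smooth_on (snd c ` (fst c \<inter> topspace (mtop N))) (local_coeff N c (form_along Us \<alpha>) xs)"
    if c: "c \<in> charts N" and xs: "length xs = k" for c xs
  proof -
    let ?S = "\<lambda>d. snd c ` (fst c \<inter> f -` fst d)"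
    have "smooth_on (?S d) (local_coeff N c (form_along Us \<alpha>) xs)" if d: "d \<in> charts M" for d
    proof -
      let ?\<phi> = "snd d \<circ> f \<circ> chart_inv c"
      let ?V = "snd d ` (fst d \<inter> topspace (mtop M))"
      let ?As = "map (\<lambda>U y. U (chart_inv c y) d) Us @ map (\<lambda>x y. frechet_derivative ?\<phi> (at y) x) xs"
      have inv: "chart_inv c (snd c p) = p" if "p \<in> fst c" for p
        by (rule chart_inv_chart_at[OF N c that])
      have S: "open (?S d)" by (rule open_chart_preimage[OF c d])
      have \<phi>: "smooth_on (?S d) ?\<phi>" by (rule smooth_on_local_map[OF c d])
      have "smooth_on (?S d) (\<lambda>y. local_coeff M d \<alpha> (map (\<lambda>a. a y) ?As @ []) (?\<phi> y))"
      proof (rule smooth_on_multilinear[OF S \<phi>])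
        show "?\<phi> ` ?S d \<subseteq> ?V"
          using inv charts_subset_topspace[OF M d] by auto
        show "smooth_on ?V (local_coeff M d \<alpha> zs)" if "length zs = length Us + k" for zs
          by (rule smooth_form_local_coeff[OF \<alpha> d that])
        show "multilinear (length Us + k) (\<lambda>zs. local_coeff M d \<alpha> zs z)" if z: "z \<in> ?V" for z
        proof -
          obtain q where q: "q \<in> fst d" "q \<in> topspace (mtop M)" "z = snd d q" using z by blast
          then show ?thesis
            using local_coeff_multilinear[where p = q and \<alpha> = \<alpha>, OF M alt[OF q(2)]] d by (simp add: charts_at_def)
        qed
        show "smooth_on (?S d) a" if "a \<in> set ?As" for a
          using that U c d smooth_on_frechet_derivative[OF \<phi>] by (auto simp: vector_field_along_def)
      qed (use xs in simp)
      then show ?thesis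
      proof (rule smooth_on_cong[OF S, rotated])
        fix y assume "y \<in> ?S d"
        then obtain p where p: "p \<in> fst c" "f p \<in> fst d" "y = snd c p" by blast
        have pt: "p \<in> topspace (mtop N)" using charts_subset_topspace[OF N c] p by blast
        have "c \<in> charts_at N p" "d \<in> charts_at M (f p)"
          using c d p by (simp_all add: charts_at_def)
        from local_coeff_form_along[OF this, of Us \<alpha> xs] UT[OF _ pt]
        show "local_coeff M d \<alpha> (map (\<lambda>a. a y) ?As @ []) (?\<phi> y) = local_coeff N c (form_along Us \<alpha>) xs y"
          using p by (simp add: o_def inv)
      qed
    qed
    then have "smooth_on (\<Union>(?S ` charts M)) (local_coeff N c (form_along Us \<alpha>) xs)"
      using open_chart_preimage[OF c] by (intro smooth_on_Union) auto
    then show ?thesis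
    proof (rule smooth_on_subset)
      show "snd c ` (fst c \<inter> topspace (mtop N)) \<subseteq> \<Union>(?S ` charts M)"
      proof (rule image_subsetI)
        fix p assume p: "p \<in> fst c \<inter> topspace (mtop N)"
        then have "some_chart M (f p) \<in> charts_at M (f p)"
          using some_chart_charts_at[OF M maps_topspace] by blast
        then show "snd c p \<in> \<Union>(?S ` charts M)" using p by (auto simp: charts_at_def)
      qed
    qed
  qed
  moreover have "alternating_form_at N p k (form_along Us \<alpha> p)" if "p \<in> topspace (mtop N)" for p
    using alternating_form_along alt[OF maps_topspace[OF that]] UT that by blast
  ultimately show ?thesis by (simp add: smooth_form_def)
qed

lemma pullback_form_along: "pullback_form N M f \<alpha> = form_along [] \<alpha>"
  by (simp add: pullback_form_def form_along_def)

lemma contract_along_form_along: "contract_along N M f U \<alpha> = form_along [U] \<alpha>"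
  by (simp add: contract_along_def form_along_def)

lemma smooth_form_pullback:
  "smooth_form M (topspace (mtop M)) k \<alpha> \<Longrightarrow> smooth_form N (topspace (mtop N)) k (pullback_form N M f \<alpha>)"
  unfolding pullback_form_along by (rule smooth_form_along) simp_all

lemma smooth_form_contract_along:
  "smooth_form M (topspace (mtop M)) (Suc k) \<alpha> \<Longrightarrow> vector_field_along N M f U \<Longrightarrow>
   smooth_form N (topspace (mtop N)) k (contract_along N M f U \<alpha>)"
  unfolding contract_along_form_along by (rule smooth_form_along) simp_all

text \<open>Computed in \<open>some_chart N p\<close> and \<open>some_chart M (f p)\<close>, the
  very charts that \<open>ext_deriv\<close> uses at \<open>p\<close> and at \<open>f p\<close>, so
  that the coordinate formula turns one exterior derivative into the other.\<close>

lemma closed_form_pullback: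
  assumes \<alpha>: "smooth_form M (topspace (mtop M)) k \<alpha>" and "closed_form M k \<alpha>"
  shows "closed_form N k (pullback_form N M f \<alpha>)"
proof -
  have "ext_deriv N k (pullback_form N M f \<alpha>) p vs = 0"
    if p: "p \<in> topspace (mtop N)" and vs: "vs \<in> tangent_lists N (Suc k) p" for p vs
  proof -
    let ?c = "some_chart N p" and ?d = "some_chart M (f p)"
    have c: "?c \<in> charts_at N p" and d: "?d \<in> charts_at M (f p)"
      by (rule some_chart_charts_at[OF N p]) (rule some_chart_charts_at[OF M maps_topspace[OF p]])
    then have cc: "?c \<in> charts N" "p \<in> fst ?c" "?d \<in> charts M" "f p \<in> fst ?d"
      by (simp_all add: charts_at_def)
    let ?\<phi> = "snd ?d \<circ> f \<circ> chart_inv ?c" and ?S = "snd ?c ` (fst ?c \<inter> f -` fst ?d)"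
    let ?V = "snd ?d ` (fst ?d \<inter> topspace (mtop M))" and ?y = "snd ?c p"
    let ?G = "local_coeff M ?d \<alpha>"
    define xs where "xs = map (\<lambda>v. v ?c) vs"
    define zs where "zs = map (frechet_derivative ?\<phi> (at ?y)) xs"
    have xs: "length xs = Suc k" using vs by (simp add: xs_def tangent_lists_def)
    have inv: "chart_inv ?c (snd ?c q) = q" if "q \<in> fst ?c" for q
      by (rule chart_inv_chart_at[OF N cc(1) that])
    have S: "open ?S" "?y \<in> ?S" using open_chart_preimage[OF cc(1,3)] cc by auto
    have V: "open ?V" "?\<phi> ` ?S \<subseteq> ?V"
      using open_chart_image_Int[OF M cc(3) openin_topspace] charts_subset_topspace[OF M cc(3)] inv by auto
    have y: "?\<phi> ?y = snd ?d (f p)" using inv[OF cc(2)] by simp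
    have alt: "alternating_form_at M q k (\<alpha> q)" if "q \<in> topspace (mtop M)" for q
      using \<alpha> that by (simp add: smooth_form_def)
    have mult: "multilinear k (\<lambda>xs. ?G xs z)" if z: "z \<in> ?V" for z
    proof -
      obtain q where q: "q \<in> fst ?d" "q \<in> topspace (mtop M)" "z = snd ?d q" using z by blast
      then show ?thesis
        using local_coeff_multilinear[where p = q and \<alpha> = \<alpha>, OF M alt[OF q(2)]] cc by (simp add: charts_at_def)
    qed
    have coeff: "frechet_derivative (local_coeff N ?c (pullback_form N M f \<alpha>) ws) (at ?y) =
        frechet_derivative (\<lambda>y. ?G (map (frechet_derivative ?\<phi> (at y)) ws) (?\<phi> y)) (at ?y)"
      if ws: "length ws = k" for ws
    proof (rule frechet_derivative_transform_within_open[OF _ S])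
      show "local_coeff N ?c (pullback_form N M f \<alpha>) ws differentiable (at ?y)"
        by (rule local_coeff_differentiable[OF N smooth_form_pullback[OF \<alpha>] c ws])
      fix y assume "y \<in> ?S"
      then obtain q where q: "q \<in> fst ?c" "f q \<in> fst ?d" "y = snd ?c q" by blast
      have "?c \<in> charts_at N q" "?d \<in> charts_at M (f q)" using cc q by (simp_all add: charts_at_def)
      from local_coeff_form_along[OF this, of "[]"]
      show "local_coeff N ?c (pullback_form N M f \<alpha>) ws y = ?G (map (frechet_derivative ?\<phi> (at y)) ws) (?\<phi> y)"
        using q by (simp add: pullback_form_along inv)
    qed
    have "ext_deriv N k (pullback_form N M f \<alpha>) p vs =
      (\<Sum>i\<le>k. (- 1) ^ i * frechet_derivative
        (\<lambda>y. ?G (map (frechet_derivative ?\<phi> (at y)) (take i xs @ drop (Suc i) xs)) (?\<phi> y)) (at ?y) (xs ! i))"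
      unfolding ext_deriv_def Let_def xs_def[symmetric]
      by (intro sum.cong refl arg_cong2[where f = "(*)"] fun_cong[OF coeff]) (use xs in simp)
    also have "\<dots> = (\<Sum>i\<le>k. (- 1) ^ i * frechet_derivative (?G (take i zs @ drop (Suc i) zs)) (at (?\<phi> ?y)) (zs ! i))"
      unfolding zs_def
    proof (rule coordinate_ext_deriv_pullback[OF S V smooth_on_local_map[OF cc(1,3)] _ mult _ xs])
      show "?G ws differentiable (at (?\<phi> ?y))" if "length ws = k" for ws
        unfolding y by (rule local_coeff_differentiable[OF M \<alpha> d that])
      show "alternating k (\<lambda>xs. ?G xs (?\<phi> ?y))"
        unfolding y by (rule local_coeff_alternating[where p = "f p" and \<alpha> = \<alpha>, OF M alt[OF maps_topspace[OF p]] d])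
    qed
    \<comment> \<open>The coordinate vectors \<open>zs\<close> are lifted to tangent vectors at
      \<open>f p\<close>; \<open>ext_deriv\<close> reads their components in the same chart and
      recovers \<open>zs\<close>.\<close>
    also have "\<dots> = ext_deriv M k \<alpha> (f p) (map (tangent_of M ?d (f p)) zs)"
      unfolding ext_deriv_def Let_def y by (simp add: o_def tangent_of_self[OF M d])
    also have "\<dots> = 0"
    proof -
      have "map (tangent_of M ?d (f p)) zs \<in> tangent_lists M (Suc k) (f p)"
        using tangent_of_in_tangent_space[OF M d] xs by (simp add: tangent_lists_def zs_def image_subset_iff)
      then show ?thesis
        using assms(2) maps_topspace[OF p] unfolding closed_form_def form_eq_def zero_form_def by blast
    qed
    finally show ?thesis .
  qed
  then show ?thesis unfolding closed_form_def form_eq_def zero_form_def by blast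
qed

end

lemma smooth_form_minus:
  assumes M: "smooth_manifold M" and "smooth_form M (topspace (mtop M)) k \<alpha>"
  shows "smooth_form M (topspace (mtop M)) k (form_minus \<alpha>)"
proof -
  have "smooth_on (snd c ` (fst c \<inter> topspace (mtop M))) (local_coeff M c (form_minus \<alpha>) xs)"
    if "c \<in> charts M" "length xs = k" for c xs
  proof -
    have "local_coeff M c (form_minus \<alpha>) xs = (\<lambda>y. - 1 * local_coeff M c \<alpha> xs y)"
      by (simp add: local_coeff_def form_minus_def)
    then show ?thesis
      using smooth_on_mult[OF open_chart_image_Int[OF M that(1) openin_topspace] smooth_on_const
          smooth_form_local_coeff[OF assms(2) that], of "- 1"] by (simp only:)
  qed
  moreover have "alternating_form_at M p k (form_minus \<alpha> p)" if "alternating_form_at M p k (\<alpha> p)" for p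
    using that unfolding alternating_form_at_def form_minus_def by simp
  ultimately show ?thesis using assms(2) by (simp add: smooth_form_def)
qed

section \<open>Wedge products\<close>

text \<open>Reindexing the sum over all permutations by
  \<open>\<sigma> \<mapsto> \<pi> \<circ> \<sigma>\<close> changes each sign by that of
  \<open>\<pi>\<close>.\<close>

lemma wedge_permute:
  assumes \<pi>: "\<pi> permutes {..<k + l}" and "length vs = k + l"
  shows "wedge k l \<alpha> \<beta> p (map (\<lambda>i. vs ! \<pi> i) [0..<k + l]) = of_int (sign \<pi>) * wedge k l \<alpha> \<beta> p vs"
proof -
  let ?h = "\<lambda>\<sigma>. of_int (sign \<sigma>) * \<alpha> p (map (\<lambda>i. vs ! \<sigma> i) [0..<k]) * \<beta> p (map (\<lambda>i. vs ! \<sigma> i) [k..<k + l])"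
  let ?P = "{\<sigma>. \<sigma> permutes {..<k + l}}"
  have fin: "finite {..<k + l}" by simp
  have "of_int (sign \<sigma>) * \<alpha> p (map (\<lambda>i. map (\<lambda>i. vs ! \<pi> i) [0..<k + l] ! \<sigma> i) [0..<k]) *
      \<beta> p (map (\<lambda>i. map (\<lambda>i. vs ! \<pi> i) [0..<k + l] ! \<sigma> i) [k..<k + l]) =
      of_int (sign \<pi>) * ?h (\<pi> \<circ> \<sigma>)" if "\<sigma> \<in> ?P" for \<sigma>
  proof -
    have \<sigma>: "\<sigma> permutes {..<k + l}" using that by simp
    have lt: "\<sigma> i < k + l" if "i < k + l" for i using permutes_in_image[OF \<sigma>, of i] that by simp
    have "sign (\<pi> \<circ> \<sigma>) = sign \<pi> * sign \<sigma>"
      using sign_compose permutes_imp_permutation[OF fin \<pi>] permutes_imp_permutation[OF fin \<sigma>] by blast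
    then have s: "sign \<sigma> = sign \<pi> * sign (\<pi> \<circ> \<sigma>)" by simp
    have 1: "map (\<lambda>i. map (\<lambda>i. vs ! \<pi> i) [0..<k + l] ! \<sigma> i) [0..<k] = map (\<lambda>i. vs ! (\<pi> \<circ> \<sigma>) i) [0..<k]"
      using lt by (intro map_cong) (simp_all del: upt_Suc)
    have 2: "map (\<lambda>i. map (\<lambda>i. vs ! \<pi> i) [0..<k + l] ! \<sigma> i) [k..<k + l] = map (\<lambda>i. vs ! (\<pi> \<circ> \<sigma>) i) [k..<k + l]"
      using lt by (intro map_cong) (simp_all del: upt_Suc)
    show ?thesis unfolding 1 2 by (subst s) (simp add: mult.assoc)
  qed
  then have "(\<Sum>\<sigma>\<in>?P. of_int (sign \<sigma>) * \<alpha> p (map (\<lambda>i. map (\<lambda>i. vs ! \<pi> i) [0..<k + l] ! \<sigma> i) [0..<k]) *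
      \<beta> p (map (\<lambda>i. map (\<lambda>i. vs ! \<pi> i) [0..<k + l] ! \<sigma> i) [k..<k + l])) =
    of_int (sign \<pi>) * (\<Sum>\<sigma>\<in>?P. ?h (\<pi> \<circ> \<sigma>))"
    unfolding sum_distrib_left by (rule sum.cong[OF refl])
  also have "(\<Sum>\<sigma>\<in>?P. ?h (\<pi> \<circ> \<sigma>)) = (\<Sum>\<sigma>\<in>?P. ?h \<sigma>)"
    using setum_permutations_compose_left[OF \<pi>, of ?h] by simp
  finally show ?thesis unfolding wedge_def by simp
qed

text \<open>Transposing two equal entries leaves the list unchanged but reverses the sign of the
  wedge product.\<close>

lemma wedge_repeat:
  fixes \<alpha> \<beta> :: "('a, 'e::euclidean_space, real) form"
  assumes "length vs = k + l" "i < k + l" "j < k + l" "i \<noteq> j" "vs ! i = vs ! j"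
  shows "wedge k l \<alpha> \<beta> p vs = 0"
proof -
  have \<pi>: "Transposition.transpose i j permutes {..<k + l}" using assms by (simp add: permutes_swap_id)
  have "map (\<lambda>m. vs ! Transposition.transpose i j m) [0..<k + l] = map (\<lambda>m. vs ! m) [0..<k + l]"
    using assms(5) by (intro map_cong) (auto simp: Transposition.transpose_def)
  also have "\<dots> = vs" using map_nth[of vs] assms(1) by simp
  finally show ?thesis using wedge_permute[OF \<pi> assms(1), of \<alpha> \<beta> p] assms(4) by (simp add: sign_swap_id)
qed

text \<open>In the summand of \<open>\<sigma>\<close>, entry \<open>\<sigma> m\<close> occupies
  position \<open>m\<close>. Hence a change of one argument affects exactly one slot of one of the
  two factors.\<close>

lemma map_list_update_permutes:
  assumes "\<sigma> permutes {..<n}" "length vs = n" "b \<le> n" "m < n"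
  shows "map (\<lambda>j. vs[\<sigma> m := x] ! \<sigma> j) [a..<b] =
    (if a \<le> m \<and> m < b then (map (\<lambda>j. vs ! \<sigma> j) [a..<b])[m - a := x] else map (\<lambda>j. vs ! \<sigma> j) [a..<b])"
proof -
  have inj: "\<sigma> i = \<sigma> j \<longleftrightarrow> i = j" for i j using permutes_inj[OF assms(1)] by (auto dest: injD)
  have lt: "\<sigma> i < n" if "i < n" for i using permutes_in_image[OF assms(1), of i] that by simp
  show ?thesis
    using assms(2-4) lt by (auto intro!: nth_equalityI simp: nth_list_update inj simp del: upt_Suc)
qed

lemma alternating_form_at_wedge:
  fixes \<alpha> \<beta> :: "('a, 'e::euclidean_space, real) form"
  assumes \<alpha>: "alternating_form_at M p k (\<alpha> p)" and \<beta>: "alternating_form_at M p l (\<beta> p)"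
  shows "alternating_form_at M p (k + l) (wedge k l \<alpha> \<beta> p)"
proof -
  have "wedge k l \<alpha> \<beta> p (vs[i := (\<lambda>c. r *\<^sub>R v c + s *\<^sub>R w c)]) =
      r * wedge k l \<alpha> \<beta> p (vs[i := v]) + s * wedge k l \<alpha> \<beta> p (vs[i := w])"
    if vs: "vs \<in> tangent_lists M (k + l) p" and i: "i < k + l"
      and vw: "v \<in> tangent_space M p" "w \<in> tangent_space M p" for vs i v w r s
  proof -
    let ?h = "\<lambda>\<sigma> x. of_int (sign \<sigma>) * \<alpha> p (map (\<lambda>j. vs[i := x] ! \<sigma> j) [0..<k]) *
        \<beta> p (map (\<lambda>j. vs[i := x] ! \<sigma> j) [k..<k + l])"
    let ?P = "{\<sigma>. \<sigma> permutes {..<k + l}}"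
    have len: "length vs = k + l" and sub: "set vs \<subseteq> tangent_space M p"
      using vs by (simp_all add: tangent_lists_def)
    have "?h \<sigma> (\<lambda>c. r *\<^sub>R v c + s *\<^sub>R w c) = r * ?h \<sigma> v + s * ?h \<sigma> w" if "\<sigma> \<in> ?P" for \<sigma>
    proof -
      have \<sigma>: "\<sigma> permutes {..<k + l}" using that by simp
      have lt: "\<sigma> i < k + l" if "i < k + l" for i using permutes_in_image[OF \<sigma>, of i] that by simp
      obtain m where m: "m < k + l" "i = \<sigma> m"
        using permutes_image[OF \<sigma>] i by (metis imageE lessThan_iff)
      have T: "map (\<lambda>j. vs ! \<sigma> j) [a..<b] \<in> tangent_lists M (b - a) p" if "b \<le> k + l" for a b
        using that sub lt len by (auto simp: tangent_lists_def simp del: upt_Suc)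
      have A: "\<alpha> p ((map (\<lambda>j. vs ! \<sigma> j) [0..<k])[m := (\<lambda>c. r *\<^sub>R v c + s *\<^sub>R w c)]) =
          r * \<alpha> p ((map (\<lambda>j. vs ! \<sigma> j) [0..<k])[m := v]) + s * \<alpha> p ((map (\<lambda>j. vs ! \<sigma> j) [0..<k])[m := w])"
        if "m < k" using \<alpha> T[of k 0] vw that unfolding alternating_form_at_def by simp
      have B: "\<beta> p ((map (\<lambda>j. vs ! \<sigma> j) [k..<k + l])[m - k := (\<lambda>c. r *\<^sub>R v c + s *\<^sub>R w c)]) =
          r * \<beta> p ((map (\<lambda>j. vs ! \<sigma> j) [k..<k + l])[m - k := v]) +
          s * \<beta> p ((map (\<lambda>j. vs ! \<sigma> j) [k..<k + l])[m - k := w])"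
        if "\<not> m < k" using \<beta> T[of "k + l" k] vw that m(1) unfolding alternating_form_at_def by simp
      show ?thesis
        using A B m(1)
        by (cases "m < k")
          (simp_all add: m(2) map_list_update_permutes[OF \<sigma> len _ m(1)] algebra_simps del: upt_Suc)
    qed
    then have "(\<Sum>\<sigma>\<in>?P. ?h \<sigma> (\<lambda>c. r *\<^sub>R v c + s *\<^sub>R w c)) = r * (\<Sum>\<sigma>\<in>?P. ?h \<sigma> v) + s * (\<Sum>\<sigma>\<in>?P. ?h \<sigma> w)"
      by (simp add: sum_distrib_left sum.distrib[symmetric] cong: sum.cong_simp)
    then show ?thesis unfolding wedge_def by (simp add: add_divide_distrib)
  qed
  moreover have "wedge k l \<alpha> \<beta> p vs = 0"
    if "vs \<in> tangent_lists M (k + l) p" "i < k + l" "j < k + l" "i \<noteq> j" "vs ! i = vs ! j" for vs i j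
    using wedge_repeat[OF _ that(2-)] that(1) by (simp add: tangent_lists_def)
  ultimately show ?thesis unfolding alternating_form_at_def by blast
qed

lemma local_coeff_wedge:
  fixes M :: "('a, 'e::euclidean_space) manifold"
  assumes "length xs = k + l"
  shows "local_coeff M c (wedge k l \<alpha> \<beta>) xs y =
    (\<Sum>\<sigma> | \<sigma> permutes {..<k + l}. of_int (sign \<sigma>) *
        local_coeff M c \<alpha> (map (\<lambda>i. xs ! \<sigma> i) [0..<k]) y *
        local_coeff M c \<beta> (map (\<lambda>i. xs ! \<sigma> i) [k..<k + l]) y) / (fact k * fact l)"
proof -
  have "map (\<lambda>i. map t xs ! \<sigma> i) [0..<k] = map t (map (\<lambda>i. xs ! \<sigma> i) [0..<k]) \<and>
      map (\<lambda>i. map t xs ! \<sigma> i) [k..<k + l] = map t (map (\<lambda>i. xs ! \<sigma> i) [k..<k + l])"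
    if "\<sigma> permutes {..<k + l}" for \<sigma> and t :: "_ \<Rightarrow> ('a, 'e) tangent"
    using permutes_in_image[OF that] assms by (auto simp del: upt_Suc)
  then show ?thesis unfolding local_coeff_def wedge_def
    by (intro arg_cong2[where f = "(/)"] sum.cong refl) (simp only: mem_Collect_eq)
qed

lemma smooth_form_wedge:
  assumes M: "smooth_manifold M"
    and \<alpha>: "smooth_form M (topspace (mtop M)) k \<alpha>" and \<beta>: "smooth_form M (topspace (mtop M)) l \<beta>"
  shows "smooth_form M (topspace (mtop M)) (k + l) (wedge k l \<alpha> \<beta>)"
proof -
  have "smooth_on (snd c ` (fst c \<inter> topspace (mtop M))) (local_coeff M c (wedge k l \<alpha> \<beta>) xs)"
    if c: "c \<in> charts M" and xs: "length xs = k + l" for c xs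
  proof -
    let ?S = "snd c ` (fst c \<inter> topspace (mtop M))"
    have S: "open ?S" by (rule open_chart_image_Int[OF M c openin_topspace])
    have "smooth_on ?S (\<lambda>y. (\<Sum>\<sigma> | \<sigma> permutes {..<k + l}. of_int (sign \<sigma>) *
        local_coeff M c \<alpha> (map (\<lambda>i. xs ! \<sigma> i) [0..<k]) y *
        local_coeff M c \<beta> (map (\<lambda>i. xs ! \<sigma> i) [k..<k + l]) y) * (1 / (fact k * fact l)))"
      by (intro smooth_on_mult smooth_on_sum smooth_on_const S
          smooth_form_local_coeff[OF \<alpha> c] smooth_form_local_coeff[OF \<beta> c]) simp_all
    then show ?thesis unfolding local_coeff_wedge[OF xs] by simp
  qed
  moreover have "alternating_form_at M p (k + l) (wedge k l \<alpha> \<beta> p)" if "p \<in> topspace (mtop M)" for p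
    by (rule alternating_form_at_wedge) (use \<alpha> \<beta> that in \<open>simp_all add: smooth_form_def\<close>)
  ultimately show ?thesis by (simp add: smooth_form_def)
qed

lemma (in smooth_mapping) pullback_form_wedge:
  assumes "length vs = k + l"
  shows "pullback_form N M f (wedge k l \<alpha> \<beta>) p vs = wedge k l (pullback_form N M f \<alpha>) (pullback_form N M f \<beta>) p vs"
proof -
  have "map (\<lambda>i. map t vs ! \<sigma> i) [0..<k] = map t (map (\<lambda>i. vs ! \<sigma> i) [0..<k]) \<and>
      map (\<lambda>i. map t vs ! \<sigma> i) [k..<k + l] = map t (map (\<lambda>i. vs ! \<sigma> i) [k..<k + l])"
    if "\<sigma> permutes {..<k + l}" for \<sigma> and t :: "_ \<Rightarrow> ('b, 'f) tangent"
    using permutes_in_image[OF that] assms by (auto simp del: upt_Suc)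
  then show ?thesis unfolding pullback_form_def wedge_def
    by (intro arg_cong2[where f = "(/)"] sum.cong refl) (simp only: mem_Collect_eq)
qed

section \<open>Explicit wedge products in low degrees\<close>

lemma signed_sum_permutes_Suc:
  fixes g :: "(nat \<Rightarrow> nat) \<Rightarrow> 'a::comm_ring_1"
  shows "(\<Sum>\<sigma> | \<sigma> permutes {..<Suc n}. of_int (sign \<sigma>) * g \<sigma>) =
   (\<Sum>b\<le>n. (if b = n then 1 else - 1) *
     (\<Sum>\<sigma> | \<sigma> permutes {..<n}. of_int (sign \<sigma>) * g (Transposition.transpose n b \<circ> \<sigma>)))"
proof -
  \<comment> \<open>Each permutation of \<open>{..<Suc n}\<close> is uniquely such a composition.
    For \<open>b = n\<close> the transposition is the identity, which accounts for the exceptional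
    sign.\<close>
  have "of_int (sign (Transposition.transpose n b \<circ> \<sigma>)) =
      (if b = n then 1 else - 1) * (of_int (sign \<sigma>) :: 'a)" if "\<sigma> permutes {..<n}" for b \<sigma>
    using permutes_imp_permutation[OF _ that] by (simp add: sign_compose permutation_swap_id sign_swap_id)
  then show ?thesis
    using sum_over_permutations_insert[of "{..<n}" n "\<lambda>\<sigma>. of_int (sign \<sigma>) * g \<sigma>"]
    by (simp add: lessThan_Suc lessThan_Suc_atMost[symmetric] sum_distrib_left mult.assoc cong: sum.cong_simp)
qed

lemma signed_sum_permutes_0:
  fixes g :: "(nat \<Rightarrow> nat) \<Rightarrow> 'a::comm_ring_1"
  shows "(\<Sum>\<sigma> | \<sigma> permutes {..<0}. of_int (sign \<sigma>) * g \<sigma>) = g id"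
  by simp

lemma signed_sum_permutes_3:
  fixes g :: "nat \<Rightarrow> nat \<Rightarrow> nat \<Rightarrow> 'a::comm_ring_1"
  shows "(\<Sum>\<sigma> | \<sigma> permutes {..<3}. of_int (sign \<sigma>) * g (\<sigma> 0) (\<sigma> 1) (\<sigma> 2)) =
    g 0 1 2 - g 0 2 1 - g 1 0 2 + g 1 2 0 + g 2 0 1 - g 2 1 0"
proof -
  have "3 = Suc (Suc (Suc 0))" by simp
  then show ?thesis
    by (simp only: signed_sum_permutes_Suc signed_sum_permutes_0)
      (simp add: Transposition.transpose_def numeral_2_eq_2)
qed

lemma signed_sum_permutes_4:
  fixes g :: "nat \<Rightarrow> nat \<Rightarrow> nat \<Rightarrow> nat \<Rightarrow> 'a::comm_ring_1"
  shows "(\<Sum>\<sigma> | \<sigma> permutes {..<4}. of_int (sign \<sigma>) * g (\<sigma> 0) (\<sigma> 1) (\<sigma> 2) (\<sigma> 3)) =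
    g 0 1 2 3 - g 0 1 3 2 - g 0 2 1 3 + g 0 2 3 1 + g 0 3 1 2 - g 0 3 2 1 -
    g 1 0 2 3 + g 1 0 3 2 + g 1 2 0 3 - g 1 2 3 0 - g 1 3 0 2 + g 1 3 2 0 +
    g 2 0 1 3 - g 2 0 3 1 - g 2 1 0 3 + g 2 1 3 0 + g 2 3 0 1 - g 2 3 1 0 -
    g 3 0 1 2 + g 3 0 2 1 + g 3 1 0 2 - g 3 1 2 0 - g 3 2 0 1 + g 3 2 1 0"
proof -
  have "4 = Suc (Suc (Suc (Suc 0)))" by simp
  then show ?thesis
    by (simp only: signed_sum_permutes_Suc signed_sum_permutes_0)
      (simp add: Transposition.transpose_def numeral_2_eq_2 numeral_3_eq_3)
qed

lemma wedge_1_1: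
  "wedge 1 1 \<alpha> \<beta> p [x, y] = \<alpha> p [x] * \<beta> p [y] - \<alpha> p [y] * \<beta> p [x]"
proof -
  have "1 + 1 = Suc (Suc 0)" by simp
  then show ?thesis
    unfolding wedge_def
    by (simp only: signed_sum_permutes_Suc signed_sum_permutes_0 mult.assoc)
      (simp add: Transposition.transpose_def)
qed

text \<open>The normalization divides by 2, and antisymmetry makes the six summands coincide in
  pairs, one pair per shuffle. Antisymmetry is asked only of the vectors that occur, because forms
  are controlled on tangent vectors alone.\<close>

lemma wedge_2_1:
  fixes \<alpha> \<beta> :: "('a, 'e, 'c::field_char_0) form"
  assumes "\<And>u v. u \<in> {x, y, z} \<Longrightarrow> v \<in> {x, y, z} \<Longrightarrow> \<alpha> p [v, u] = - \<alpha> p [u, v]"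
  shows "wedge 2 1 \<alpha> \<beta> p [x, y, z] =
    \<alpha> p [x, y] * \<beta> p [z] - \<alpha> p [x, z] * \<beta> p [y] + \<alpha> p [y, z] * \<beta> p [x]"
proof -
  have a: "\<alpha> p [y, x] = - \<alpha> p [x, y]" "\<alpha> p [z, x] = - \<alpha> p [x, z]" "\<alpha> p [z, y] = - \<alpha> p [y, z]"
    by (rule assms; simp)+
  have e: "(2::nat) + 1 = 3" "[2..<3] = [2]" "fact 2 * fact 1 = (2 :: 'c)"
    by simp_all
  have e0: "[0..<2] = [0, 1]" by (simp add: numeral_2_eq_2)
  define g where "g i j k = \<alpha> p [[x, y, z] ! i, [x, y, z] ! j] * \<beta> p [[x, y, z] ! k]" for i j k
  have eq: "wedge 2 1 \<alpha> \<beta> p [x, y, z] =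
      (\<Sum>\<sigma> | \<sigma> permutes {..<3}. of_int (sign \<sigma>) * g (\<sigma> 0) (\<sigma> 1) (\<sigma> 2)) / 2"
    unfolding wedge_def g_def by (simp only: e e0 list.map mult.assoc)
  show ?thesis unfolding eq signed_sum_permutes_3 by (simp add: field_simps g_def a numeral_2_eq_2)
qed

text \<open>As in the previous lemma, the 24 summands coincide in groups of four, which leaves the
  six shuffles.\<close>

lemma wedge_2_2:
  fixes \<alpha> \<beta> :: "('a, 'e, 'c::field_char_0) form"
  assumes "\<And>u v. u \<in> {x, y, z, w} \<Longrightarrow> v \<in> {x, y, z, w} \<Longrightarrow> \<alpha> p [v, u] = - \<alpha> p [u, v]"
    and "\<And>u v. u \<in> {x, y, z, w} \<Longrightarrow> v \<in> {x, y, z, w} \<Longrightarrow> \<beta> p [v, u] = - \<beta> p [u, v]"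
  shows "wedge 2 2 \<alpha> \<beta> p [x, y, z, w] =
    \<alpha> p [x, y] * \<beta> p [z, w] - \<alpha> p [x, z] * \<beta> p [y, w] + \<alpha> p [x, w] * \<beta> p [y, z] +
    \<alpha> p [y, z] * \<beta> p [x, w] - \<alpha> p [y, w] * \<beta> p [x, z] + \<alpha> p [z, w] * \<beta> p [x, y]"
proof -
  have a: "\<alpha> p [y, x] = - \<alpha> p [x, y]" "\<alpha> p [z, x] = - \<alpha> p [x, z]" "\<alpha> p [z, y] = - \<alpha> p [y, z]"
    "\<alpha> p [w, x] = - \<alpha> p [x, w]" "\<alpha> p [w, y] = - \<alpha> p [y, w]" "\<alpha> p [w, z] = - \<alpha> p [z, w]"
    by (rule assms(1); simp)+
  have b: "\<beta> p [y, x] = - \<beta> p [x, y]" "\<beta> p [z, x] = - \<beta> p [x, z]" "\<beta> p [z, y] = - \<beta> p [y, z]"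
    "\<beta> p [w, x] = - \<beta> p [x, w]" "\<beta> p [w, y] = - \<beta> p [y, w]" "\<beta> p [w, z] = - \<beta> p [z, w]"
    by (rule assms(2); simp)+
  let ?l = "[x, y, z, w]"
  have e: "(2::nat) + 2 = 4" "[2..<4] = [2, 3]" "fact 2 * fact 2 = (4 :: 'c)"
    by simp_all
  have e0: "[0..<2] = [0, 1]" by (simp add: numeral_2_eq_2)
  define g where "g i j k m = \<alpha> p [?l ! i, ?l ! j] * \<beta> p [?l ! k, ?l ! m]" for i j k m
  have eq: "wedge 2 2 \<alpha> \<beta> p ?l =
      (\<Sum>\<sigma> | \<sigma> permutes {..<4}. of_int (sign \<sigma>) * g (\<sigma> 0) (\<sigma> 1) (\<sigma> 2) (\<sigma> 3)) / 4"
    unfolding wedge_def g_def by (simp only: e e0 list.map mult.assoc)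
  show ?thesis unfolding eq signed_sum_permutes_4 by (simp add: field_simps g_def a b numeral_2_eq_2 numeral_3_eq_3)
qed

text \<open>Used to evaluate the volume form on a frame. Only permutations fixing 4 survive; they
  all contribute the same by \<open>wedge_permute\<close>, and their number cancels
  \<open>fact 4\<close>.\<close>

lemma wedge_4_1:
  fixes \<gamma> \<delta> :: "('a, 'e, real) form"
  assumes "length vs = 5" and \<beta>: "\<And>i. i < 4 \<Longrightarrow> \<beta> p [vs ! i] = 0"
  shows "wedge 4 1 (wedge 2 2 \<gamma> \<delta>) \<beta> p vs = wedge 2 2 \<gamma> \<delta> p (take 4 vs) * \<beta> p [vs ! 4]"
proof -
  let ?\<alpha> = "wedge 2 2 \<gamma> \<delta>"
  define g where "g \<sigma> = ?\<alpha> p (map (\<lambda>i. vs ! \<sigma> i) [0..<4]) * \<beta> p [vs ! \<sigma> 4]" for \<sigma>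
  \<comment> \<open>\<open>\<sigma>\<close> fixes 4 and the transposition sends 4 to
    \<open>b\<close>, so \<open>\<beta>\<close> receives a vector that it annihilates.\<close>
  have z: "g (Transposition.transpose 4 b \<circ> \<sigma>) = 0" if "b < 4" "\<sigma> permutes {..<4}" for b \<sigma>
    using permutes_not_in[OF that(2), of 4] \<beta>[OF that(1)] unfolding g_def by simp
  have "of_int (sign \<sigma>) * g (Transposition.transpose 4 4 \<circ> \<sigma>) = ?\<alpha> p (take 4 vs) * \<beta> p [vs ! 4]"
    if \<sigma>: "\<sigma> permutes {..<4}" for \<sigma>
  proof -
    have "\<sigma> i < 4" if "i < 4" for i using permutes_in_image[OF \<sigma>, of i] that by simp
    then have e: "map (\<lambda>i. vs ! \<sigma> i) [0..<4] = map (\<lambda>i. take 4 vs ! \<sigma> i) [0..<4]"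
      by (intro map_cong) simp_all
    have "?\<alpha> p (map (\<lambda>i. vs ! \<sigma> i) [0..<4]) = of_int (sign \<sigma>) * ?\<alpha> p (take 4 vs)"
      unfolding e using wedge_permute[of \<sigma> 2 2 "take 4 vs" \<gamma> \<delta> p] \<sigma> assms(1) by simp
    moreover have "real_of_int (sign \<sigma>) * real_of_int (sign \<sigma>) = 1"
      by (metis of_int_1 of_int_mult sign_idempotent)
    ultimately show ?thesis using permutes_not_in[OF \<sigma>, of 4] unfolding g_def by simp
  qed
  then have "(\<Sum>\<sigma> | \<sigma> permutes {..<4}. of_int (sign \<sigma>) * g (Transposition.transpose 4 4 \<circ> \<sigma>)) =
      fact 4 * (?\<alpha> p (take 4 vs) * \<beta> p [vs ! 4])"
    using card_permutations[of "{..<4::nat}" 4] by (simp cong: sum.cong_simp)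
  moreover have "(\<Sum>b<4. (if b = 4 then 1 else - 1) *
      (\<Sum>\<sigma> | \<sigma> permutes {..<4}. of_int (sign \<sigma>) * g (Transposition.transpose 4 b \<circ> \<sigma>))) = 0"
    using z by (intro sum.neutral ballI) simp
  moreover have "{..4} = insert 4 {..<4::nat}" by auto
  ultimately have "(\<Sum>\<sigma> | \<sigma> permutes {..<Suc 4}. of_int (sign \<sigma>) * g \<sigma>) =
      fact 4 * (?\<alpha> p (take 4 vs) * \<beta> p [vs ! 4])"
    unfolding signed_sum_permutes_Suc by simp
  moreover have "4 + 1 = Suc 4" "[4..<Suc 4] = [4]" by simp_all
  ultimately show ?thesis
    unfolding wedge_def g_def by (simp only: list.map mult.assoc) simp
qed

section \<open>Pointwise algebra of SU(3)-structures\<close>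

text \<open>Conjugate linear in the first argument, so that the imaginary part has the sign of
  \<open>e12 + e34 + e56\<close> when \<open>a\<close>, \<open>b\<close>, \<open>c\<close> are
  formed from consecutive pairs of a coframe.\<close>

definition herm :: "('v \<Rightarrow> complex) \<Rightarrow> ('v \<Rightarrow> complex) \<Rightarrow> ('v \<Rightarrow> complex) \<Rightarrow> 'v \<Rightarrow> 'v \<Rightarrow> complex" where
  "herm a b c x y = cnj (a x) * a y + cnj (b x) * b y + cnj (c x) * c y"

text \<open>The value of \<open>a \<and> b \<and> c\<close> on three vectors, as a determinant
  expanded along the row of \<open>a\<close>.\<close>

definition cdet :: "('v \<Rightarrow> complex) \<Rightarrow> ('v \<Rightarrow> complex) \<Rightarrow> ('v \<Rightarrow> complex) \<Rightarrow> 'v \<Rightarrow> 'v \<Rightarrow> 'v \<Rightarrow> complex" where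
  "cdet a b c x y z = a x * (b y * c z - b z * c y) - a y * (b x * c z - b z * c x) +
     a z * (b x * c y - b y * c x)"

text \<open>The real part of \<open>herm\<close> is the metric.\<close>

definition complex_coframe ::
    "('a, real^6) manifold \<Rightarrow> ('a, real^6, real) form \<Rightarrow> ('a, real^6, real) form \<Rightarrow>
     ('a, real^6, real) form \<Rightarrow> 'a \<Rightarrow> (('a, real^6) tangent \<Rightarrow> complex) \<Rightarrow>
     (('a, real^6) tangent \<Rightarrow> complex) \<Rightarrow> (('a, real^6) tangent \<Rightarrow> complex) \<Rightarrow> bool" where
  "complex_coframe M F \<Psi>p \<Psi>m p a b c \<longleftrightarrow>
     (\<forall>h\<in>{a, b, c}. \<forall>v\<in>tangent_space M p. \<forall>w\<in>tangent_space M p. \<forall>r s.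
        h (\<lambda>d. r *\<^sub>R v d + s *\<^sub>R w d) = r *\<^sub>R h v + s *\<^sub>R h w) \<and>
     (\<forall>x y z. \<exists>v\<in>tangent_space M p. a v = x \<and> b v = y \<and> c v = z) \<and>
     (\<forall>v\<in>tangent_space M p. a v = 0 \<and> b v = 0 \<and> c v = 0 \<longrightarrow> v = (\<lambda>d. 0)) \<and>
     (\<forall>v\<in>tangent_space M p. \<forall>w\<in>tangent_space M p. F p [v, w] = Im (herm a b c v w)) \<and>
     (\<forall>u\<in>tangent_space M p. \<forall>v\<in>tangent_space M p. \<forall>w\<in>tangent_space M p.
        Complex (\<Psi>p p [u, v, w]) (\<Psi>m p [u, v, w]) = cdet a b c u v w)"

lemma complex_coframeD:
  assumes "complex_coframe M F \<Psi>p \<Psi>m p a b c"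
  shows "v \<in> tangent_space M p \<Longrightarrow> w \<in> tangent_space M p \<Longrightarrow> h \<in> {a, b, c} \<Longrightarrow>
      h (\<lambda>d. r *\<^sub>R v d + s *\<^sub>R w d) = r *\<^sub>R h v + s *\<^sub>R h w"
    and "\<exists>v\<in>tangent_space M p. a v = x \<and> b v = y \<and> c v = z"
    and "v \<in> tangent_space M p \<Longrightarrow> a v = 0 \<Longrightarrow> b v = 0 \<Longrightarrow> c v = 0 \<Longrightarrow> v = (\<lambda>d. 0)"
    and "v \<in> tangent_space M p \<Longrightarrow> w \<in> tangent_space M p \<Longrightarrow> F p [v, w] = Im (herm a b c v w)"
    and "u \<in> tangent_space M p \<Longrightarrow> v \<in> tangent_space M p \<Longrightarrow> w \<in> tangent_space M p \<Longrightarrow>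
      Complex (\<Psi>p p [u, v, w]) (\<Psi>m p [u, v, w]) = cdet a b c u v w"
  using assms unfolding complex_coframe_def by blast+

text \<open>A cyclic permutation of three covectors is even and so preserves the determinant. It
  lets a rotation of the first two covectors act on any neighbouring pair.\<close>

lemma complex_coframe_cycle:
  assumes "complex_coframe M F \<Psi>p \<Psi>m p a b c"
  shows "complex_coframe M F \<Psi>p \<Psi>m p b c a"
proof -
  have "herm b c a v w = herm a b c v w" "cdet b c a u v w = cdet a b c u v w" for u v w
    by (simp_all add: herm_def cdet_def algebra_simps)
  moreover have "\<exists>v\<in>tangent_space M p. b v = x \<and> c v = y \<and> a v = z" for x y z
    using complex_coframeD(2)[OF assms] by blast
  moreover have "v = (\<lambda>d. 0)" if "v \<in> tangent_space M p" "b v = 0" "c v = 0" "a v = 0" for v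
    by (rule complex_coframeD(3)[OF assms that(1,4,2,3)])
  moreover have "h (\<lambda>d. r *\<^sub>R v d + s *\<^sub>R w d) = r *\<^sub>R h v + s *\<^sub>R h w"
    if "v \<in> tangent_space M p" "w \<in> tangent_space M p" "h \<in> {b, c, a}" for h v w r s
    by (rule complex_coframeD(1)[OF assms that(1,2)]) (use that(3) in blast)
  ultimately show ?thesis
    using complex_coframeD(4,5)[OF assms] unfolding complex_coframe_def by simp
qed

text \<open>If \<open>J w\<close> satisfies \<open>\<Psi>(J w, x, y) = \<i> \<Psi>(w, x, y)\<close> then \<open>F(v, J w)\<close> is the metric; such a \<open>J w\<close> is
  taken from the second coframe and recognized in the first.\<close>

lemma complex_coframe_metric_unique:
  assumes 1: "complex_coframe M F \<Psi>p \<Psi>m p a b c" and 2: "complex_coframe M F \<Psi>p \<Psi>m p a' b' c'"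
    and vw: "v \<in> tangent_space M p" "w \<in> tangent_space M p"
  shows "Re (herm a b c v w) = Re (herm a' b' c' v w)"
proof -
  let ?T = "tangent_space M p"
  note F1 = complex_coframeD(4)[OF 1] and F2 = complex_coframeD(4)[OF 2]
  note onto = complex_coframeD(2)[OF 1]
  have P: "cdet a b c u v w = cdet a' b' c' u v w" if "u \<in> ?T" "v \<in> ?T" "w \<in> ?T" for u v w
    using complex_coframeD(5)[OF 1 that] complex_coframeD(5)[OF 2 that] by simp
  obtain j where j: "j \<in> ?T" "a' j = \<i> * a' w" "b' j = \<i> * b' w" "c' j = \<i> * c' w"
    using complex_coframeD(2)[OF 2] by blast
  have J: "cdet a b c j x y = \<i> * cdet a b c w x y" if "x \<in> ?T" "y \<in> ?T" for x y
  proof -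
    have "cdet a' b' c' j x y = \<i> * cdet a' b' c' w x y" by (simp add: cdet_def j algebra_simps)
    then show ?thesis using P[OF j(1) that] P[OF vw(2) that] by simp
  qed
  \<comment> \<open>\<open>x\<close>, \<open>y\<close>, \<open>z\<close> are dual to
    \<open>a\<close>, \<open>b\<close>, \<open>c\<close>; inserting two of them into
    \<open>cdet\<close> isolates one coordinate of the first argument.\<close>
  obtain x where x: "x \<in> ?T" "a x = 1" "b x = 0" "c x = 0" using onto by blast
  obtain y where y: "y \<in> ?T" "a y = 0" "b y = 1" "c y = 0" using onto by blast
  obtain z where z: "z \<in> ?T" "a z = 0" "b z = 0" "c z = 1" using onto by blast
  have "a j = \<i> * a w" "b j = \<i> * b w" "c j = \<i> * c w"
    using J[OF y(1) z(1)] J[OF z(1) x(1)] J[OF x(1) y(1)] by (simp_all add: cdet_def x y z)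
  then have "F p [v, j] = Re (herm a b c v w)"
    using F1[OF vw(1) j(1)] by (simp add: herm_def algebra_simps)
  moreover have "F p [v, j] = Re (herm a' b' c' v w)"
    using F2[OF vw(1) j(1)] by (simp add: herm_def j algebra_simps)
  ultimately show ?thesis by simp
qed

text \<open>The matrix with rows \<open>(\<alpha>, \<beta>)\<close> and
  \<open>(- cnj \<beta>, cnj \<alpha>)\<close> is unitary of determinant one: the first property
  preserves \<open>herm\<close>, the second \<open>cdet\<close>. Its conjugate transpose is the
  inverse used for bijectivity.\<close>

lemma complex_coframe_rotate:
  assumes "complex_coframe M F \<Psi>p \<Psi>m p a b c" and n: "\<alpha> * cnj \<alpha> + \<beta> * cnj \<beta> = 1"
  shows "complex_coframe M F \<Psi>p \<Psi>m p (\<lambda>v. \<alpha> * a v + \<beta> * b v) (\<lambda>v. cnj \<alpha> * b v - cnj \<beta> * a v) c"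
    (is "complex_coframe _ _ _ _ _ ?a ?b c")
proof -
  have inv: "cnj \<alpha> * (\<alpha> * x + \<beta> * y) - \<beta> * (cnj \<alpha> * y - cnj \<beta> * x) = x"
    "cnj \<beta> * (\<alpha> * x + \<beta> * y) + \<alpha> * (cnj \<alpha> * y - cnj \<beta> * x) = y" for x y
  proof -
    have "cnj \<alpha> * (\<alpha> * x + \<beta> * y) - \<beta> * (cnj \<alpha> * y - cnj \<beta> * x) = (\<alpha> * cnj \<alpha> + \<beta> * cnj \<beta>) * x"
      "cnj \<beta> * (\<alpha> * x + \<beta> * y) + \<alpha> * (cnj \<alpha> * y - cnj \<beta> * x) = (\<alpha> * cnj \<alpha> + \<beta> * cnj \<beta>) * y"
      by (simp_all add: algebra_simps)
    then show "cnj \<alpha> * (\<alpha> * x + \<beta> * y) - \<beta> * (cnj \<alpha> * y - cnj \<beta> * x) = x"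
      "cnj \<beta> * (\<alpha> * x + \<beta> * y) + \<alpha> * (cnj \<alpha> * y - cnj \<beta> * x) = y" by (simp_all add: n)
  qed
  have "\<exists>v\<in>tangent_space M p. ?a v = x \<and> ?b v = y \<and> c v = z" for x y z
  proof -
    obtain v where v: "v \<in> tangent_space M p" "a v = cnj \<alpha> * x - \<beta> * y" "b v = cnj \<beta> * x + \<alpha> * y" "c v = z"
      using complex_coframeD(2)[OF assms(1)] by blast
    have "\<alpha> * (cnj \<alpha> * x - \<beta> * y) + \<beta> * (cnj \<beta> * x + \<alpha> * y) = (\<alpha> * cnj \<alpha> + \<beta> * cnj \<beta>) * x"
      "cnj \<alpha> * (cnj \<beta> * x + \<alpha> * y) - cnj \<beta> * (cnj \<alpha> * x - \<beta> * y) = (\<alpha> * cnj \<alpha> + \<beta> * cnj \<beta>) * y"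
      by (simp_all add: algebra_simps)
    then have "?a v = x" "?b v = y" unfolding v n by simp_all
    then show ?thesis using v(1,4) by blast
  qed
  moreover have "herm ?a ?b c = herm a b c"
  proof (intro ext)
    fix v w
    have "herm ?a ?b c v w =
        (\<alpha> * cnj \<alpha> + \<beta> * cnj \<beta>) * (cnj (a v) * a w + cnj (b v) * b w) + cnj (c v) * c w"
      by (simp add: herm_def algebra_simps)
    then show "herm ?a ?b c v w = herm a b c v w" by (simp add: n herm_def)
  qed
  moreover have "cdet ?a ?b c = cdet a b c"
  proof (intro ext)
    fix u v w
    have "cdet ?a ?b c u v w = (\<alpha> * cnj \<alpha> + \<beta> * cnj \<beta>) * cdet a b c u v w"
      by (simp add: cdet_def algebra_simps)
    then show "cdet ?a ?b c u v w = cdet a b c u v w" by (simp add: n)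
  qed
  moreover have "v = (\<lambda>d. 0)"
    if "v \<in> tangent_space M p" "?a v = 0" "?b v = 0" "c v = 0" for v
  proof -
    have "a v = 0" "b v = 0" using inv[of "a v" "b v"] unfolding that(2,3) by simp_all
    then show ?thesis using complex_coframeD(3)[OF assms(1) that(1)] that(4) by blast
  qed
  moreover have "h (\<lambda>d. r *\<^sub>R v d + s *\<^sub>R w d) = r *\<^sub>R h v + s *\<^sub>R h w"
    if "v \<in> tangent_space M p" "w \<in> tangent_space M p" "h \<in> {?a, ?b, c}" for h v w r s
  proof -
    have "a (\<lambda>d. r *\<^sub>R v d + s *\<^sub>R w d) = r *\<^sub>R a v + s *\<^sub>R a w"
      "b (\<lambda>d. r *\<^sub>R v d + s *\<^sub>R w d) = r *\<^sub>R b v + s *\<^sub>R b w"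
      "c (\<lambda>d. r *\<^sub>R v d + s *\<^sub>R w d) = r *\<^sub>R c v + s *\<^sub>R c w"
      using complex_coframeD(1)[OF assms(1) that(1,2)] by blast+
    then show ?thesis using that(3) by (auto simp: algebra_simps scaleR_conv_of_real)
  qed
  ultimately show ?thesis
    using complex_coframeD(4,5)[OF assms(1)] unfolding complex_coframe_def by simp
qed

text \<open>For \<open>(u, v) \<noteq> 0\<close> the row \<open>(\<alpha>, \<beta>)\<close> is the
  conjugate of \<open>(u, v)\<close> divided by its length \<open>r\<close>; for the zero vector the
  identity matrix serves.\<close>

lemma givens_rotation:
  obtains \<alpha> \<beta> :: complex and r :: real where "\<alpha> * cnj \<alpha> + \<beta> * cnj \<beta> = 1"
    "\<alpha> * u + \<beta> * v = of_real r" "r \<ge> 0" "cnj \<alpha> * v - cnj \<beta> * u = 0"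
proof (cases "u = 0 \<and> v = 0")
  case True
  then show ?thesis using that[of 1 0 0] by simp
next
  case False
  define r where "r = sqrt ((cmod u)\<^sup>2 + (cmod v)\<^sup>2)"
  have pos: "(cmod u)\<^sup>2 + (cmod v)\<^sup>2 > 0"
    using False by (auto simp: sum_power2_gt_zero_iff)
  then have r: "r > 0" "r * r = (cmod u)\<^sup>2 + (cmod v)\<^sup>2" unfolding r_def by auto
  have rr: "cnj u * u + cnj v * v = complex_of_real r * complex_of_real r"
    unfolding of_real_mult[symmetric] r(2) of_real_add complex_norm_square by (simp add: mult.commute)
  show ?thesis
  proof (rule that[of "cnj u / of_real r" "cnj v / of_real r" r])
    have "cnj u / of_real r * cnj (cnj u / of_real r) + cnj v / of_real r * cnj (cnj v / of_real r) =
        (cnj u * u + cnj v * v) / (complex_of_real r * complex_of_real r)"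
      by (simp add: add_divide_distrib)
    then show "cnj u / of_real r * cnj (cnj u / of_real r) + cnj v / of_real r * cnj (cnj v / of_real r) = 1"
      unfolding rr using r(1) by simp
    have "cnj u / of_real r * u + cnj v / of_real r * v = (cnj u * u + cnj v * v) / complex_of_real r"
      by (simp add: add_divide_distrib)
    then show "cnj u / of_real r * u + cnj v / of_real r * v = of_real r"
      unfolding rr using r(1) by simp
    show "cnj (cnj u / of_real r) * v - cnj (cnj v / of_real r) * u = 0" by (simp add: mult.commute)
  qed (use r(1) in simp)
qed

text \<open>A rotation of \<open>b\<close>, \<open>c\<close> makes the third coordinate of
  \<open>u\<close> vanish; a rotation of \<open>a\<close> and the new \<open>b'\<close> then removes
  the second one and leaves the third alone. The two cycles around the inner rotation restore the
  order of the covectors.\<close>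

lemma complex_coframe_normalize:
  assumes "complex_coframe M F \<Psi>p \<Psi>m p a b c"
  obtains a' b' c' r where "complex_coframe M F \<Psi>p \<Psi>m p a' b' c'"
    "a' u = of_real r" "r \<ge> 0" "b' u = 0" "c' u = 0"
proof -
  obtain \<alpha> \<beta> r where 1: "\<alpha> * cnj \<alpha> + \<beta> * cnj \<beta> = 1" "cnj \<alpha> * c u - cnj \<beta> * b u = 0"
    "\<alpha> * b u + \<beta> * c u = of_real r"
    using givens_rotation by metis
  define b' c' where "b' = (\<lambda>v. \<alpha> * b v + \<beta> * c v)" and "c' = (\<lambda>v. cnj \<alpha> * c v - cnj \<beta> * b v)"
  have C: "complex_coframe M F \<Psi>p \<Psi>m p a b' c'"
    unfolding b'_def c'_def
    by (intro complex_coframe_cycle[OF complex_coframe_cycle[OF complex_coframe_rotate]]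
        complex_coframe_cycle[OF assms] 1(1))
  have c': "c' u = 0" using 1(2) by (simp add: c'_def)
  obtain \<gamma> \<delta> s where 2: "\<gamma> * cnj \<gamma> + \<delta> * cnj \<delta> = 1" "\<gamma> * a u + \<delta> * b' u = of_real s" "s \<ge> 0"
    "cnj \<gamma> * b' u - cnj \<delta> * a u = 0"
    by (rule givens_rotation)
  show ?thesis
    by (rule that[OF complex_coframe_rotate[OF C 2(1)] 2(2,3,4) c'])
qed

lemma sum_1_6: "(\<Sum>i = 1..6. g i) = g 1 + g 2 + g 3 + g 4 + g 5 + g (6::nat)"
proof -
  have "{1..6} = {1, 2, 3, 4, 5, 6 :: nat}" by auto
  then show ?thesis by (simp add: add.assoc)
qed

lemma alternating_form_at_1_combination:
  assumes "alternating_form_at M p 1 \<alpha>" "v \<in> tangent_space M p" "w \<in> tangent_space M p"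
  shows "\<alpha> [\<lambda>d. r *\<^sub>R v d + s *\<^sub>R w d] = r * \<alpha> [v] + s * \<alpha> [w]"
  using alternating_form_at_combination[OF assms(1) _ _ assms(2,3), of "[]" "[]" r s] by simp

lemma wedge_wedge_1_1_1:
  "wedge 2 1 (wedge 1 1 \<alpha> \<beta>) \<gamma> p [u, v, w] =
    cdet (\<lambda>v. \<alpha> p [v]) (\<lambda>v. \<beta> p [v]) (\<lambda>v. \<gamma> p [v]) u v w"
proof -
  have "wedge 1 1 \<alpha> \<beta> p [y, x] = - wedge 1 1 \<alpha> \<beta> p [x, y]" for x y
    unfolding wedge_1_1 by simp
  from wedge_2_1[of u v w "wedge 1 1 \<alpha> \<beta>", OF this, of \<gamma>]
  show ?thesis unfolding wedge_1_1 cdet_def by (simp add: algebra_simps)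
qed

text \<open>Six independent covectors on a space of dimension 6 are coordinates: a proper range of
  \<open>L\<close> would have a nonzero normal vector, whose real components give a linear relation
  among the covectors. Surjectivity then implies injectivity by equality of dimensions.\<close>

lemma adapted_coframe_complex_coframe:
  assumes M: "smooth_manifold M" and e: "adapted_coframe M F \<Psi>p \<Psi>m S e" and p: "p \<in> S"
  shows "complex_coframe M F \<Psi>p \<Psi>m p (\<lambda>v. Complex (e 1 p [v]) (e 2 p [v]))
    (\<lambda>v. Complex (e 3 p [v]) (e 4 p [v])) (\<lambda>v. Complex (e 5 p [v]) (e 6 p [v]))"
    (is "complex_coframe _ _ _ _ _ ?a ?b ?c")
proof -
  let ?T = "tangent_space M p"
  have "p \<in> topspace (mtop M)" using e p openin_subset unfolding adapted_coframe_def by blast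
  then obtain d where d: "d \<in> charts_at M p" using some_chart_charts_at[OF M] by blast
  have alt: "alternating_form_at M p 1 (e i p)" if "i \<in> {1..6}" for i
    using e p that unfolding adapted_coframe_def smooth_form_def by blast
  have lin: "e i p [\<lambda>d. r *\<^sub>R v d + s *\<^sub>R w d] = r * e i p [v] + s * e i p [w]"
    if "i \<in> {1..6}" "v \<in> ?T" "w \<in> ?T" for i v w r s
    by (rule alternating_form_at_1_combination[OF alt[OF that(1)] that(2,3)])
  have linear: "h (\<lambda>d. r *\<^sub>R v d + s *\<^sub>R w d) = r *\<^sub>R h v + s *\<^sub>R h w"
    if "v \<in> ?T" "w \<in> ?T" "h \<in> {?a, ?b, ?c}" for h v w r s
    using that(3) lin[OF _ that(1,2)] by (auto simp: complex_eq_iff)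
  define L where "L x = (let v = tangent_of M d p x in (?a v, ?b v, ?c v))" for x
  have L: "linear L"
  proof (rule linearI)
    have T: "tangent_of M d p x \<in> ?T" for x by (rule tangent_of_in_tangent_space[OF M d])
    have "e i p [tangent_of M d p (x + y)] = e i p [tangent_of M d p x] + e i p [tangent_of M d p y]"
      if "i \<in> {1..6}" for i x y
      using lin[OF that T T, of 1 x 1 y] tangent_of_combination[OF M d, of 1 x 1 y] by simp
    then show "L (x + y) = L x + L y" for x y
      unfolding L_def by (simp add: Let_def complex_eq_iff)
    have "e i p [tangent_of M d p (r *\<^sub>R x)] = r * e i p [tangent_of M d p x]"
      if "i \<in> {1..6}" for i r x
      using lin[OF that T T, of r x 0 x] tangent_of_combination[OF M d, of r x 0 x] by simp
    then show "L (r *\<^sub>R x) = r *\<^sub>R L x" for r x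
      unfolding L_def by (simp add: Let_def complex_eq_iff)
  qed
  have surj: "surj L"
  proof (rule ccontr)
    assume "\<not> surj L"
    moreover have "span (range L) = range L"
      using linear_subspace_image[OF L subspace_UNIV] by (simp only: span_eq_iff)
    ultimately have "span (range L) \<noteq> UNIV" by metis
    from span_not_UNIV_orthogonal[OF this]
    obtain \<alpha> \<beta> \<gamma> where n: "(\<alpha>, \<beta>, \<gamma>) \<noteq> 0" and o: "\<And>x. (\<alpha>, \<beta>, \<gamma>) \<bullet> L x = 0"
      by (metis prod_cases3 rangeI span_base)
    \<comment> \<open>The real and imaginary parts of the normal vector are the coefficients of the
      forbidden relation.\<close>
    define q where "q i = (if i = 1 then Re \<alpha> else if i = 2 then Im \<alpha> else if i = 3 then Re \<beta>
      else if i = 4 then Im \<beta> else if i = 5 then Re \<gamma> else Im \<gamma>)" for i :: nat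
    have "(\<Sum>i=1..6. q i * e i p [v]) = 0" if "v \<in> ?T" for v
      using o[of "v d"] tangent_of_component[OF M that d]
      unfolding sum_1_6 by (simp add: L_def Let_def q_def inner_complex_def add.assoc)
    then have "\<forall>i\<in>{1..6}. q i = 0"
      using e p unfolding adapted_coframe_def by blast
    then have "q 1 = 0" "q 2 = 0" "q 3 = 0" "q 4 = 0" "q 5 = 0" "q 6 = 0" by auto
    then show False using n by (simp add: q_def complex_eq_iff zero_prod_def)
  qed
  have "inj L"
    by (rule linear_surjective_imp_injective[OF L surj]) simp
  then have inj: "v = (\<lambda>d. 0)" if v: "v \<in> ?T" "?a v = 0" "?b v = 0" "?c v = 0" for v
  proof -
    have "L (v d) = 0" using v tangent_of_component[OF M v(1) d] by (simp add: L_def zero_prod_def)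
    then have "v d = 0" using \<open>inj L\<close> linear_0[OF L] by (metis injD)
    \<comment> \<open>Zero is written as a combination so that linearity of
      \<open>tangent_of\<close> exhibits the vector as the zero function.\<close>
    then have "v = tangent_of M d p (0 *\<^sub>R v d + 0 *\<^sub>R v d)" using tangent_of_component[OF M v(1) d] by simp
    then show ?thesis unfolding tangent_of_combination[OF M d] by simp
  qed
  have onto: "\<exists>v\<in>?T. ?a v = x \<and> ?b v = y \<and> ?c v = z" for x y z
  proof -
    obtain u where "(x, y, z) = L u" using surj by (metis surjD)
    then show ?thesis using tangent_of_in_tangent_space[OF M d, of u] unfolding L_def Let_def by blast
  qed
  have F: "F p [v, w] = Im (herm ?a ?b ?c v w)" if "v \<in> ?T" "w \<in> ?T" for v w
  proof -
    have "[v, w] \<in> tangent_lists M 2 p" using that by (simp add: tangent_lists_def)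
    then have "F p [v, w] = form_sum (form_sum (wedge 1 1 (e 1) (e 2)) (wedge 1 1 (e 3) (e 4)))
        (wedge 1 1 (e 5) (e 6)) p [v, w]"
      using e p unfolding adapted_coframe_def form_eq_def by blast
    then show ?thesis unfolding form_sum_def wedge_1_1 by (simp add: herm_def algebra_simps)
  qed
  have \<Psi>: "Complex (\<Psi>p p [u, v, w]) (\<Psi>m p [u, v, w]) = cdet ?a ?b ?c u v w"
    if "u \<in> ?T" "v \<in> ?T" "w \<in> ?T" for u v w
  proof -
    have "[u, v, w] \<in> tangent_lists M 3 p" using that by (simp add: tangent_lists_def)
    then have "complex_form \<Psi>p \<Psi>m p [u, v, w] =
      wedge 2 1 (wedge 1 1 (complex_form (e 1) (e 2)) (complex_form (e 3) (e 4))) (complex_form (e 5) (e 6)) p [u, v, w]"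
      using e p unfolding adapted_coframe_def form_eq_def by blast
    also have "\<dots> = cdet ?a ?b ?c u v w"
      unfolding wedge_wedge_1_1_1 complex_form_def ..
    finally show ?thesis by (simp add: complex_form_def)
  qed
  show ?thesis unfolding complex_coframe_def
    by (intro conjI ballI allI impI; (elim conjE)?) (rule linear onto inj F \<Psi>; assumption)+
qed

section \<open>The metric of an SU(3)-structure in complex coframes\<close>

lemma SU3_structure_complex_coframe:
  assumes "smooth_manifold M" "SU3_structure M F \<Psi>p \<Psi>m" "p \<in> topspace (mtop M)"
  shows "\<exists>a b c. complex_coframe M F \<Psi>p \<Psi>m p a b c"
proof -
  obtain S e where "p \<in> S" "adapted_coframe M F \<Psi>p \<Psi>m S e"
    using assms(2,3) unfolding SU3_structure_def by blast
  from adapted_coframe_complex_coframe[OF assms(1) this(2,1)] show ?thesis by blast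
qed

text \<open>All candidates for the definite description agree with the value in the given complex
  coframe. That coframe lives at the single point \<open>p\<close>, so the formula also applies
  after a rotation chosen there.\<close>

lemma SU3_metric_complex_coframe:
  assumes M: "smooth_manifold M" and "SU3_structure M F \<Psi>p \<Psi>m" "p \<in> topspace (mtop M)"
    and c: "complex_coframe M F \<Psi>p \<Psi>m p a b c"
    and vw: "v \<in> tangent_space M p" "w \<in> tangent_space M p"
  shows "SU3_metric M F \<Psi>p \<Psi>m p v w = Re (herm a b c v w)"
proof -
  have val: "(\<Sum>i=1..6. e i p [v] * e i p [w]) = Re (herm a b c v w)"
    if "p \<in> S" "adapted_coframe M F \<Psi>p \<Psi>m S e" for S e
    using complex_coframe_metric_unique[OF adapted_coframe_complex_coframe[OF M that(2,1)] c vw]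
    unfolding sum_1_6 by (simp add: herm_def add.assoc)
  obtain S e where e: "p \<in> S" "adapted_coframe M F \<Psi>p \<Psi>m S e"
    using assms(2,3) unfolding SU3_structure_def by blast
  show ?thesis unfolding SU3_metric_def
  proof (rule the_equality)
    show "\<exists>S e. p \<in> S \<and> adapted_coframe M F \<Psi>p \<Psi>m S e \<and>
        Re (herm a b c v w) = (\<Sum>i=1..6. e i p [v] * e i p [w])"
      by (rule exI[of _ S], rule exI[of _ e]) (use e val[OF e] in simp)
    fix r assume "\<exists>S e. p \<in> S \<and> adapted_coframe M F \<Psi>p \<Psi>m S e \<and> r = (\<Sum>i=1..6. e i p [v] * e i p [w])"
    then obtain S' e' where "p \<in> S'" "adapted_coframe M F \<Psi>p \<Psi>m S' e'" "r = (\<Sum>i=1..6. e' i p [v] * e' i p [w])"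
      by (elim exE conjE) (rule that)
    then show "r = Re (herm a b c v w)" using val by simp
  qed
qed

text \<open>The coordinates \<open>t\<close>, \<open>z\<close>, \<open>w\<close> come from a complex coframe \<open>a\<close>, \<open>b\<close>, \<open>c\<close> with \<open>a U = 1\<close> and
  \<open>b U = c U = 0\<close>: on the normal complement of \<open>U\<close>, \<open>a\<close> is purely imaginary.\<close>

lemma hypersurface_coordinates:
  fixes N :: "('a, real^5) manifold" and M :: "('b, real^6) manifold"
  assumes N: "smooth_manifold N" and M: "smooth_manifold M" and imm: "immersion N M f"
    and U: "unit_normal_field N \<nu> M F \<Psi>p \<Psi>m f U" and S: "SU3_structure M F \<Psi>p \<Psi>m"
    and p: "p \<in> topspace (mtop N)"
  shows "\<exists>(t :: ('a, real^5) tangent \<Rightarrow> real) (z :: ('a, real^5) tangent \<Rightarrow> complex) w.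
    (\<forall>\<tau> x y. \<exists>v\<in>tangent_space N p. t v = \<tau> \<and> z v = x \<and> w v = y) \<and>
    (\<forall>v. F (f p) [U p, differential N M f p v] = t v) \<and>
    (\<forall>u\<in>tangent_space N p. \<forall>v\<in>tangent_space N p.
      F (f p) [differential N M f p u, differential N M f p v] = Im (cnj (z u) * z v + cnj (w u) * w v)) \<and>
    (\<forall>u v. Complex (\<Psi>p (f p) [U p, differential N M f p u, differential N M f p v])
        (\<Psi>m (f p) [U p, differential N M f p u, differential N M f p v]) = z u * w v - z v * w u) \<and>
    (\<forall>u\<in>tangent_space N p. \<forall>v\<in>tangent_space N p. \<forall>x\<in>tangent_space N p.
      Complex (\<Psi>p (f p) [differential N M f p u, differential N M f p v, differential N M f p x])
        (\<Psi>m (f p) [differential N M f p u, differential N M f p v, differential N M f p x]) =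
      \<i> * (t u * (z v * w x - z x * w v) - t v * (z u * w x - z x * w u) + t x * (z u * w v - z v * w u)))"
proof -
  interpret smooth_mapping N M f
    using N M imm by unfold_locales (simp_all add: immersion_def)
  let ?q = "f p" and ?D = "differential N M f p"
  have q: "?q \<in> topspace (mtop M)" by (rule maps_topspace[OF p])
  have DT: "?D v \<in> tangent_space M ?q" for v by (rule differential_in_tangent_space[OF p])
  have UT: "U p \<in> tangent_space M ?q"
    using U p unfolding unit_normal_field_def vector_field_along_def by blast
  obtain a0 b0 c0 where "complex_coframe M F \<Psi>p \<Psi>m ?q a0 b0 c0"
    using SU3_structure_complex_coframe[OF M S q] by blast
  from complex_coframe_normalize[OF this, of "U p"]
  obtain a b c r where C: "complex_coframe M F \<Psi>p \<Psi>m ?q a b c"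
    and r: "a (U p) = of_real r" "r \<ge> 0" "b (U p) = 0" "c (U p) = 0" by metis
  note metric = SU3_metric_complex_coframe[OF M S q C UT]
  have "SU3_metric M F \<Psi>p \<Psi>m ?q (U p) (U p) = 1"
    using U p unfolding unit_normal_field_def by blast
  then have "r * r = 1" using metric[OF UT] r by (simp add: herm_def)
  \<comment> \<open>The unit length of \<open>U p\<close> gives \<open>r * r = 1\<close>, and
    nonnegativity of \<open>r\<close> selects the root.\<close>
  then have "r = 1" using r(2) by (metis abs_of_nonneg real_sqrt_abs2 real_sqrt_one)
  then have a: "a (U p) = 1" using r(1) by simp
  define t where "t v = Im (a (?D v))" for v
  define z where "z v = b (?D v)" for v
  define w where "w v = c (?D v)" for v
  have aD: "a (?D v) = \<i> * t v" if "v \<in> tangent_space N p" for v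
  proof -
    have "SU3_metric M F \<Psi>p \<Psi>m ?q (U p) (?D v) = 0"
      using U p that unfolding unit_normal_field_def by blast
    then have "Re (a (?D v)) = 0" using metric[OF DT] by (simp add: herm_def a r(3,4))
    then show ?thesis by (simp add: t_def complex_eq_iff)
  qed
  have onto: "\<exists>v\<in>tangent_space N p. t v = \<tau> \<and> z v = x \<and> w v = y" for \<tau> x y
  proof -
    obtain d where d: "d \<in> charts_at N p" using some_chart_charts_at[OF N p] by blast
    let ?t = "tangent_of N d p"
    have T: "?t x \<in> tangent_space N p" for x by (rule tangent_of_in_tangent_space[OF N d])
    define L where "L x = (t (?t x), z (?t x), w (?t x))" for x
    have lin: "h (?D (?t (r *\<^sub>R x + s *\<^sub>R y))) = r *\<^sub>R h (?D (?t x)) + s *\<^sub>R h (?D (?t y))"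
      if "h \<in> {a, b, c}" for h r s x y
      unfolding tangent_of_combination[OF N d] differential_combination[OF p]
      by (rule complex_coframeD(1)[OF C DT DT that])
    have L: "linear L"
      using lin[of a 1 _ 1] lin[of a _ _ 0] lin[of b 1 _ 1] lin[of b _ _ 0] lin[of c 1 _ 1] lin[of c _ _ 0]
      by (intro linearI) (simp_all add: L_def t_def z_def w_def)
    \<comment> \<open>The real part of \<open>a\<close> vanishes on the image of the differential,
      so zero \<open>t\<close>, \<open>z\<close> and \<open>w\<close> force a zero image vector, and
      the immersion property applies. Source and target of \<open>L\<close> both have real dimension
      5, hence \<open>L\<close> is also surjective.\<close>
    have "inj L"
    proof (rule linear_injective_0[OF L, THEN iffD2], intro allI impI)
      fix x assume "L x = 0"
      then have "a (?D (?t x)) = 0" "b (?D (?t x)) = 0" "c (?D (?t x)) = 0"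
        using aD[OF T] by (simp_all add: L_def z_def w_def zero_prod_def)
      then have "?D (?t x) = (\<lambda>d. 0)" by (rule complex_coframeD(3)[OF C DT])
      also have "\<dots> = ?D (?t 0)"
        using tangent_of_combination[OF N d, of 0 0 0 0]
          differential_combination[OF p, of 0 "?t 0" 0 "?t 0"] by simp
      finally have "?t x = ?t 0"
        using imm p T unfolding immersion_def inj_on_def by blast
      then show "x = 0" using tangent_of_self[OF N d] by metis
    qed
    then have "surj L" by (rule linear_injective_imp_surjective[OF L]) simp
    then obtain u where "(\<tau>, x, y) = L u" by (metis surjD)
    then show ?thesis using T unfolding L_def by blast
  qed
  show ?thesis
  proof (rule exI[of _ t], rule exI[of _ z], rule exI[of _ w], intro conjI allI ballI)
    show "F ?q [U p, ?D v] = t v" for v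
      using complex_coframeD(4)[OF C UT DT] by (simp add: herm_def a r(3,4) t_def)
    show "F ?q [?D u, ?D v] = Im (cnj (z u) * z v + cnj (w u) * w v)"
      if "u \<in> tangent_space N p" "v \<in> tangent_space N p" for u v
      unfolding complex_coframeD(4)[OF C DT DT] herm_def aD[OF that(1)] aD[OF that(2)] z_def w_def by simp
    show "Complex (\<Psi>p ?q [U p, ?D u, ?D v]) (\<Psi>m ?q [U p, ?D u, ?D v]) = z u * w v - z v * w u" for u v
      unfolding complex_coframeD(5)[OF C UT DT DT] cdet_def a r(3,4) z_def w_def by simp
    show "Complex (\<Psi>p ?q [?D u, ?D v, ?D x]) (\<Psi>m ?q [?D u, ?D v, ?D x]) =
      \<i> * (t u * (z v * w x - z x * w v) - t v * (z u * w x - z x * w u) + t x * (z u * w v - z v * w u))"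
      if "u \<in> tangent_space N p" "v \<in> tangent_space N p" "x \<in> tangent_space N p" for u v x
      unfolding complex_coframeD(5)[OF C DT DT DT] cdet_def aD[OF that(1)] aD[OF that(2)] aD[OF that(3)]
        z_def w_def by (simp add: algebra_simps)
  qed (rule onto)
qed

text \<open>The parameters \<open>\<psi>p\<close> and \<open>\<psi>m\<close> stand for the pullbacks
  of \<open>\<Psi>p\<close> and \<open>\<Psi>m\<close>. Their formulas are the real and imaginary
  parts of \<open>\<i>\<close> times \<open>t \<and> z \<and> w\<close>, hence \<open>- Im\<close>
  for the first and \<open>Re\<close> for the second.\<close>

definition adapted_coordinates ::
    "('a, real^5) manifold \<Rightarrow> ('a, real^5, real) form \<Rightarrow> ('a, real^5, real) form \<Rightarrow>
     ('a, real^5, real) form \<Rightarrow> ('a, real^5, real) form \<Rightarrow> ('a, real^5, real) form \<Rightarrow>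
     ('a, real^5, real) form \<Rightarrow> 'a \<Rightarrow> (('a, real^5) tangent \<Rightarrow> real) \<Rightarrow>
     (('a, real^5) tangent \<Rightarrow> complex) \<Rightarrow> (('a, real^5) tangent \<Rightarrow> complex) \<Rightarrow> bool" where
  "adapted_coordinates N \<eta> \<omega>1 \<omega>2 \<omega>3 \<psi>p \<psi>m p t z w \<longleftrightarrow>
     (\<forall>\<tau> x y. \<exists>v\<in>tangent_space N p. t v = \<tau> \<and> z v = x \<and> w v = y) \<and>
     (\<forall>v. \<eta> p [v] = - t v) \<and>
     (\<forall>u v. \<omega>1 p [u, v] = Im (z u * w v - z v * w u)) \<and>
     (\<forall>u v. \<omega>2 p [u, v] = - Re (z u * w v - z v * w u)) \<and>
     (\<forall>u\<in>tangent_space N p. \<forall>v\<in>tangent_space N p.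
        \<omega>3 p [u, v] = Im (cnj (z u) * z v + cnj (w u) * w v)) \<and>
     (\<forall>u\<in>tangent_space N p. \<forall>v\<in>tangent_space N p. \<forall>x\<in>tangent_space N p.
        \<psi>p p [u, v, x] = - Im (t u * (z v * w x - z x * w v) -
          t v * (z u * w x - z x * w u) + t x * (z u * w v - z v * w u)) \<and>
        \<psi>m p [u, v, x] = Re (t u * (z v * w x - z x * w v) -
          t v * (z u * w x - z x * w u) + t x * (z u * w v - z v * w u)))"

lemma adapted_coordinatesD:
  assumes "adapted_coordinates N \<eta> \<omega>1 \<omega>2 \<omega>3 \<psi>p \<psi>m p t z w"
  shows "\<exists>v\<in>tangent_space N p. t v = \<tau> \<and> z v = x' \<and> w v = y'"
    and "\<eta> p [v] = - t v"
    and "\<omega>1 p [u, v] = Im (z u * w v - z v * w u)"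
    and "\<omega>2 p [u, v] = - Re (z u * w v - z v * w u)"
    and "u \<in> tangent_space N p \<Longrightarrow> v \<in> tangent_space N p \<Longrightarrow>
      \<omega>3 p [u, v] = Im (cnj (z u) * z v + cnj (w u) * w v)"
    and "u \<in> tangent_space N p \<Longrightarrow> v \<in> tangent_space N p \<Longrightarrow> x \<in> tangent_space N p \<Longrightarrow>
      \<psi>p p [u, v, x] = - Im (t u * (z v * w x - z x * w v) -
          t v * (z u * w x - z x * w u) + t x * (z u * w v - z v * w u))"
    and "u \<in> tangent_space N p \<Longrightarrow> v \<in> tangent_space N p \<Longrightarrow> x \<in> tangent_space N p \<Longrightarrow>
      \<psi>m p [u, v, x] = Re (t u * (z v * w x - z x * w v) -
          t v * (z u * w x - z x * w u) + t x * (z u * w v - z v * w u))"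
  using assms unfolding adapted_coordinates_def by blast+

theorem proposition2p5:
  fixes N :: "('a, real^5) manifold" and M :: "('b, real^6) manifold"
    and \<nu> :: "('a, real^5, real) form"
    and F \<Psi>p \<Psi>m :: "('b, real^6, real) form"
    and f :: "'a \<Rightarrow> 'b" and U :: "'a \<Rightarrow> ('b, real^6) tangent"
    and \<eta> \<omega>1 \<omega>2 \<omega>3 :: "('a, real^5, real) form"
  assumes "smooth_manifold N" and "orientation_form N \<nu>"
    and "smooth_manifold M"
    and "immersion N M f"
    and "unit_normal_field N \<nu> M F \<Psi>p \<Psi>m f U"
    and "balanced_SU3_structure M F \<Psi>p \<Psi>m"
    and "\<eta> = form_minus (contract_along N M f U F)"
    and "\<omega>1 = contract_along N M f U \<Psi>m"
    and "\<omega>2 = form_minus (contract_along N M f U \<Psi>p)"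
    and "\<omega>3 = pullback_form N M f F"
  shows "balanced_SU2_structure N \<eta> \<omega>1 \<omega>2 \<omega>3"
proof -
  interpret smooth_mapping N M f
    using assms(1,3,4) by unfold_locales (simp_all add: immersion_def)
  let ?P = "topspace (mtop N)" and ?Q = "topspace (mtop M)"
  have SU3: "SU3_structure M F \<Psi>p \<Psi>m" and closed: "closed_form M 4 (wedge 2 2 F F)"
    "closed_form M 3 \<Psi>p" "closed_form M 3 \<Psi>m"
    using assms(6) by (simp_all add: balanced_SU3_structure_def)
  have sF: "smooth_form M ?Q 2 F" and s\<Psi>p: "smooth_form M ?Q 3 \<Psi>p" and s\<Psi>m: "smooth_form M ?Q 3 \<Psi>m"
    using SU3 by (simp_all add: SU3_structure_def)
  have U: "vector_field_along N M f U" using assms(5) by (simp add: unit_normal_field_def)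
  have s\<eta>: "smooth_form N ?P 1 \<eta>"
    unfolding assms(7) by (rule smooth_form_minus[OF N smooth_form_contract_along[OF _ U]]) (use sF in \<open>simp add: numeral_2_eq_2\<close>)
  have s1: "smooth_form N ?P 2 \<omega>1"
    unfolding assms(8) by (rule smooth_form_contract_along[OF _ U]) (use s\<Psi>m in simp)
  have s2: "smooth_form N ?P 2 \<omega>2"
    unfolding assms(9) by (rule smooth_form_minus[OF N smooth_form_contract_along[OF _ U]]) (use s\<Psi>p in simp)
  have s3: "smooth_form N ?P 2 \<omega>3"
    unfolding assms(10) by (rule smooth_form_pullback[OF sF])
  have s4: "smooth_form N ?P 4 (wedge 2 2 \<omega>3 \<omega>3)"
    using smooth_form_wedge[OF N s3 s3] by simp
  have coords: "\<exists>t z w. adapted_coordinates N \<eta> \<omega>1 \<omega>2 \<omega>3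
      (pullback_form N M f \<Psi>p) (pullback_form N M f \<Psi>m) p t z w"
    if p: "p \<in> ?P" for p
  proof -
    obtain t :: "('a, real^5) tangent \<Rightarrow> real" and z w :: "('a, real^5) tangent \<Rightarrow> complex" where
      o: "\<forall>\<tau> x y. \<exists>v\<in>tangent_space N p. t v = \<tau> \<and> z v = x \<and> w v = y" and
      c: "\<forall>v. F (f p) [U p, differential N M f p v] = t v"
      "\<forall>u\<in>tangent_space N p. \<forall>v\<in>tangent_space N p.
        F (f p) [differential N M f p u, differential N M f p v] = Im (cnj (z u) * z v + cnj (w u) * w v)"
      "\<forall>u v. Complex (\<Psi>p (f p) [U p, differential N M f p u, differential N M f p v])
          (\<Psi>m (f p) [U p, differential N M f p u, differential N M f p v]) = z u * w v - z v * w u"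
      "\<forall>u\<in>tangent_space N p. \<forall>v\<in>tangent_space N p. \<forall>x\<in>tangent_space N p.
        Complex (\<Psi>p (f p) [differential N M f p u, differential N M f p v, differential N M f p x])
          (\<Psi>m (f p) [differential N M f p u, differential N M f p v, differential N M f p x]) =
        \<i> * (t u * (z v * w x - z x * w v) - t v * (z u * w x - z x * w u) + t x * (z u * w v - z v * w u))"
      using hypersurface_coordinates[OF assms(1,3,4,5) SU3 p] by (elim exE conjE) (rule that)
    note c = c[rule_format]
    have "\<omega>1 p [u, v] = Im (z u * w v - z v * w u)" "\<omega>2 p [u, v] = - Re (z u * w v - z v * w u)" for u v
      unfolding c(3)[symmetric] assms(8,9) by (simp_all add: contract_along_def form_minus_def)
    moreover have "pullback_form N M f \<Psi>p p [u, v, x] = - Im (t u * (z v * w x - z x * w v) -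
          t v * (z u * w x - z x * w u) + t x * (z u * w v - z v * w u))"
        "pullback_form N M f \<Psi>m p [u, v, x] = Re (t u * (z v * w x - z x * w v) -
          t v * (z u * w x - z x * w u) + t x * (z u * w v - z v * w u))"
      if "u \<in> tangent_space N p" "v \<in> tangent_space N p" "x \<in> tangent_space N p" for u v x
      using arg_cong[OF c(4)[OF that], of Re] arg_cong[OF c(4)[OF that], of Im]
      unfolding pullback_form_def by simp_all
    ultimately have "adapted_coordinates N \<eta> \<omega>1 \<omega>2 \<omega>3
        (pullback_form N M f \<Psi>p) (pullback_form N M f \<Psi>m) p t z w"
      using o c(1,2) unfolding adapted_coordinates_def assms(7,10)
      by (simp add: contract_along_def form_minus_def pullback_form_def)
    then show ?thesis by blast
  qed
  have len3: "\<exists>u v x. vs = [u, v, x] \<and> u \<in> tangent_space N p \<and> v \<in> tangent_space N p \<and> x \<in> tangent_space N p"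
    if "vs \<in> tangent_lists N 3 p" for vs p
    using that by (auto simp: tangent_lists_def numeral_3_eq_3 length_Suc_conv)
  have len4: "\<exists>u v x y. vs = [u, v, x, y] \<and> u \<in> tangent_space N p \<and> v \<in> tangent_space N p \<and>
      x \<in> tangent_space N p \<and> y \<in> tangent_space N p"
    if "vs \<in> tangent_lists N 4 p" for vs p
    using that by (auto simp: tangent_lists_def eval_nat_numeral length_Suc_conv)
  have "closed_form N 3 (wedge 2 1 \<omega>1 \<eta>)"
  proof (rule closed_form_cong[OF N _ smooth_form_pullback[OF s\<Psi>p] closed_form_pullback[OF s\<Psi>p closed(2)]])
    show "form_eq N ?P 3 (pullback_form N M f \<Psi>p) (wedge 2 1 \<omega>1 \<eta>)"
      unfolding form_eq_def
    proof (intro ballI)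
      fix p vs assume p: "p \<in> ?P" and vs: "vs \<in> tangent_lists N 3 p"
      obtain t z w where C: "adapted_coordinates N \<eta> \<omega>1 \<omega>2 \<omega>3
          (pullback_form N M f \<Psi>p) (pullback_form N M f \<Psi>m) p t z w"
        using coords[OF p] by blast
      note c = adapted_coordinatesD(2,3)[OF C] adapted_coordinatesD(6)[OF C]
      obtain u v x where l: "vs = [u, v, x]" "u \<in> tangent_space N p" "v \<in> tangent_space N p" "x \<in> tangent_space N p"
        using len3[OF vs] by blast
      show "pullback_form N M f \<Psi>p p vs = wedge 2 1 \<omega>1 \<eta> p vs"
        unfolding l(1) c(3)[OF l(2-4)]
        \<comment> \<open>The antisymmetry required by \<open>wedge_2_1\<close> comes from the same
          coordinate formula for \<open>\<omega>1\<close> as the identity itself.\<close>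
        by (subst wedge_2_1) (simp_all add: c(1,2) algebra_simps)
    qed
  qed
  moreover have "closed_form N 3 (wedge 2 1 \<omega>2 \<eta>)"
  proof (rule closed_form_cong[OF N _ smooth_form_pullback[OF s\<Psi>m] closed_form_pullback[OF s\<Psi>m closed(3)]])
    show "form_eq N ?P 3 (pullback_form N M f \<Psi>m) (wedge 2 1 \<omega>2 \<eta>)"
      unfolding form_eq_def
    proof (intro ballI)
      fix p vs assume p: "p \<in> ?P" and vs: "vs \<in> tangent_lists N 3 p"
      obtain t z w where C: "adapted_coordinates N \<eta> \<omega>1 \<omega>2 \<omega>3
          (pullback_form N M f \<Psi>p) (pullback_form N M f \<Psi>m) p t z w"
        using coords[OF p] by blast
      note c = adapted_coordinatesD(2,4)[OF C] adapted_coordinatesD(7)[OF C]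
      obtain u v x where l: "vs = [u, v, x]" "u \<in> tangent_space N p" "v \<in> tangent_space N p" "x \<in> tangent_space N p"
        using len3[OF vs] by blast
      show "pullback_form N M f \<Psi>m p vs = wedge 2 1 \<omega>2 \<eta> p vs"
        unfolding l(1) c(3)[OF l(2-4)]
        by (subst wedge_2_1) (simp_all add: c(1,2) algebra_simps)
    qed
  qed
  moreover have "closed_form N 4 (wedge 2 2 \<omega>3 \<omega>3)"
  proof -
    have sFF: "smooth_form M ?Q 4 (wedge 2 2 F F)" using smooth_form_wedge[OF M sF sF] by simp
    have "form_eq N ?P 4 (pullback_form N M f (wedge 2 2 F F)) (wedge 2 2 \<omega>3 \<omega>3)"
      unfolding form_eq_def assms(10) tangent_lists_def using pullback_form_wedge[of _ 2 2] by simp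
    from closed_form_cong[OF N this smooth_form_pullback[OF sFF] closed_form_pullback[OF sFF closed(1)]]
    show ?thesis .
  qed
  moreover have "SU2_structure N \<eta> \<omega>1 \<omega>2 \<omega>3"
  proof -
    let ?v = "wedge 2 2 \<omega>3 \<omega>3"
    \<comment> \<open>The forms are the standard triple on the complex plane with coordinates
      \<open>z\<close>, \<open>w\<close>: the Kaehler form \<open>\<omega>3\<close> and the parts of
      \<open>z \<and> w = - \<omega>2 + \<i> \<omega>1\<close>. The square of
      \<open>z \<and> w\<close> is zero, which relates \<open>\<omega>1\<close> and
      \<open>\<omega>2\<close>, and its product with \<open>\<omega>3\<close> vanishes by type. The
      common square is taken to be that of \<open>\<omega>3\<close>.\<close>
    have prods: "wedge 2 2 \<omega>1 \<omega>1 p vs = ?v p vs" "wedge 2 2 \<omega>2 \<omega>2 p vs = ?v p vs"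
      "wedge 2 2 \<omega>1 \<omega>2 p vs = 0" "wedge 2 2 \<omega>2 \<omega>1 p vs = 0"
      "wedge 2 2 \<omega>1 \<omega>3 p vs = 0" "wedge 2 2 \<omega>3 \<omega>1 p vs = 0"
      "wedge 2 2 \<omega>2 \<omega>3 p vs = 0" "wedge 2 2 \<omega>3 \<omega>2 p vs = 0"
      if p: "p \<in> ?P" and vs: "vs \<in> tangent_lists N 4 p" for p vs
    proof -
      obtain t z w where C: "adapted_coordinates N \<eta> \<omega>1 \<omega>2 \<omega>3
          (pullback_form N M f \<Psi>p) (pullback_form N M f \<Psi>m) p t z w"
        using coords[OF p] by blast
      note c = adapted_coordinatesD(3-5)[OF C]
      obtain u v x y where l: "vs = [u, v, x, y]" "u \<in> tangent_space N p" "v \<in> tangent_space N p"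
        "x \<in> tangent_space N p" "y \<in> tangent_space N p"
        using len4[OF vs] by blast
      have anti: "\<omega> p [b, a] = - \<omega> p [a, b]"
        if "\<omega> \<in> {\<omega>1, \<omega>2, \<omega>3}" "a \<in> {u, v, x, y}" "b \<in> {u, v, x, y}" for \<omega> a b
      proof -
        have "a \<in> tangent_space N p" "b \<in> tangent_space N p" using that l by blast+
        then show ?thesis using that(1) by (auto simp: c algebra_simps)
      qed
      have expand: "wedge 2 2 \<alpha> \<beta> p vs =
          \<alpha> p [u, v] * \<beta> p [x, y] - \<alpha> p [u, x] * \<beta> p [v, y] + \<alpha> p [u, y] * \<beta> p [v, x] +
          \<alpha> p [v, x] * \<beta> p [u, y] - \<alpha> p [v, y] * \<beta> p [u, x] + \<alpha> p [x, y] * \<beta> p [u, v]"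
        if "\<alpha> \<in> {\<omega>1, \<omega>2, \<omega>3}" "\<beta> \<in> {\<omega>1, \<omega>2, \<omega>3}" for \<alpha> \<beta>
        unfolding l(1) using anti[OF that(1)] anti[OF that(2)] by (rule wedge_2_2)
      show "wedge 2 2 \<omega>1 \<omega>1 p vs = ?v p vs" "wedge 2 2 \<omega>2 \<omega>2 p vs = ?v p vs"
        "wedge 2 2 \<omega>1 \<omega>2 p vs = 0" "wedge 2 2 \<omega>2 \<omega>1 p vs = 0"
        "wedge 2 2 \<omega>1 \<omega>3 p vs = 0" "wedge 2 2 \<omega>3 \<omega>1 p vs = 0"
        "wedge 2 2 \<omega>2 \<omega>3 p vs = 0" "wedge 2 2 \<omega>3 \<omega>2 p vs = 0"
        by (simp_all add: expand c l(2-5) algebra_simps)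
    qed
    have nondeg: "\<exists>vs\<in>tangent_lists N 5 p. wedge 4 1 ?v \<eta> p vs \<noteq> 0" if p: "p \<in> ?P" for p
    proof -
      let ?T = "tangent_space N p"
      obtain t z w where C: "adapted_coordinates N \<eta> \<omega>1 \<omega>2 \<omega>3
          (pullback_form N M f \<Psi>p) (pullback_form N M f \<Psi>m) p t z w"
        using coords[OF p] by blast
      note onto = adapted_coordinatesD(1)[OF C] and c = adapted_coordinatesD(2,5)[OF C]
      \<comment> \<open>\<open>e1\<close> to \<open>e4\<close> form the real standard basis of the
        \<open>z\<close>, \<open>w\<close> plane and annihilate \<open>\<eta>\<close>. Among their
        pairs in increasing order only \<open>\<omega>3(e1, e2)\<close> and
        \<open>\<omega>3(e3, e4)\<close> are nonzero, both equal to 1, so the square of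
        \<open>\<omega>3\<close> takes the value 2. Of \<open>e0\<close> only
        \<open>t e0 = 1\<close> matters.\<close>
      obtain e1 where 1: "e1 \<in> ?T" "t e1 = 0" "z e1 = 1" "w e1 = 0" using onto by blast
      obtain e2 where 2: "e2 \<in> ?T" "t e2 = 0" "z e2 = \<i>" "w e2 = 0" using onto by blast
      obtain e3 where 3: "e3 \<in> ?T" "t e3 = 0" "z e3 = 0" "w e3 = 1" using onto by blast
      obtain e4 where 4: "e4 \<in> ?T" "t e4 = 0" "z e4 = 0" "w e4 = \<i>" using onto by blast
      obtain e0 where 0: "e0 \<in> ?T" "t e0 = 1" using onto by blast
      let ?vs = "[e1, e2, e3, e4, e0]"
      have anti: "\<omega>3 p [b, a] = - \<omega>3 p [a, b]" if "a \<in> {e1, e2, e3, e4}" "b \<in> {e1, e2, e3, e4}" for a b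
      proof -
        have "a \<in> ?T" "b \<in> ?T" using that 1(1) 2(1) 3(1) 4(1) by blast+
        then show ?thesis by (simp add: c(2) algebra_simps)
      qed
      have "?v p [e1, e2, e3, e4] =
          \<omega>3 p [e1, e2] * \<omega>3 p [e3, e4] - \<omega>3 p [e1, e3] * \<omega>3 p [e2, e4] + \<omega>3 p [e1, e4] * \<omega>3 p [e2, e3] +
          \<omega>3 p [e2, e3] * \<omega>3 p [e1, e4] - \<omega>3 p [e2, e4] * \<omega>3 p [e1, e3] + \<omega>3 p [e3, e4] * \<omega>3 p [e1, e2]"
        using anti anti by (rule wedge_2_2)
      then have "?v p [e1, e2, e3, e4] = 2" by (simp add: c(2) 1 2 3 4)
      moreover have "wedge 4 1 ?v \<eta> p ?vs = ?v p (take 4 ?vs) * \<eta> p [?vs ! 4]"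
      proof (rule wedge_4_1)
        fix i :: nat assume "i < 4"
        then have "i = 0 \<or> i = 1 \<or> i = 2 \<or> i = 3" by linarith
        then show "\<eta> p [?vs ! i] = 0" by (auto simp: c(1) 1 2 3 4)
      qed simp
      ultimately have "wedge 4 1 ?v \<eta> p ?vs \<noteq> 0" by (simp add: c(1) 0)
      moreover have "?vs \<in> tangent_lists N 5 p" by (simp add: tangent_lists_def 0 1 2 3 4)
      ultimately show ?thesis by blast
    qed
    have pos: "0 \<le> \<omega>2 p [X, Y]"
      if p: "p \<in> ?P" and X: "X \<in> tangent_space N p" and Y: "Y \<in> tangent_space N p"
        and eq: "\<And>Z. Z \<in> tangent_space N p \<Longrightarrow> \<omega>3 p [X, Z] = \<omega>1 p [Y, Z]" for p X Y
    proof -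
      let ?T = "tangent_space N p"
      obtain t z w where C: "adapted_coordinates N \<eta> \<omega>1 \<omega>2 \<omega>3
          (pullback_form N M f \<Psi>p) (pullback_form N M f \<Psi>m) p t z w"
        using coords[OF p] by blast
      note onto = adapted_coordinatesD(1)[OF C] and c = adapted_coordinatesD(3-5)[OF C]
      have E: "Im (cnj (z X) * x + cnj (w X) * y) = Im (z Y * y - x * w Y)" for x y
      proof -
        obtain Z where "Z \<in> ?T" "z Z = x" "w Z = y" using onto by blast
        then show ?thesis using eq[of Z] c(1)[of Y Z] c(3)[OF X, of Z] by simp
      qed
      \<comment> \<open>Testing on the four real basis vectors of the \<open>z\<close>,
        \<open>w\<close> plane determines \<open>Y\<close> from \<open>X\<close> there. With these
        values \<open>\<omega>2(X, Y)\<close> becomes the squared length of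
        \<open>(z X, w X)\<close>.\<close>
      have "w Y = - cnj (z X)" "z Y = cnj (w X)"
        using E[of 1 0] E[of \<i> 0] E[of 0 1] E[of 0 \<i>] by (simp_all add: complex_eq_iff)
      then have "\<omega>2 p [X, Y] = (Re (z X))\<^sup>2 + (Im (z X))\<^sup>2 + (Re (w X))\<^sup>2 + (Im (w X))\<^sup>2"
        by (simp add: c(2) power2_eq_square)
      then show ?thesis by simp
    qed
    have "\<forall>i\<in>{1..3::nat}. smooth_form N ?P 2 (if i = 1 then \<omega>1 else if i = 2 then \<omega>2 else \<omega>3)"
      using s1 s2 s3 by simp
    moreover have "{1..3} = {1, 2, 3 :: nat}" by auto
    then have "\<forall>i\<in>{1..3::nat}. \<forall>j\<in>{1..3::nat}. form_eq N ?P 4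
        (wedge 2 2 (if i = 1 then \<omega>1 else if i = 2 then \<omega>2 else \<omega>3)
          (if j = 1 then \<omega>1 else if j = 2 then \<omega>2 else \<omega>3)) (if i = j then ?v else zero_form)"
      using prods by (simp add: form_eq_def zero_form_def)
    ultimately show ?thesis
      unfolding SU2_structure_def Let_def using s\<eta> s4 nondeg pos by blast
  qed
  ultimately show ?thesis by (simp add: balanced_SU2_structure_def)
qed

end
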